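(* Let $k\ge 1$, $\boldsymbol{\mu}\in\mathbb{R}^k$, $\boldsymbol{\Sigma}\in S_k$, $\nu>0$ and $\boldsymbol{\mathcal V}=(\boldsymbol{\mu},\boldsymbol{\Sigma},\nu)$. The multivariate Student $t$ family $\{\mathrm{P}^{(n)}_{\boldsymbol{\mathcal V}}\mid \boldsymbol{\mathcal V}\in\mathbb{R}^k\times S_k\times(0,\infty)\}$ is uniformly locally asymptotically normal (ULAN) at $\boldsymbol{\mathcal V}$ with central sequence $\boldsymbol{\Delta}^{(n)}(\boldsymbol{\mathcal V})=\frac{1}{\sqrt n}\sum_{j=1}^n\boldsymbol{\mathcal L}_{\boldsymbol{\mathcal V}}(\boldsymbol X_j)$ and information matrix $\boldsymbol{\Gamma}(\boldsymbol{\mathcal V})$. More precisely, for any (deterministic) sequence $\boldsymbol{\mathcal V}^{(n)}=(\boldsymbol{\mu}^{(n)},\boldsymbol{\Sigma}^{(n)},\nu^{(n)})\in\mathbb{R}^k\times S_k\times(0,\infty)$ with $\boldsymbol{\mathcal V}^{(n)}=\boldsymbol{\mathcal V}+O(n^{-1/2})$, and any bounded sequence $\boldsymbol{\tau}^{(n)}=(\boldsymbol{\tau}^{(n)}_1,\boldsymbol{\tau}^{(n)}_2,\tau^{(n)}_3)\in\mathbb{R}^k\times M_k\times\mathbb{R}$ such that $\boldsymbol{\Sigma}^{(n)}+n^{-1/2}\boldsymbol{\tau}_2^{(n)}\in S_k$ and $\nu^{(n)}+n^{-1/2}\tau_3^{(n)}>0$, writing $\mathcal T^{(n)}:=((\boldsymbol{\tau}^{(n)}_1)',(\mathrm{vech}(\boldsymbol{\tau}_2^{(n)}))',\tau_3^{(n)})'$,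 we have $$\log\frac{\mathrm d\mathrm P^{(n)}_{\boldsymbol{\mathcal V}^{(n)}+n^{-1/2}\boldsymbol{\tau}^{(n)}}}{\mathrm d\mathrm P^{(n)}_{\boldsymbol{\mathcal V}^{(n)}}}(\boldsymbol X_1,\dots,\boldsymbol X_n)=(\mathcal T^{(n)})'\boldsymbol{\Delta}^{(n)}(\boldsymbol{\mathcal V}^{(n)})-\frac12(\mathcal T^{(n)})'\boldsymbol{\Gamma}(\boldsymbol{\mathcal V})\mathcal T^{(n)}+o_{\mathrm P}(1)$$ and $$\boldsymbol{\Delta}^{(n)}(\boldsymbol{\mathcal V}^{(n)})\stackrel{\mathcal L}{\longrightarrow}\mathcal N_{k+k(k+1)/2+1}\big(\boldsymbol 0,\boldsymbol{\Gamma}(\boldsymbol{\mathcal V})\big),$$ both under $\mathrm P^{(n)}_{\boldsymbol{\mathcal V}^{(n)}}$ as $n\to\infty$.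
   Context: $M_k$ is the set of real $k\times k$ matrices and $S_k\subset M_k$ the set of symmetric positive definite ones. For $\boldsymbol{\mathcal V}=(\boldsymbol{\mu},\boldsymbol{\Sigma},\nu)\in\mathbb{R}^k\times S_k\times(0,\infty)$, the $k$-dimensional Student $t$ density is $$f_{\boldsymbol{\mu},\boldsymbol{\Sigma},\nu}(\boldsymbol x)=c_{\nu,k}|\boldsymbol{\Sigma}|^{-1/2}\left(1+\|\boldsymbol{\Sigma}^{-1/2}(\boldsymbol x-\boldsymbol{\mu})\|^2/\nu\right)^{-\frac{\nu+k}{2}},\qquad c_{\nu,k}=\frac{\Gamma(\frac{\nu+k}{2})}{(\pi\nu)^{k/2}\Gamma(\frac{\nu}{2})}.$$ $\mathrm P^{(n)}_{\boldsymbol{\mathcal V}}$ is the joint distribution of $n$ i.i.d. random vectors $\boldsymbol X_1,\dots,\boldsymbol X_n$ with density $f_{\boldsymbol{\mu},\boldsymbol{\Sigma},\nu}$. For $\boldsymbol A\in M_k$, $\mathrm{vech}(\boldsymbol A)$ is the $k(k+1)/2$-vector formed by the entries of $\boldsymbol A$ on and above the diagonal (in the order in which they appear when stacking columns). A symmetric matrix is identified with its vech, which serves as free coordinates. The score vector is $$\boldsymbol{\mathcal L}_{\boldsymbol{\mathcal V}}(\boldsymbol x)=\begin{pmatrix}\nabla_{\boldsymbol{\mu}}\log f_{\boldsymbol{\mu},\boldsymbol{\Sigma},\nu}(\boldsymbol x)\\ \nabla_{\mathrm{vech}(\boldsymbol{\Sigma})}\log f_{\boldsymbol{\mu},\boldsymbol{\Sigma},\nu}(\boldsymbol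 x)\\ \partial_\nu\log f_{\boldsymbol{\mu},\boldsymbol{\Sigma},\nu}(\boldsymbol x)\end{pmatrix}\in\mathbb{R}^{k+k(k+1)/2+1},$$ and $\boldsymbol{\Gamma}(\boldsymbol{\mathcal V})$ is the Fisher information matrix, i.e. the covariance matrix of $\boldsymbol{\mathcal L}_{\boldsymbol{\mathcal V}}(\boldsymbol X)$ when $\boldsymbol X$ has density $f_{\boldsymbol{\mu},\boldsymbol{\Sigma},\nu}$; it is known to be finite and non-singular for every $\boldsymbol{\mathcal V}$. Triples are added componentwise: $(\boldsymbol{\mu}_1,\boldsymbol{\Sigma}_1,\nu_1)+(\boldsymbol{\mu}_2,\boldsymbol{\Sigma}_2,\nu_2)=(\boldsymbol{\mu}_1+\boldsymbol{\mu}_2,\boldsymbol{\Sigma}_1+\boldsymbol{\Sigma}_2,\nu_1+\nu_2)$. A prime denotes transpose. "ULAN" here means exactly the displayed expansion and convergence. *)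

theory Defs
  imports "HOL-Probability.Probability" "HOL-Library.Landau_Symbols"
begin

section \<open>Symmetric matrices and their half-vectorization\<close>

type_synonym 'k rvec = "real^'k"
type_synonym 'k rmat = "real^'k^'k"

definition spd :: "('k::finite) rmat set" where
  "spd = {A. transpose A = A \<and> (\<forall>x. x \<noteq> 0 \<longrightarrow> 0 < x \<bullet> (A *v x))}"

text \<open>The symmetric positive definite matrix $A^{-1/2}$.\<close>

definition inv_sqrt :: "('k::finite) rmat \<Rightarrow> 'k rmat" where
  "inv_sqrt A = (THE B. B \<in> spd \<and> B ** B = matrix_inv A)"

text \<open>
  Vectors of length $k(k+1)/2$ are indexed by the positions $(i,j)$, $i \le j$, on and above the
  diagonal. The order in which these positions are listed is immaterial, since every vector and
  matrix below uses the same index type.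
\<close>

typedef (overloaded) ('k::linorder) vech_index = "{(i, j). (i::'k) \<le> j}"
  by blast

instance vech_index :: ("{finite,linorder}") finite
proof
  have "range (Rep_vech_index :: 'a vech_index \<Rightarrow> 'a \<times> 'a) \<subseteq> UNIV"
    by simp
  then show "finite (UNIV :: 'a vech_index set)"
    by (metis Rep_vech_index_inject finite finite_imageD injI)
qed

definition vech :: "('k::{finite,linorder}) rmat \<Rightarrow> 'k vech_index rvec" where
  "vech A = (\<chi> p. A $ fst (Rep_vech_index p) $ snd (Rep_vech_index p))"

text \<open>The symmetric matrix with prescribed half-vectorization.\<close>

definition unvech :: "('k::{finite,linorder}) vech_index rvec \<Rightarrow> 'k rmat" where
  "unvech s = (\<chi> i j. s $ Abs_vech_index (min i j, max i j))"

lemma transpose_unvech: "transpose (unvech s) = unvech s"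
  by (simp add: transpose_def unvech_def vec_eq_iff min.commute max.commute)

lemma vech_unvech: "vech (unvech s) = s"
proof -
  have "Abs_vech_index (min (fst (Rep_vech_index p)) (snd (Rep_vech_index p)),
          max (fst (Rep_vech_index p)) (snd (Rep_vech_index p))) = p"
    for p :: "'a vech_index"
    using Rep_vech_index[of p] Rep_vech_index_inverse[of p]
    by (auto simp: min_def max_def split: prod.splits)
  then show ?thesis
    by (simp add: vech_def unvech_def vec_eq_iff)
qed

lemma unvech_vech:
  assumes "transpose A = A"
  shows "unvech (vech A) = A"
proof -
  have "A $ min i j $ max i j = A $ i $ j" for i j
    using arg_cong[OF assms, of "\<lambda>B. B $ i $ j"]
    by (auto simp: min_def max_def transpose_def)
  moreover have "Rep_vech_index (Abs_vech_index (min i j, max i j)) = (min i j, max i j)"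
    for i j :: 'a
    by (rule Abs_vech_index_inverse) (auto simp: min_def max_def)
  ultimately show ?thesis
    by (simp add: vech_def unvech_def vec_eq_iff)
qed


section \<open>The multivariate Student t family\<close>

type_synonym 'k param = "'k rvec \<times> 'k rmat \<times> real"

definition param_space :: "'k::finite param set" where
  "param_space = UNIV \<times> spd \<times> {0<..}"

definition student_const :: "real \<Rightarrow> real \<Rightarrow> real" where
  "student_const \<nu> k = Gamma ((\<nu> + k) / 2) / ((pi * \<nu>) powr (k / 2) * Gamma (\<nu> / 2))"

fun student_density :: "'k::finite param \<Rightarrow> 'k rvec \<Rightarrow> real" where
  "student_density (\<mu>, \<Sigma>, \<nu>) x =
     student_const \<nu> (real CARD('k)) * det \<Sigma> powr (- 1 / 2)
     * (1 + (norm (inv_sqrt \<Sigma> *v (x - \<mu>)))\<^sup>2 / \<nu>) powr (- (\<nu> + real CARD('k)) / 2)"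

definition student_t :: "'k::finite param \<Rightarrow> 'k rvec measure" where
  "student_t V = density lborel (\<lambda>x. ennreal (student_density V x))"

text \<open>The joint law of $n$ i.i.d. observations; the observation $X_j$ is the map
  \<open>\<lambda>\<omega>. \<omega> j\<close>.\<close>

definition student_sample :: "nat \<Rightarrow> 'k::finite param \<Rightarrow> (nat \<Rightarrow> 'k rvec) measure" where
  "student_sample n V = (\<Pi>\<^sub>M j\<in>{1..n}. student_t V)"


section \<open>Score, central sequence and Fisher information\<close>

type_synonym 'k coord = "'k + 'k vech_index + unit"

definition stack ::
  "('k::{finite,linorder}) rvec \<Rightarrow> 'k vech_index rvec \<Rightarrow> real \<Rightarrow> 'k coord rvec" where
  "stack a b c = (\<chi> d. case d of Inl i \<Rightarrow> a $ i | Inr (Inl p) \<Rightarrow> b $ p | Inr (Inr _) \<Rightarrow> c)"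

definition grad :: "(real^'d \<Rightarrow> real) \<Rightarrow> real^'d \<Rightarrow> real^'d" where
  "grad g x = (\<chi> i. deriv (\<lambda>h. g (x + h *\<^sub>R axis i 1)) 0)"

text \<open>The derivative in \<open>\<Sigma>\<close> is taken in the free coordinates \<open>vech \<Sigma>\<close>, so an off-diagonal
  coordinate moves both matching entries of \<open>\<Sigma>\<close>.\<close>

fun score :: "'k::{finite,linorder} param \<Rightarrow> 'k rvec \<Rightarrow> 'k coord rvec" where
  "score (\<mu>, \<Sigma>, \<nu>) x = stack
     (grad (\<lambda>m. ln (student_density (m, \<Sigma>, \<nu>) x)) \<mu>)
     (grad (\<lambda>s. ln (student_density (\<mu>, unvech s, \<nu>) x)) (vech \<Sigma>))
     (deriv (\<lambda>v. ln (student_density (\<mu>, \<Sigma>, v) x)) \<nu>)"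

definition covariance_matrix :: "'a measure \<Rightarrow> ('a \<Rightarrow> real^'d) \<Rightarrow> real^'d^'d" where
  "covariance_matrix M Y = (\<chi> a b. \<integral>\<omega>. (Y \<omega> $ a - (\<integral>\<omega>'. Y \<omega>' $ a \<partial>M))
                                     * (Y \<omega> $ b - (\<integral>\<omega>'. Y \<omega>' $ b \<partial>M)) \<partial>M)"

definition fisher_info :: "'k::{finite,linorder} param \<Rightarrow> 'k coord rmat" where
  "fisher_info V = covariance_matrix (student_t V) (score V)"

definition central_seq ::
  "nat \<Rightarrow> 'k::{finite,linorder} param \<Rightarrow> (nat \<Rightarrow> 'k rvec) \<Rightarrow> 'k coord rvec" where
  "central_seq n V \<omega> = (1 / sqrt (real n)) *\<^sub>R (\<Sum>j=1..n. score V (\<omega> j))"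

fun direction :: "'k::{finite,linorder} param \<Rightarrow> 'k coord rvec" where
  "direction (\<tau>\<^sub>1, \<tau>\<^sub>2, \<tau>\<^sub>3) = stack \<tau>\<^sub>1 (vech \<tau>\<^sub>2) \<tau>\<^sub>3"


section \<open>Likelihood ratios and stochastic convergence\<close>

definition log_lr :: "'a measure \<Rightarrow> 'a measure \<Rightarrow> 'a \<Rightarrow> real" where
  "log_lr Q P \<omega> = ln (enn2real (RN_deriv P Q \<omega>))"

text \<open>Measurability is demanded explicitly below, because \<open>measure\<close> and the Bochner integral are
  0 by convention on non-measurable arguments.\<close>

definition small_oP :: "(nat \<Rightarrow> 'a measure) \<Rightarrow> (nat \<Rightarrow> 'a \<Rightarrow> real) \<Rightarrow> bool" where
  "small_oP M R \<longleftrightarrow>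
     (\<forall>\<^sub>F n in sequentially. R n \<in> borel_measurable (M n)) \<and>
     (\<forall>\<epsilon>>0. (\<lambda>n. measure (M n) {\<omega> \<in> space (M n). \<epsilon> < \<bar>R n \<omega>\<bar>}) \<longlonglongrightarrow> 0)"

definition conv_in_law ::
  "(nat \<Rightarrow> 'a measure) \<Rightarrow> (nat \<Rightarrow> 'a \<Rightarrow> real^'d) \<Rightarrow> (real^'d) measure \<Rightarrow> bool" where
  "conv_in_law M Y N \<longleftrightarrow>
     (\<forall>\<^sub>F n in sequentially. Y n \<in> borel_measurable (M n)) \<and>
     (\<forall>g :: real^'d \<Rightarrow> real. continuous_on UNIV g \<longrightarrow> bounded (range g) \<longrightarrow>
        (\<lambda>n. \<integral>\<omega>. g (Y n \<omega>) \<partial>M n) \<longlonglongrightarrow> (\<integral>y. g y \<partial>N))"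

text \<open>The multivariate normal law, for non-singular covariance matrix \<open>S\<close>.\<close>

definition mvnormal :: "real^'d \<Rightarrow> real^'d^'d \<Rightarrow> (real^'d) measure" where
  "mvnormal m S = density lborel (\<lambda>y. ennreal
     ((2 * pi) powr (- real CARD('d) / 2) * det S powr (- 1 / 2)
      * exp (- ((y - m) \<bullet> (matrix_inv S *v (y - m))) / 2)))"

end

theory Submission imports Defs begin

text \<open>
  The expansion uses first derivatives only. On a neighbourhood of \<open>V\<close> the log density is, up to
  the weight \<open>1 + ln (1 + |x|\<^sup>2)\<close>, differentiable in the parameter with a remainder that is
  quadratic uniformly in \<open>x\<close>, and this weight has uniformly bounded exponential moments. So with
  \<open>\<theta> = V\<^sub>n\<close> and \<open>r = ln (f\<^sub>\<theta>\<^sub>' / f\<^sub>\<theta>)\<close> for \<open>\<theta>' = \<theta> + \<tau> / sqrt n\<close>, the difference \<open>q\<close> of \<open>r\<close> and its linear part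
  is \<open>O(1/n)\<close> in every moment; hence the sum of the \<open>q(X\<^sub>j)\<close> is close to its mean by
  Chebyshev's inequality, and the mean is \<open>- \<tau>'\<Gamma>\<tau> / 2 + o(1)\<close> because \<open>E exp r = 1\<close> gives
  \<open>E r = - E r\<^sup>2 / 2 + O(E |r|\<^sup>3)\<close>. The same normalization along a ray shows that the score is
  centred. The central sequence is treated with characteristic functions and a continuity theorem,
  which follows from smoothing by a Gaussian. The limit law has a density because the score
  components are linearly independent functions of \<open>x\<close>.
\<close>

section \<open>Symmetric matrices\<close>

text \<open>The tails are the obstacle. With few degrees of freedom an observation need not even
  have a mean, so no estimate may contain a power of |x|. Relative to 1 + |x|^2, however, the
  quadratic form in the density and its parameter derivative stay bounded, so the log density, its
  derivative and its remainder cost only a logarithm; exponential moments of that logarithm are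
  small powers of 1 + |x|^2, and small enough powers are integrable. The second obstacle is the
  moving base point: the law of one observation changes with n, hence every constant has to be
  uniform near \<open>V\<close>, and the information at \<open>Vn n\<close>, which the expansion
  produces, is exchanged for the one at \<open>V\<close> by dominated convergence. Finally, the
  scatter part of the direction is formally an arbitrary matrix, but it is a multiple of a
  difference of two symmetric matrices. So all derivatives are taken along symmetric displacements,
  and one linear map translates them into vech coordinates.\<close>

lemma symmetric_inner:
  fixes A :: "real^'n^'n"
  assumes "transpose A = A"
  shows "x \<bullet> (A *v y) = (A *v x) \<bullet> y"
  by (metis assms dot_lmul_matrix transpose_matrix_vector)

lemma symmetric_matrixI:
  fixes A :: "real^'n^'n"
  assumes "\<And>x y. x \<bullet> (A *v y) = (A *v x) \<bullet> y"
  shows "transpose A = A"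
proof -
  have "(transpose A *v x) \<bullet> y = (A *v x) \<bullet> y" for x y
    by (metis assms dot_lmul_matrix transpose_matrix_vector)
  then have "transpose A *v x = A *v x" for x
    using vector_eq_rdot by blast
  then show ?thesis by (simp add: matrix_eq)
qed

lemma spd_symmetric: "A \<in> spd \<Longrightarrow> transpose A = A"
  by (simp add: spd_def)

lemma spd_pos: "A \<in> spd \<Longrightarrow> x \<noteq> 0 \<Longrightarrow> 0 < x \<bullet> (A *v x)"
  by (simp add: spd_def)

section \<open>Spectral theorem for symmetric matrices\<close>

text \<open>A maximizer \<open>v\<close> of the quadratic form on the unit sphere of
  \<open>S\<close> works. If the residual \<open>w\<close> of the eigenvalue equation were nonzero,
  moving from \<open>v\<close> towards \<open>w\<close> would raise the Rayleigh quotient to first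
  order. Invariance keeps \<open>w\<close> in \<open>S\<close>, where maximality can be
  tested.\<close>

lemma symmetric_eigenvector:
  fixes A :: "real^'n^'n"
  assumes sym: "transpose A = A" and S: "subspace S" "S \<noteq> {0}" and inv: "\<And>x. x \<in> S \<Longrightarrow> A *v x \<in> S"
  obtains v c where "v \<in> S" "norm v = 1" "A *v v = c *\<^sub>R v"
proof -
  obtain u where u: "u \<in> S" "u \<noteq> 0"
    using S subspace_0 by blast
  let ?K = "S \<inter> sphere 0 1"
  have "compact ?K"
    by (intro closed_Int_compact closed_subspace S) simp
  moreover have "(1 / norm u) *\<^sub>R u \<in> ?K"
    using u S by (auto intro: subspace_scale)
  moreover have "continuous_on ?K (\<lambda>x. x \<bullet> (A *v x))"
    by (intro continuous_intros linear_continuous_on) simp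
  ultimately obtain v where v: "v \<in> ?K" "\<And>x. x \<in> ?K \<Longrightarrow> x \<bullet> (A *v x) \<le> v \<bullet> (A *v v)"
    using continuous_attains_sup[of ?K "\<lambda>x. x \<bullet> (A *v x)"] by blast
  define c where "c = v \<bullet> (A *v v)"
  have vS: "v \<in> S" and nv: "norm v = 1" and vv: "v \<bullet> v = 1"
    using v(1) by (auto simp: norm_eq_1)
  have le: "x \<bullet> (A *v x) \<le> c * (x \<bullet> x)" if "x \<in> S" for x
  proof (cases "x = 0")
    case False
    have "(1 / norm x) *\<^sub>R x \<in> ?K"
      using that False S by (auto intro: subspace_scale)
    from v(2)[OF this] have "(x \<bullet> (A *v x)) / (norm x)^2 \<le> c"
      by (simp add: c_def matrix_vector_mult_scaleR power2_eq_square)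
    then have "x \<bullet> (A *v x) \<le> c * (norm x)^2"
      using False by (simp add: divide_le_eq)
    then show ?thesis
      by (simp only: power2_norm_eq_inner)
  qed simp
  define w where "w = A *v v - c *\<^sub>R v"
  have wS: "w \<in> S"
    unfolding w_def by (intro subspace_diff subspace_scale S inv vS)
  have wv: "w \<bullet> v = 0"
    unfolding w_def inner_diff_left inner_scaleR_left vv c_def inner_commute[of v "A *v v"] by simp
  have wAv: "w \<bullet> (A *v v) = w \<bullet> w"
  proof -
    have "w \<bullet> w = w \<bullet> (A *v v) - c * (w \<bullet> v)"
      unfolding w_def by (simp only: inner_diff_right inner_scaleR_right)
    with wv show ?thesis by simp
  qed
  \<comment> \<open>Maximality tested at \<open>v + t *\<^sub>R w\<close>: the constant terms
    cancel, so a term linear in \<open>t\<close> is dominated by a quadratic one for every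
    \<open>t\<close>.\<close>
  have ineq: "2 * t * (w \<bullet> w) \<le> t^2 * (c * (w \<bullet> w) - w \<bullet> (A *v w))" for t
  proof -
    have "v + t *\<^sub>R w \<in> S"
      by (intro subspace_add subspace_scale S vS wS)
    from le[OF this]
    have "v \<bullet> (A *v v) + t * (v \<bullet> (A *v w)) + t * (w \<bullet> (A *v v)) + t * t * (w \<bullet> (A *v w))
        \<le> c * (v \<bullet> v + t * (v \<bullet> w) + t * (w \<bullet> v) + t * t * (w \<bullet> w))"
      by (simp add: matrix_vector_right_distrib matrix_vector_mult_scaleR inner_add_left inner_add_right
            distrib_left mult.assoc)
    moreover have "v \<bullet> (A *v w) = w \<bullet> w"
      using symmetric_inner[OF sym, of v w] wAv by (simp only: inner_commute[of "A *v v" w])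
    moreover have "v \<bullet> w = 0" using wv by (simp only: inner_commute[of v w])
    ultimately have "c + t * (w \<bullet> w) + t * (w \<bullet> w) + t * t * (w \<bullet> (A *v w)) \<le> c * (1 + t * 0 + t * 0 + t * t * (w \<bullet> w))"
      by (simp only: c_def[symmetric] wv wAv vv)
    then show ?thesis
      by (simp add: algebra_simps power2_eq_square)
  qed
  define W where "W = w \<bullet> w"
  have "W \<le> 0"
  proof (rule ccontr)
    assume "\<not> W \<le> 0"
    then have ww: "W > 0" by linarith
    \<comment> \<open>A strictly positive bound of the quadratic coefficient; at
      \<open>t = W / d\<close> the inequality would give 2 W^2 / d at most W^2 / d.\<close>
    define d where "d = \<bar>c * W - w \<bullet> (A *v w)\<bar> + 1"
    have d: "d > 0" "c * W - w \<bullet> (A *v w) \<le> d" by (auto simp: d_def)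
    have "2 * (W / d) * W \<le> (W / d)^2 * d"
      by (rule order_trans[OF ineq[folded W_def]]) (intro mult_left_mono d zero_le_power2)
    then show False
      using ww d(1) by (simp add: field_simps power2_eq_square)
  qed
  then have "w = 0" 
    using inner_ge_zero[of w] inner_eq_zero_iff[of w] unfolding W_def by linarith
  then show ?thesis
    using that[of v c] vS nv by (simp add: w_def)
qed

text \<open>Induction on the dimension: after an eigenvector \<open>v\<close> is split off, the
  vectors of \<open>S\<close> orthogonal to \<open>v\<close> are again invariant, because symmetry
  moves \<open>A\<close> onto \<open>v\<close> in the inner product.\<close>

lemma symmetric_eigenbasis_subspace:
  fixes A :: "real^'n^'n"
  assumes sym: "transpose A = A" and "subspace S" and "\<And>x. x \<in> S \<Longrightarrow> A *v x \<in> S"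
  shows "\<exists>B. finite B \<and> pairwise orthogonal B \<and> (\<forall>b\<in>B. norm b = 1) \<and> span B = S
            \<and> (\<forall>b\<in>B. \<exists>c. A *v b = c *\<^sub>R b)"
  using assms(2,3)
proof (induction "dim S" arbitrary: S rule: less_induct)
  case less
  show ?case
  proof (cases "S = {0}")
    case True
    then show ?thesis by (intro exI[of _ "{}"]) auto
  next
    case False
    obtain v c where v: "v \<in> S" "norm v = 1" "A *v v = c *\<^sub>R v"
      using symmetric_eigenvector[OF sym less.prems(1) False less.prems(2)] by blast
    then have vv: "v \<bullet> v = 1" by (simp add: norm_eq_1)
    let ?T = "{x \<in> S. v \<bullet> x = 0}"
    have sT: "subspace ?T"
      using less.prems(1) by (auto simp: subspace_def inner_add_right)
    have "v \<notin> span ?T"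
    proof
      assume "v \<in> span ?T"
      then have "v \<in> ?T" unfolding span_eq_iff[THEN iffD2, OF sT] .
      then show False using vv by simp
    qed
    moreover have "v \<in> span S" "span ?T \<subseteq> span S"
      by (rule span_base[OF v(1)], rule span_mono) blast
    ultimately have "span ?T \<subset> span S"
      by auto
    then have "dim ?T < dim S"
      by (rule dim_psubset)
    moreover have "A *v x \<in> ?T" if "x \<in> ?T" for x
    proof -
      have "v \<bullet> (A *v x) = 0"
        using that by (simp add: symmetric_inner[OF sym] v(3))
      then show ?thesis using that less.prems(2) by blast
    qed
    ultimately obtain B where B: "finite B" "pairwise orthogonal B" "\<forall>b\<in>B. norm b = 1" "span B = ?T"
        "\<forall>b\<in>B. \<exists>c. A *v b = c *\<^sub>R b"
      using less.hyps[OF _ sT] by blast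
    have BT: "b \<in> ?T" if "b \<in> B" for b
      using that B(4) span_superset by blast
    have "span (insert v B) = S"
    proof
      show "span (insert v B) \<subseteq> S"
        using BT v(1) by (intro span_minimal less.prems(1)) auto
      show "S \<subseteq> span (insert v B)"
      proof
        fix x assume x: "x \<in> S"
        have "x - (v \<bullet> x) *\<^sub>R v \<in> S"
          using x v(1) less.prems(1) by (intro subspace_diff subspace_scale)
        moreover have "v \<bullet> (x - (v \<bullet> x) *\<^sub>R v) = 0"
          by (simp add: inner_diff_right inner_scaleR_right vv)
        ultimately have "x - (v \<bullet> x) *\<^sub>R v \<in> ?T"
          by blast
        then have "x - (v \<bullet> x) *\<^sub>R v \<in> span (insert v B)"
          using B(4) span_mono[of B "insert v B"] by auto
        moreover have "(v \<bullet> x) *\<^sub>R v \<in> span (insert v B)"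
          by (intro span_scale span_base) simp
        ultimately show "x \<in> span (insert v B)"
          using span_add by fastforce
      qed
    qed
    moreover have "pairwise orthogonal (insert v B)"
    proof -
      have "orthogonal v b \<and> orthogonal b v" if "b \<in> B" for b
        using BT[OF that] orthogonal_commute[of v b] by (simp add: orthogonal_def)
      then show ?thesis using B(2) by (simp add: pairwise_insert)
    qed
    ultimately show ?thesis
      using B v by (intro exI[of _ "insert v B"]) auto
  qed
qed

lemma symmetric_eigenbasis:
  fixes A :: "real^'n^'n"
  assumes "transpose A = A"
  obtains B c where "finite B" "pairwise orthogonal B" "\<And>b. b \<in> B \<Longrightarrow> norm b = 1" "span B = UNIV"
    "\<And>b. b \<in> B \<Longrightarrow> A *v b = c b *\<^sub>R b"
proof -
  have "\<exists>B. finite B \<and> pairwise orthogonal B \<and> (\<forall>b\<in>B. norm b = 1) \<and> span B = UNIV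
            \<and> (\<forall>b\<in>B. \<exists>c. A *v b = c *\<^sub>R b)"
    using symmetric_eigenbasis_subspace[OF assms, of UNIV] by simp
  then show ?thesis
    using that by metis
qed

section \<open>Square roots of positive definite matrices\<close>

text \<open>The root multiplies each vector of an orthonormal eigenbasis by the square root of its
  eigenvalue; \<open>r\<close> writes this through the expansion coefficients.\<close>

lemma spd_sqrt_exists:
  fixes A :: "real^'n^'n"
  assumes A: "A \<in> spd"
  obtains R where "R \<in> spd" "R ** R = A"
proof -
  obtain B c where B: "finite B" "pairwise orthogonal B" "\<And>b. b \<in> B \<Longrightarrow> norm b = 1" "span B = UNIV"
    "\<And>b. b \<in> B \<Longrightarrow> A *v b = c b *\<^sub>R b"
    using symmetric_eigenbasis[OF spd_symmetric[OF A]] by blast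
  have ex: "(\<Sum>b\<in>B. (x \<bullet> b) *\<^sub>R b) = x" for x
    using orthonormal_basis_expand[OF B(2,3) _ B(1)] B(4) by blast
  have c: "c b > 0" if "b \<in> B" for b
  proof -
    have "b \<noteq> 0" using B(3)[OF that] by auto
    from spd_pos[OF A this] show ?thesis
      using B(3)[OF that] by (simp add: B(5)[OF that] norm_eq_1)
  qed
  have orth: "b \<bullet> b' = (if b = b' then 1 else 0)" if "b \<in> B" "b' \<in> B" for b b'
    using that B(2,3) by (auto simp: pairwise_def orthogonal_def norm_eq_1)
  define r where "r x = (\<Sum>b\<in>B. (sqrt (c b) * (x \<bullet> b)) *\<^sub>R b)" for x
  have lin: "linear r"
    unfolding r_def by (intro linearI) (auto simp: algebra_simps inner_add_left sum.distrib scaleR_sum_right)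
  define R where "R = matrix r"
  have R: "R *v x = r x" for x
    by (simp add: R_def matrix_works lin)
  have rb: "r x \<bullet> b = sqrt (c b) * (x \<bullet> b)" if "b \<in> B" for x b
    using that B(1) orth by (simp add: r_def inner_sum_left if_distrib[of "(*) _"] sum.delta cong: if_cong sum.cong)
  have "R *v (R *v x) = A *v x" for x
  proof -
    have "R *v (R *v x) = (\<Sum>b\<in>B. (c b * (x \<bullet> b)) *\<^sub>R b)"
      unfolding R r_def[of "r x"] using c
      by (intro sum.cong refl) (simp add: rb mult.assoc[symmetric] less_imp_le)
    also have "\<dots> = (\<Sum>b\<in>B. (x \<bullet> b) *\<^sub>R (A *v b))"
      by (intro sum.cong refl) (simp add: B(5))
    also have "\<dots> = A *v (\<Sum>b\<in>B. (x \<bullet> b) *\<^sub>R b)"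
      by (simp add: linear_sum[OF matrix_vector_mul_linear] matrix_vector_mult_scaleR)
    finally show ?thesis by (simp add: ex)
  qed
  then have "R ** R = A"
    by (simp add: matrix_eq matrix_vector_mul_assoc[symmetric])
  moreover have "R \<in> spd"
    unfolding spd_def
  proof (intro CollectI conjI allI impI)
    show "transpose R = R"
    proof (rule symmetric_matrixI)
      fix x y
      have "x \<bullet> r y = (\<Sum>b\<in>B. sqrt (c b) * (y \<bullet> b) * (x \<bullet> b))"
        by (simp add: r_def inner_sum_right)
      moreover have "r x \<bullet> y = (\<Sum>b\<in>B. sqrt (c b) * (x \<bullet> b) * (y \<bullet> b))"
        unfolding r_def inner_sum_left by (simp add: inner_commute[of _ y])
      ultimately show "x \<bullet> (R *v y) = (R *v x) \<bullet> y"
        by (simp add: R mult_ac)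
    qed
    fix x :: "real^'n" assume "x \<noteq> 0"
    then obtain b where b: "b \<in> B" "x \<bullet> b \<noteq> 0"
      using ex[of x] by (metis (no_types, lifting) scale_eq_0_iff sum.neutral)
    have "0 < (\<Sum>b\<in>B. sqrt (c b) * (x \<bullet> b)^2)"
      by (rule sum_pos2[OF B(1) b(1)]) (use b c in \<open>auto simp: less_imp_le\<close>)
    then show "0 < x \<bullet> (R *v x)"
      by (simp add: R r_def inner_sum_right power2_eq_square mult_ac)
  qed
  ultimately show ?thesis using that by blast
qed

text \<open>For X = B - C one has BX + XC = BB - CC = 0. Tested on an eigenvector of X, this is the
  eigenvalue times a sum of two positive numbers, so every eigenvalue of X vanishes. Uniqueness
  gives the definite description in \<open>inv_sqrt\<close> its meaning.\<close>

lemma spd_sqrt_unique: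
  fixes B C :: "real^'n^'n"
  assumes B: "B \<in> spd" and C: "C \<in> spd" and eq: "B ** B = C ** C"
  shows "B = C"
proof -
  define X where "X = B - C"
  have "transpose X = X"
    using spd_symmetric[OF B] spd_symmetric[OF C] unfolding X_def transpose_def
    by (simp add: vec_eq_iff)
  then obtain E c where E: "finite E" "pairwise orthogonal E" "\<And>b. b \<in> E \<Longrightarrow> norm b = 1" "span E = UNIV"
    "\<And>b. b \<in> E \<Longrightarrow> X *v b = c b *\<^sub>R b"
    using symmetric_eigenbasis by blast
  have "X *v b = 0" if "b \<in> E" for b
  proof -
    have b0: "b \<noteq> 0" using E(3)[OF that] by auto
    have "B *v (X *v b) + X *v (C *v b) = (B ** B) *v b - (C ** C) *v b"
      unfolding X_def
      by (simp add: matrix_vector_mult_diff_rdistrib matrix_vector_mult_diff_distrib matrix_vector_mul_assoc[symmetric])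
    then have "b \<bullet> (B *v (X *v b)) + b \<bullet> (X *v (C *v b)) = 0"
      by (simp add: eq inner_add_right[symmetric])
    then have "c b * (b \<bullet> (B *v b) + b \<bullet> (C *v b)) = 0"
      using symmetric_inner[OF \<open>transpose X = X\<close>, of b "C *v b"] E(5)[OF that]
      by (simp add: matrix_vector_mult_scaleR algebra_simps)
    then have "c b = 0"
      using spd_pos[OF B b0] spd_pos[OF C b0] by simp
    then show ?thesis using E(5)[OF that] by simp
  qed
  then have "X *v x = 0" for x
    using linear_eq_0_on_span[OF matrix_vector_mul_linear, of E X x] E(4) by auto
  then have "X = 0"
    by (simp add: matrix_eq)
  then show ?thesis by (simp add: X_def)
qed

section \<open>Inverses, determinants and norm bounds\<close>

lemma spd_invertible:
  fixes A :: "real^'n^'n"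
  assumes "A \<in> spd"
  shows "invertible A"
proof -
  have "x = 0" if "A *v x = 0" for x
    using spd_pos[OF assms, of x] that by fastforce
  then show ?thesis
    by (simp add: invertible_left_inverse matrix_left_invertible_ker)
qed

lemma matrix_inv_mult:
  fixes A :: "real^'n^'n"
  assumes "invertible A"
  shows "A ** matrix_inv A = mat 1" "matrix_inv A ** A = mat 1"
proof -
  have "A ** matrix_inv A = mat 1 \<and> matrix_inv A ** A = mat 1"
    using assms unfolding matrix_inv_def invertible_def by (rule someI_ex)
  then show "A ** matrix_inv A = mat 1" "matrix_inv A ** A = mat 1" by auto
qed

lemma matrix_inv_mul_vec:
  fixes A :: "real^'n^'n"
  assumes "invertible A"
  shows "A *v (matrix_inv A *v x) = x" "matrix_inv A *v (A *v x) = x"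
  using matrix_inv_mult[OF assms] by (simp_all add: matrix_vector_mul_assoc)

text \<open>The determinant is the square of the nonzero determinant of a root.\<close>

lemma det_spd_pos:
  fixes A :: "real^'n^'n"
  assumes "A \<in> spd"
  shows "det A > 0"
proof -
  obtain R where R: "R \<in> spd" "R ** R = A" using spd_sqrt_exists[OF assms] by blast
  have "det R \<noteq> 0" using spd_invertible[OF R(1)] by (simp add: invertible_det_nz)
  then show ?thesis using R(2) det_mul[of R R] by (simp add: zero_less_mult_iff) linarith
qed

lemma spd_matrix_inv:
  fixes A :: "real^'n^'n"
  assumes A: "A \<in> spd"
  shows "matrix_inv A \<in> spd"
proof -
  note inv = matrix_inv_mul_vec[OF spd_invertible[OF A]]
  have "x \<bullet> (matrix_inv A *v y) = (matrix_inv A *v x) \<bullet> y" for x y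
    using symmetric_inner[OF spd_symmetric[OF A], of "matrix_inv A *v x" "matrix_inv A *v y"] inv by simp
  moreover have "0 < x \<bullet> (matrix_inv A *v x)" if "x \<noteq> 0" for x
  proof -
    have "matrix_inv A *v x \<noteq> 0" using inv(1)[of x] that by fastforce
    from spd_pos[OF A this] show ?thesis using inv by (simp add: inner_commute)
  qed
  ultimately show ?thesis
    unfolding spd_def by (auto intro: symmetric_matrixI)
qed

lemma inv_sqrt:
  assumes "A \<in> spd"
  shows "inv_sqrt A \<in> spd" "inv_sqrt A ** inv_sqrt A = matrix_inv A"
proof -
  obtain R where R: "R \<in> spd" "R ** R = matrix_inv A"
    using spd_sqrt_exists[OF spd_matrix_inv[OF assms]] by blast
  have "inv_sqrt A \<in> spd \<and> inv_sqrt A ** inv_sqrt A = matrix_inv A"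
    unfolding inv_sqrt_def by (rule theI[of _ R]) (use R spd_sqrt_unique in metis)+
  then show "inv_sqrt A \<in> spd" "inv_sqrt A ** inv_sqrt A = matrix_inv A" by auto
qed

text \<open>Eliminates the matrix root: the log density can then be written with the inverse and the
  determinant of the scatter matrix, which are accessible to algebraic perturbation.\<close>

lemma norm_inv_sqrt:
  assumes "A \<in> spd"
  shows "(norm (inv_sqrt A *v u))\<^sup>2 = u \<bullet> (matrix_inv A *v u)"
proof -
  have "(norm (inv_sqrt A *v u))\<^sup>2 = (inv_sqrt A *v u) \<bullet> (inv_sqrt A *v u)"
    by (simp add: power2_norm_eq_inner)
  also have "\<dots> = u \<bullet> (inv_sqrt A *v (inv_sqrt A *v u))"
    by (simp add: symmetric_inner spd_symmetric inv_sqrt(1)[OF assms])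
  finally show ?thesis
    by (simp add: matrix_vector_mul_assoc inv_sqrt(2)[OF assms])
qed

lemma det_inv_sqrt:
  assumes "A \<in> spd"
  shows "det (inv_sqrt A) = det A powr (- 1 / 2)"
proof -
  define d where "d = det (inv_sqrt A)"
  define a where "a = det A"
  have pos: "a > 0" "d > 0"
    using det_spd_pos[OF assms] det_spd_pos[OF inv_sqrt(1)[OF assms]] by (auto simp: d_def a_def)
  have "a * det (matrix_inv A) = 1"
    using det_mul[of A "matrix_inv A"] matrix_inv_mult(1)[OF spd_invertible[OF assms]]
    unfolding a_def by simp
  moreover have "det (matrix_inv A) = d * d"
    unfolding d_def inv_sqrt(2)[OF assms, symmetric] by (rule det_mul)
  ultimately have "a = 1 / (d * d)"
    using pos by (simp add: field_simps)
  also have "\<dots> = d powr (- 2)"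
    using pos by (simp add: powr_minus_divide power2_eq_square)
  finally have "a powr (- 1 / 2) = (d powr (- 2)) powr (- 1 / 2)"
    by (rule arg_cong)
  also have "\<dots> = d"
    using pos by (simp only: powr_powr) simp
  finally show ?thesis by (simp add: a_def d_def)
qed

text \<open>The norm of a matrix is the Euclidean norm of its row norms (the Frobenius norm), so
  Cauchy-Schwarz row by row suffices.\<close>

lemma norm_matrix_vector_le:
  fixes A :: "real^'n^'m"
  shows "norm (A *v x) \<le> norm A * norm x"
proof -
  have "norm (A *v x) = L2_set (\<lambda>i. \<bar>A $ i \<bullet> x\<bar>) UNIV"
    by (simp add: norm_vec_def matrix_vector_mul_component)
  also have "\<dots> \<le> L2_set (\<lambda>i. norm (A $ i) * norm x) UNIV"
    by (intro L2_set_mono) (auto intro: Cauchy_Schwarz_ineq2)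
  also have "\<dots> = norm A * norm x"
    by (simp add: norm_vec_def L2_set_left_distrib)
  finally show ?thesis .
qed

text \<open>The constant is the minimum of the quadratic form on the compact unit sphere;
  homogeneity extends the bound to all vectors.\<close>

lemma spd_coercive:
  fixes A :: "real^'n^'n"
  assumes "A \<in> spd"
  obtains c where "c > 0" "\<And>x. c * (norm x)\<^sup>2 \<le> x \<bullet> (A *v x)"
proof -
  have "continuous_on (sphere 0 1) (\<lambda>x. x \<bullet> (A *v x))"
    by (intro continuous_intros linear_continuous_on) simp
  moreover have "sphere 0 1 \<noteq> ({} :: (real^'n) set)" by simp
  ultimately obtain v where v: "v \<in> sphere 0 1" "\<And>x. x \<in> sphere 0 1 \<Longrightarrow> v \<bullet> (A *v v) \<le> x \<bullet> (A *v x)"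
    using continuous_attains_inf[of "sphere 0 1" "\<lambda>x. x \<bullet> (A *v x)"] by (metis compact_sphere)
  show ?thesis
  proof
    show "v \<bullet> (A *v v) > 0" using v(1) spd_pos[OF assms, of v] by fastforce
    fix x show "v \<bullet> (A *v v) * (norm x)\<^sup>2 \<le> x \<bullet> (A *v x)"
    proof (cases "x = 0")
      case False
      then have "v \<bullet> (A *v v) \<le> (x \<bullet> (A *v x)) / (norm x)\<^sup>2"
        using v(2)[of "(1 / norm x) *\<^sub>R x"] by (simp add: matrix_vector_mult_scaleR power2_eq_square)
      then show ?thesis using False by (simp add: field_simps)
    qed simp
  qed
qed

section \<open>Linear change of variables\<close>

text \<open>Stretches, coordinate swaps, shears and maps with a vanishing coordinate generate all
  linear maps. Injectivity rules out the last kind, and determinants multiply under composition just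
  as volume factors do.\<close>

lemma measure_injective_linear_image:
  fixes f :: "real^'n \<Rightarrow> real^'n"
  assumes "linear f" "inj f"
  shows "\<forall>S\<in>lmeasurable. f ` S \<in> lmeasurable \<and> measure lebesgue (f ` S) = \<bar>det (matrix f)\<bar> * measure lebesgue S"
  using assms(2)
proof (induction rule: induct_linear_elementary[OF assms(1)])
  case (1 f g)
  \<comment> \<open>Injective and surjective agree for endomorphisms of finite-dimensional spaces,
    which passes injectivity of the composite on to both factors.\<close>
  have "inj g" using \<open>inj (f \<circ> g)\<close> inj_on_imageI2 by blast
  then have "surj g" using 1(2) linear_injective_imp_surjective by blast
  then have "inj f" using \<open>inj (f \<circ> g)\<close> by (metis comp_apply injD injI surj_def)
  show ?case
    using 1(3)[OF \<open>inj f\<close>] 1(4)[OF \<open>inj g\<close>]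
    by (simp add: image_comp[symmetric] matrix_compose[OF 1(2,1)] det_mul abs_mult del: image_comp o_apply)
next
  case (2 f i)
  then have "surj f" using linear_injective_imp_surjective by blast
  then show ?case using 2(2)[of "inv f (axis i 1)"] by (simp add: surj_f_inv_f)
next
  case (3 c)
  have "\<bar>det (matrix (\<lambda>x::real^'n. \<chi> i. c i * x $ i))\<bar> = \<bar>prod c UNIV\<bar>"
    by (simp add: matrix_def det_diagonal axis_def)
  then show ?case using measurable_stretch[of _ c] measure_stretch[of _ c] by simp
next
  case (4 m n)
  let ?h = "\<lambda>v::real^'n. \<chi> i. v $ Transposition.transpose m n i"
  have lin: "linear ?h"
    by (rule linearI) (simp_all add: plus_vec_def scaleR_vec_def)
  have "matrix ?h = transpose (\<chi> i j. mat 1 $ i $ Transposition.transpose m n j)"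
    by (auto simp: vec_eq_iff transpose_def axis_def mat_def matrix_def)
  then have 1: "\<bar>det (matrix ?h)\<bar> = 1"
    by (simp add: det_permute_columns permutes_swap_id sign_swap_id abs_mult)
  have "measure lebesgue (?h ` cbox a b) = measure lebesgue (cbox a b)" for a b
  proof (cases "cbox a b = {}")
    case False
    have eq: "?h ` cbox a b = cbox (?h a) (?h b)"
    proof safe
      fix x assume "x \<in> cbox (?h a) (?h b)"
      then have "?h x \<in> cbox a b"
        unfolding mem_box_cart by (metis transpose_involutory vec_lambda_beta)
      moreover have "x = ?h (?h x)" by (simp add: vec_eq_iff)
      ultimately show "x \<in> ?h ` cbox a b" by (rule rev_image_eqI)
    qed (auto simp: mem_box_cart)
    then have "cbox (?h a) (?h b) \<noteq> {}" using False by blast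
    then show ?thesis
      using prod.permute[OF permutes_swap_id, where S=UNIV and g="\<lambda>i. (b - a)$i", of m n]
      by (simp add: eq content_cbox_cart False o_def)
  qed simp
  then have im: "measure lebesgue (?h ` cbox a b) = 1 * measure lebesgue (cbox a b)" for a b
    by simp
  show ?case
  proof
    fix S :: "(real^'n) set" assume "S \<in> lmeasurable"
    from measure_linear_sufficient[OF lin this im]
    show "?h ` S \<in> lmeasurable \<and> measure lebesgue (?h ` S) = \<bar>det (matrix ?h)\<bar> * measure lebesgue S"
      unfolding 1 by simp
  qed
next
  case (5 m n)
  let ?h = "\<lambda>v::real^'n. \<chi> i. if i = m then v $ m + v $ n else v $ i"
  have lin: "linear ?h"
    by (rule linearI) (auto simp: algebra_simps plus_vec_def scaleR_vec_def vec_eq_iff)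
  have "matrix ?h = (\<chi> i. if i = m then row m (mat 1) + 1 *s row n (mat 1) else row i (mat 1))"
    using 5 by (auto simp: vec_eq_iff matrix_def row_def mat_def axis_def)
  then have 1: "\<bar>det (matrix ?h)\<bar> = 1"
    by (simp only: det_row_operation[OF 5(1)] det_I abs_one)
  have "measure lebesgue (?h ` cbox a b) = measure lebesgue (cbox a b)" for a b
  proof (cases "cbox a b = {}")
    case False
    \<comment> \<open>the library's shear lemma wants a box in the half space where the n-th coordinate is nonnegative\<close>
    define v :: "real^'n" where "v = (\<chi> i. if i = n then - a $ n else 0)"
    define h where "h = ?h"
    have linh: "linear h" using lin by (simp add: h_def)
    have ab: "(+) v ` cbox a b = cbox (v + a) (v + b)" by (simp add: cbox_translation)
    have "h ` cbox a b = (+) (- h v) ` h ` (+) v ` cbox a b"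
      by (simp add: image_image linear_add[OF linh])
    then have "measure lebesgue (h ` cbox a b) = measure lebesgue (h ` cbox (v + a) (v + b))"
      unfolding ab by (simp only: measure_translation)
    also have "\<dots> = measure lebesgue (cbox (v + a) (v + b))"
    proof -
      have "cbox (v + a) (v + b) \<noteq> {}" unfolding ab[symmetric] using False by blast
      then show ?thesis
        unfolding h_def by (intro measure_shear_interval[OF 5(1)]) (simp_all add: v_def)
    qed
    also have "\<dots> = measure lebesgue (cbox a b)"
      by (simp only: ab[symmetric] measure_translation)
    finally show ?thesis by (simp only: h_def)
  qed simp
  then have im: "measure lebesgue (?h ` cbox a b) = 1 * measure lebesgue (cbox a b)" for a b
    by simp
  show ?case
  proof
    fix S :: "(real^'n) set" assume "S \<in> lmeasurable"
    from measure_linear_sufficient[OF lin this im]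
    show "?h ` S \<in> lmeasurable \<and> measure lebesgue (?h ` S) = \<bar>det (matrix ?h)\<bar> * measure lebesgue S"
      unfolding 1 by simp
  qed
qed

text \<open>Lebesgue measure is determined by its values on boxes. The preimage of a box is the
  image of a translated box under the inverse matrix, and the constant density compensates the
  volume factor of that inverse.\<close>

lemma lborel_affine_matrix:
  fixes B :: "real^'n^'n"
  assumes "invertible B"
  shows "lborel = density (distr lborel borel (\<lambda>x. m + B *v x)) (\<lambda>_. ennreal \<bar>det B\<bar>)"
proof (rule lborel_eqI)
  let ?f = "\<lambda>x. m + B *v x"
  have [measurable]: "?f \<in> borel_measurable borel"
    by (intro borel_measurable_continuous_onI continuous_intros linear_continuous_on) simp
  fix l u :: "real^'n" assume lu: "\<And>b. b \<in> Basis \<Longrightarrow> l \<bullet> b \<le> u \<bullet> b"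
  note inv = matrix_inv_mul_vec[OF assms]
  define C where "C = matrix_inv B"
  have vim: "?f -` box l u = (*v) C ` box (l - m) (u - m)"
  proof safe
    fix x assume "m + B *v x \<in> box l u"
    then have "B *v x \<in> box (l - m) (u - m)"
      by (simp add: mem_box inner_diff_left inner_add_left less_diff_eq diff_less_eq add.commute)
    then show "x \<in> (*v) C ` box (l - m) (u - m)" using inv(2)[of x] image_eqI[of x "(*v) C" "B *v x"] by (simp add: C_def)
  next
    fix y assume "y \<in> box (l - m) (u - m)"
    then show "C *v y \<in> ?f -` box l u" by (simp add: mem_box C_def inv inner_diff_left inner_add_left less_diff_eq diff_less_eq add.commute)
  qed
  have "inj ((*v) C)" by (rule injI) (use inv(1) in \<open>unfold C_def, metis\<close>)
  then have *: "(*v) C ` box (l - m) (u - m) \<in> lmeasurable"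
     "measure lebesgue ((*v) C ` box (l - m) (u - m)) = \<bar>det C\<bar> * measure lebesgue (box (l - m) (u - m))"
    using measure_injective_linear_image[of "(*v) C"] by auto
  have "det B * det C = 1"
    using det_mul[of B C] matrix_inv_mult(1)[OF assms] by (simp add: C_def)
  then have det: "\<bar>det B\<bar> * \<bar>det C\<bar> = 1"
    by (metis abs_mult abs_one)
  have "?f -` box l u \<in> sets borel"
    using measurable_sets[of ?f borel borel "box l u"] by simp
  then have "emeasure lborel (?f -` box l u) = ennreal (\<bar>det C\<bar> * measure lebesgue (box (l - m) (u - m)))"
    using emeasure_completion[of "?f -` box l u" lborel] emeasure_eq_measure2[OF *(1)] *(2)
    unfolding vim by simp
  then have "emeasure (density (distr lborel borel ?f) (\<lambda>_. ennreal \<bar>det B\<bar>)) (box l u)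
     = ennreal (\<bar>det B\<bar> * (\<bar>det C\<bar> * measure lebesgue (box (l - m) (u - m))))"
    by (simp add: emeasure_density_const emeasure_distr ennreal_mult)
  also have "\<dots> = ennreal (measure lebesgue (box (l - m) (u - m)))"
    using det by (simp add: mult.assoc[symmetric])
  also have "\<dots> = ennreal (\<Prod>b\<in>Basis. (u - l) \<bullet> b)"
    using lu by (simp add: measure_completion measure_lborel_box_eq inner_diff_left)
  finally show "emeasure (density (distr lborel borel ?f) (\<lambda>_. ennreal \<bar>det B\<bar>)) (box l u) = (\<Prod>b\<in>Basis. (u - l) \<bullet> b)"
    by simp
qed simp

section \<open>Gaussian integrals and the normalization of the Student density\<close>

lemma nn_integral_affine_matrix:
  fixes B :: "real^'n^'n"
  assumes "invertible B" and [measurable]: "h \<in> borel_measurable borel"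
  shows "(\<integral>\<^sup>+x. h x \<partial>lborel) = ennreal \<bar>det B\<bar> * (\<integral>\<^sup>+x. h (m + B *v x) \<partial>lborel)"
proof -
  have [measurable]: "(\<lambda>x. m + B *v x) \<in> borel_measurable borel"
    by (intro borel_measurable_continuous_onI continuous_intros linear_continuous_on) simp
  show ?thesis
    by (subst lborel_affine_matrix[OF assms(1), of m])
      (simp add: nn_integral_density nn_integral_distr nn_integral_cmult)
qed

lemma nn_integral_exp_square:
  fixes s :: real
  assumes "s > 0"
  shows "(\<integral>\<^sup>+x. ennreal (exp (- s * x\<^sup>2)) \<partial>lborel) = ennreal (sqrt (pi / s))"
proof -
  \<comment> \<open>The standard deviation at which the normal density becomes proportional to the
    integrand.\<close>
  define \<sigma> where "\<sigma> = sqrt (1 / (2 * s))"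
  have \<sigma>: "\<sigma> > 0" "\<sigma>\<^sup>2 = 1 / (2 * s)" using assms by (auto simp: \<sigma>_def)
  have "exp (- s * x\<^sup>2) = sqrt (pi / s) * normal_density 0 \<sigma> x" for x
    using assms by (simp add: normal_density_def \<sigma>(2) field_simps)
  then have "(\<integral>\<^sup>+x. ennreal (exp (- s * x\<^sup>2)) \<partial>lborel)
      = (\<integral>\<^sup>+x. ennreal (sqrt (pi / s)) * ennreal (normal_density 0 \<sigma> x) \<partial>lborel)"
    using assms by (simp add: ennreal_mult)
  also have "\<dots> = ennreal (sqrt (pi / s)) * (\<integral>\<^sup>+x. ennreal (normal_density 0 \<sigma> x) \<partial>lborel)"
    by (intro nn_integral_cmult) auto
  also have "(\<integral>\<^sup>+x. ennreal (normal_density 0 \<sigma> x) \<partial>lborel) = 1"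
    using \<sigma>(1) by (subst nn_integral_eq_integral) (auto simp: integral_normal_density)
  finally show ?thesis by simp
qed

lemma norm_sq_Basis: "(norm (x::'a::euclidean_space))\<^sup>2 = (\<Sum>b\<in>Basis. (x \<bullet> b)\<^sup>2)"
  unfolding power2_norm_eq_inner euclidean_inner[of x x] by (simp add: power2_eq_square)

lemma nn_integral_gaussian_vec:
  fixes s :: real
  assumes "s > 0"
  shows "(\<integral>\<^sup>+x. ennreal (exp (- s * (norm (x::real^'n))\<^sup>2)) \<partial>lborel) = ennreal ((pi / s) powr (real CARD('n) / 2))"
proof -
  have "exp (- s * (norm x)\<^sup>2) = (\<Prod>b\<in>Basis. exp (- s * (x \<bullet> b)\<^sup>2))" for x :: "real^'n"
    by (simp add: norm_sq_Basis sum_distrib_left exp_sum[symmetric] sum_negf)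
  then have "(\<integral>\<^sup>+x. ennreal (exp (- s * (norm (x::real^'n))\<^sup>2)) \<partial>lborel)
      = (\<integral>\<^sup>+x. (\<Prod>b\<in>Basis. ennreal (exp (- s * ((x::real^'n) \<bullet> b)\<^sup>2))) \<partial>lborel)"
    by (simp add: prod_ennreal)
  also have "\<dots> = ennreal (sqrt (pi / s)) ^ CARD('n)"
    using assms by (subst nn_integral_lborel_prod) (simp_all add: nn_integral_exp_square[simplified])
  also have "\<dots> = ennreal ((pi / s) powr (real CARD('n) / 2))"
    using assms by (simp add: ennreal_power powr_half_sqrt[symmetric] powr_power)
  finally show ?thesis .
qed

text \<open>This turns the Student density into a scale mixture of Gaussian densities.\<close>

lemma powr_gamma_mixture:
  fixes a z :: real
  assumes "a > 0" "z > 0"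
  shows "(\<integral>\<^sup>+t. ennreal (indicator {0..} t * t powr (a - 1) * exp (- t * z)) \<partial>lborel)
    = ennreal (Gamma a * z powr (- a))"
proof -
  have "ennreal (Gamma a) = (\<integral>\<^sup>+t. ennreal (indicator {0..} t * t powr (a - 1) / exp t) \<partial>lborel)"
    by (rule Gamma_conv_nn_integral_real) fact
  also have "\<dots> = ennreal \<bar>z\<bar> * (\<integral>\<^sup>+t. ennreal (indicator {0..} (0 + z * t) * (0 + z * t) powr (a - 1) / exp (0 + z * t)) \<partial>lborel)"
    using assms by (intro nn_integral_real_affine) auto
  also have "\<dots> = (\<integral>\<^sup>+t. ennreal (z powr a) * ennreal (indicator {0..} t * t powr (a - 1) * exp (- t * z)) \<partial>lborel)"
    using assms
    by (subst nn_integral_cmult[symmetric])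
      (auto intro!: nn_integral_cong simp: ennreal_mult[symmetric] zero_le_mult_iff powr_mult powr_diff exp_minus
        field_simps split: split_indicator)
  also have "\<dots> = ennreal (z powr a) * (\<integral>\<^sup>+t. ennreal (indicator {0..} t * t powr (a - 1) * exp (- t * z)) \<partial>lborel)"
    by (intro nn_integral_cmult) auto
  finally have "ennreal (z powr (- a)) * ennreal (Gamma a)
    = ennreal (z powr (- a)) * ennreal (z powr a) * (\<integral>\<^sup>+t. ennreal (indicator {0..} t * t powr (a - 1) * exp (- t * z)) \<partial>lborel)"
    by (simp add: mult.assoc)
  also have "ennreal (z powr (- a)) * ennreal (z powr a) = 1"
    using assms by (simp add: ennreal_mult[symmetric] powr_add[symmetric])
  finally show ?thesis
    using assms by (simp add: ennreal_mult mult.commute Gamma_real_nonneg)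
qed

text \<open>Insert the Gamma mixture and exchange the integrals. The Gaussian integral in
  \<open>y\<close> contributes \<open>t\<close> to the power -k/2, which lowers the Gamma exponent
  from \<open>a\<close> to a - k/2; this must stay positive, hence the bound on
  \<open>a\<close>.\<close>

lemma nn_integral_student_kernel:
  fixes a r :: real
  assumes r: "r > 0" and a: "a > real CARD('n) / 2"
  shows "(\<integral>\<^sup>+y. ennreal ((1 + (norm (y::real^'n))\<^sup>2 / r) powr (- a)) \<partial>lborel)
    = ennreal ((pi * r) powr (real CARD('n) / 2) * Gamma (a - real CARD('n) / 2) / Gamma a)"
proof -
  let ?k = "real CARD('n)"
  have a0: "a > 0" using a by (meson divide_nonneg_nonneg le_less_trans of_nat_0_le_iff zero_le_numeral)
  have Ga: "Gamma a > 0" using a0 by (rule Gamma_real_pos)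
  have pos: "1 + (norm y)\<^sup>2 / r > 0" for y :: "real^'n"
    using r by (simp add: add_pos_nonneg)
  let ?g = "\<lambda>y::real^'n. \<lambda>t::real. ennreal (indicator {0..} t * t powr (a - 1) * exp (- t * (1 + (norm y)\<^sup>2 / r)))"
  have "ennreal (Gamma a) * (\<integral>\<^sup>+y. ennreal ((1 + (norm (y::real^'n))\<^sup>2 / r) powr (- a)) \<partial>lborel)
      = (\<integral>\<^sup>+y. ennreal (Gamma a * (1 + (norm (y::real^'n))\<^sup>2 / r) powr (- a)) \<partial>lborel)"
    using Ga by (subst nn_integral_cmult[symmetric]) (auto simp: ennreal_mult)
  also have "\<dots> = (\<integral>\<^sup>+y. \<integral>\<^sup>+t. ?g y t \<partial>lborel \<partial>lborel)"
    using pos a0 by (simp only: powr_gamma_mixture)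
  also have "\<dots> = (\<integral>\<^sup>+t. \<integral>\<^sup>+y. ?g y t \<partial>lborel \<partial>lborel)"
    by (subst lborel_pair.Fubini') simp_all
  also have "\<dots> = (\<integral>\<^sup>+t. ennreal ((pi * r) powr (?k / 2)) * ennreal (indicator {0..} t * t powr (a - ?k / 2 - 1) / exp t) \<partial>lborel)"
  proof (intro nn_integral_cong_AE)
    \<comment> \<open>The Gaussian scale \<open>t / r\<close> has to be positive: the point 0 is a
      null set, and negative \<open>t\<close> are removed by the indicator.\<close>
    have "AE t in lborel. t \<noteq> (0::real)" by (rule AE_lborel_singleton)
    then show "AE t in lborel. (\<integral>\<^sup>+y. ?g y t \<partial>lborel)
      = ennreal ((pi * r) powr (?k / 2)) * ennreal (indicator {0..} t * t powr (a - ?k / 2 - 1) / exp t)"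
    proof eventually_elim
      fix t :: real assume "t \<noteq> 0"
      show "(\<integral>\<^sup>+y. ?g y t \<partial>lborel)
        = ennreal ((pi * r) powr (?k / 2)) * ennreal (indicator {0..} t * t powr (a - ?k / 2 - 1) / exp t)"
      proof (cases "t > 0")
        case True
        have "(\<integral>\<^sup>+y. ?g y t \<partial>lborel)
          = (\<integral>\<^sup>+y. ennreal (t powr (a - 1) / exp t) * ennreal (exp (- (t / r) * (norm (y::real^'n))\<^sup>2)) \<partial>lborel)"
          using True by (intro nn_integral_cong)
            (simp add: ennreal_mult[symmetric] algebra_simps exp_add exp_minus exp_diff divide_inverse)
        also have "\<dots> = ennreal (t powr (a - 1) / exp t) * (\<integral>\<^sup>+y. ennreal (exp (- (t / r) * (norm (y::real^'n))\<^sup>2)) \<partial>lborel)"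
          by (intro nn_integral_cmult) auto
        also have "\<dots> = ennreal (t powr (a - 1) / exp t * (pi / (t / r)) powr (?k / 2))"
          using True r by (subst nn_integral_gaussian_vec) (auto simp: ennreal_mult[symmetric])
        also have "t powr (a - 1) / exp t * (pi / (t / r)) powr (?k / 2)
            = (pi * r) powr (?k / 2) * (t powr (a - ?k / 2 - 1) / exp t)"
        proof -
          have "(pi / (t / r)) powr (?k / 2) = (pi * r) powr (?k / 2) * t powr (- (?k / 2))"
            using True r by (simp add: powr_divide powr_minus_divide)
          moreover have "t powr (a - 1) * t powr (- (?k / 2)) = t powr (a - ?k / 2 - 1)"
            by (simp add: powr_add[symmetric] algebra_simps)
          ultimately show ?thesis by (simp add: field_simps)
        qed
        finally show ?thesis using True by (simp add: ennreal_mult[symmetric])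
      qed (use \<open>t \<noteq> 0\<close> in simp)
    qed
  qed
  also have "\<dots> = ennreal ((pi * r) powr (?k / 2)) * ennreal (Gamma (a - ?k / 2))"
    using a by (subst nn_integral_cmult) (auto simp: Gamma_conv_nn_integral_real)
  finally have "ennreal (1 / Gamma a) * (ennreal (Gamma a) * (\<integral>\<^sup>+y. ennreal ((1 + (norm (y::real^'n))\<^sup>2 / r) powr (- a)) \<partial>lborel))
    = ennreal (1 / Gamma a) * (ennreal ((pi * r) powr (?k / 2)) * ennreal (Gamma (a - ?k / 2)))"
    by simp
  moreover have "ennreal (1 / Gamma a) * ennreal (Gamma a) = 1"
    using Ga by (simp add: ennreal_mult[symmetric])
  ultimately show ?thesis
    using Ga a Gamma_real_pos[of "a - ?k / 2"]
    by (simp add: mult.assoc[symmetric] ennreal_mult[symmetric] less_imp_le mult_ac)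
qed

lemma param_spaceD:
  assumes "(\<mu>, \<Sigma>, \<nu>) \<in> param_space"
  shows "\<Sigma> \<in> spd" "\<nu> > 0"
  using assms by (auto simp: param_space_def)

lemma student_const_pos: "\<nu> > 0 \<Longrightarrow> k \<ge> 0 \<Longrightarrow> student_const \<nu> k > 0"
  unfolding student_const_def
  by (intro divide_pos_pos mult_pos_pos Gamma_real_pos) auto

lemma student_density_pos:
  assumes "\<theta> \<in> param_space"
  shows "student_density \<theta> x > 0"
proof -
  obtain \<mu> \<Sigma> \<nu> where \<theta>: "\<theta> = (\<mu>, \<Sigma>, \<nu>)" by (cases \<theta>)
  have *: "det \<Sigma> > 0" "\<nu> > 0" using assms param_spaceD[of \<mu> \<Sigma> \<nu>] det_spd_pos by (auto simp: \<theta>)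
  have "1 + (norm (inv_sqrt \<Sigma> *v (x - \<mu>)))\<^sup>2 / \<nu> > 0"
    using * by (simp add: add_pos_nonneg)
  then show ?thesis
    using * student_const_pos[of \<nu> "real CARD('a)"] by (simp add: \<theta>)
qed

lemma student_density_measurable [measurable]: "student_density \<theta> \<in> borel_measurable borel"
proof -
  obtain \<mu> \<Sigma> \<nu> where \<theta>: "\<theta> = (\<mu>, \<Sigma>, \<nu>)" by (cases \<theta>)
  have [measurable]: "(\<lambda>x. inv_sqrt \<Sigma> *v (x - \<mu>)) \<in> borel_measurable borel"
    by (intro borel_measurable_continuous_onI continuous_intros
        continuous_on_compose2[OF linear_continuous_on[of "(*v) (inv_sqrt \<Sigma>)" UNIV]]) auto
  show ?thesis unfolding \<theta> student_density.simps by measurable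
qed

text \<open>Substitute \<open>x = \<mu> + matrix_inv B *v y\<close> with \<open>B\<close> the
  inverse root. The Jacobian cancels the determinant factor, and the kernel integral with exponent
  (\<open>\<nu>\<close> + k) / 2 leaves the Gamma function at \<open>\<nu> / 2\<close>, the
  reciprocal of the constant.\<close>

lemma nn_integral_student_density:
  fixes \<theta> :: "'k::finite param"
  assumes "\<theta> \<in> param_space"
  shows "(\<integral>\<^sup>+x. ennreal (student_density \<theta> x) \<partial>lborel) = 1"
proof -
  obtain \<mu> \<Sigma> \<nu> where \<theta>: "\<theta> = (\<mu>, \<Sigma>, \<nu>)" by (cases \<theta>)
  note * = param_spaceD[OF assms[unfolded \<theta>]]
  let ?k = "real CARD('k)"
  define B where "B = inv_sqrt \<Sigma>"
  have B: "B \<in> spd" "det B = det \<Sigma> powr (- 1 / 2)" "det B > 0"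
    using inv_sqrt(1)[OF *(1)] det_inv_sqrt[OF *(1)] det_spd_pos[OF inv_sqrt(1)[OF *(1)]] by (simp_all add: B_def)
  note Binv = matrix_inv_mult[OF spd_invertible[OF B(1)]]
  have inv: "invertible (matrix_inv B)" using Binv by (auto simp: invertible_def)
  have "det B * det (matrix_inv B) = 1"
    using det_mul[of B "matrix_inv B"] Binv by simp
  then have det: "\<bar>det (matrix_inv B)\<bar> * det \<Sigma> powr (- 1 / 2) = 1"
    using B by (metis abs_mult abs_of_pos abs_one mult.commute)
  let ?c = "student_const \<nu> ?k"
  have "(\<integral>\<^sup>+x. ennreal (student_density \<theta> x) \<partial>lborel)
     = ennreal \<bar>det (matrix_inv B)\<bar> * (\<integral>\<^sup>+x. ennreal (student_density \<theta> (\<mu> + matrix_inv B *v x)) \<partial>lborel)"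
    by (rule nn_integral_affine_matrix[OF inv]) simp
  also have "\<dots> = ennreal \<bar>det (matrix_inv B)\<bar> * (\<integral>\<^sup>+x. ennreal (?c * det \<Sigma> powr (- 1 / 2)) * ennreal ((1 + (norm (x::real^'k))\<^sup>2 / \<nu>) powr (- (\<nu> + ?k) / 2)) \<partial>lborel)"
    using student_const_pos[OF *(2), of ?k] matrix_inv_mul_vec[OF spd_invertible[OF B(1)]]
    by (simp add: \<theta> B_def[symmetric] ennreal_mult)
  also have "\<dots> = ennreal \<bar>det (matrix_inv B)\<bar> * (ennreal (?c * det \<Sigma> powr (- 1 / 2)) *
      ennreal ((pi * \<nu>) powr (?k / 2) * Gamma ((\<nu> + ?k) / 2 - ?k / 2) / Gamma ((\<nu> + ?k) / 2)))"
  proof -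
    have e: "- (\<nu> + ?k) / 2 = - ((\<nu> + ?k) / 2)" by (rule minus_divide_left[symmetric])
    show ?thesis
      unfolding e using *(2)
      by (subst nn_integral_cmult, simp, subst nn_integral_student_kernel) auto
  qed
  also have "\<dots> = ennreal ((\<bar>det (matrix_inv B)\<bar> * det \<Sigma> powr (- 1 / 2)) * (?c * ((pi * \<nu>) powr (?k / 2) * Gamma ((\<nu> + ?k) / 2 - ?k / 2) / Gamma ((\<nu> + ?k) / 2))))"
    using *(2) student_const_pos[OF *(2), of ?k] Gamma_real_pos[of "\<nu>/2"] Gamma_real_pos[of "(\<nu> + ?k)/2"]
    by (simp add: ennreal_mult[symmetric] add_divide_distrib less_imp_le mult_ac)
  also have "?c * ((pi * \<nu>) powr (?k / 2) * Gamma ((\<nu> + ?k) / 2 - ?k / 2) / Gamma ((\<nu> + ?k) / 2)) = 1"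
  proof -
    have "Gamma (\<nu> / 2) > 0" "Gamma ((\<nu> + ?k) / 2) > 0" "(pi * \<nu>) powr (?k / 2) > 0"
      using *(2) by (auto intro!: Gamma_real_pos)
    moreover have e: "(\<nu> + ?k) / 2 - ?k / 2 = \<nu> / 2" by (simp add: add_divide_distrib)
    ultimately show ?thesis unfolding student_const_def e by simp
  qed
  finally show ?thesis using det by simp
qed

lemma sets_student_t [simp, measurable_cong]: "sets (student_t \<theta>) = sets borel"
  by (simp add: student_t_def)

lemma space_student_t [simp]: "space (student_t \<theta>) = UNIV"
  by (simp add: student_t_def)

lemma prob_space_student_t: "\<theta> \<in> param_space \<Longrightarrow> prob_space (student_t \<theta>)"
  by (rule prob_spaceI) (simp add: student_t_def emeasure_density nn_integral_student_density)

section \<open>The multivariate normal law\<close>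

text \<open>Serves twice: its linear images are the centred nonsingular normal laws, and it is the
  smoothing kernel of the continuity theorem.\<close>

definition std_gauss :: "(real^'d) measure" where
  "std_gauss = density lborel (\<lambda>x. ennreal ((2 * pi) powr (- real CARD('d) / 2) * exp (- (norm x)\<^sup>2 / 2)))"

lemma sets_std_gauss [simp, measurable_cong]: "sets std_gauss = sets borel"
  by (simp add: std_gauss_def)

lemma space_std_gauss [simp]: "space std_gauss = UNIV"
  by (simp add: std_gauss_def)

lemma prob_space_std_gauss: "prob_space (std_gauss :: (real^'d) measure)"
proof
  have "emeasure std_gauss (space (std_gauss :: (real^'d) measure))
    = (\<integral>\<^sup>+x. ennreal ((2 * pi) powr (- real CARD('d) / 2)) * ennreal (exp (- (1 / 2) * (norm (x::real^'d))\<^sup>2)) \<partial>lborel)"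
    by (simp add: std_gauss_def emeasure_density ennreal_mult)
  also have "\<dots> = ennreal ((2 * pi) powr (- real CARD('d) / 2)) * ennreal ((pi / (1 / 2)) powr (real CARD('d) / 2))"
    by (subst nn_integral_cmult, simp, subst nn_integral_gaussian_vec) auto
  also have "\<dots> = 1"
    by (simp add: ennreal_mult[symmetric] powr_add[symmetric] mult.commute)
  finally show "emeasure std_gauss (space (std_gauss :: (real^'d) measure)) = 1" .
qed

text \<open>Lebesgue measure is the image of a product measure under the coordinate map, so Fubini
  factorizes the integral. The values are complex because the factors will be characters.\<close>

lemma lborel_integral_prod:
  fixes f :: "'a::euclidean_space \<Rightarrow> real \<Rightarrow> complex"
  assumes int: "\<And>b. b \<in> Basis \<Longrightarrow> integrable lborel (f b)"
  shows "(\<integral>x. (\<Prod>b\<in>Basis. f b (x \<bullet> b)) \<partial>lborel) = (\<Prod>b\<in>Basis. \<integral>x. f b x \<partial>lborel)"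
proof -
  interpret product_sigma_finite "\<lambda>_::'a. lborel :: real measure" ..
  have [measurable]: "f b \<in> borel_measurable borel" if "b \<in> Basis" for b
    using int[OF that] by auto
  have *: "(\<Sum>b\<in>Basis. x b *\<^sub>R b) \<bullet> b' = x b'" if "b' \<in> Basis" for x and b' :: 'a
    using that by (simp add: inner_sum_left inner_Basis if_distrib sum.delta cong: if_cong)
  have "(\<integral>x. (\<Prod>b\<in>Basis. f b (x \<bullet> b)) \<partial>lborel)
     = (\<integral>x. (\<Prod>b\<in>Basis. f b ((\<Sum>b\<in>Basis. x b *\<^sub>R b) \<bullet> b)) \<partial>(\<Pi>\<^sub>M b\<in>Basis. lborel))"
    by (subst lborel_eq) (rule integral_distr; measurable)
  also have "\<dots> = (\<integral>x. (\<Prod>b\<in>Basis. f b (x b)) \<partial>(\<Pi>\<^sub>M b\<in>Basis. lborel))"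
    by (intro Bochner_Integration.integral_cong refl prod.cong) (simp add: *)
  also have "\<dots> = (\<Prod>b\<in>Basis. \<integral>x. f b x \<partial>lborel)"
    by (rule product_integral_prod) (auto intro: int)
  finally show ?thesis .
qed

text \<open>Both the density and the character factorize over the coordinates, which reduces the
  claim to dimension one. Read from right to left, it represents a Gaussian kernel as an average of
  characters.\<close>

lemma char_std_gauss:
  fixes t :: "real^'d"
  shows "(\<integral>x. iexp (t \<bullet> x) \<partial>std_gauss) = complex_of_real (exp (- (norm t)\<^sup>2 / 2))"
proof -
  let ?f = "\<lambda>u x. std_normal_density x *\<^sub>R iexp (u * x)"
  have 1: "(\<integral>x. ?f u x \<partial>lborel) = complex_of_real (exp (- u\<^sup>2 / 2))" for u
    using fun_cong[OF char_std_normal_distribution, of u]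
    by (simp add: char_def integral_density normal_density_nonneg)
  have int: "integrable lborel (?f u)" for u
  proof (rule Bochner_Integration.integrable_bound)
    show "integrable lborel std_normal_density" by simp
  qed (auto simp: normal_density_nonneg)
  have "(\<integral>x. iexp (t \<bullet> x) \<partial>std_gauss) = (\<integral>x. ((2 * pi) powr (- real CARD('d) / 2) * exp (- (norm x)\<^sup>2 / 2)) *\<^sub>R iexp (t \<bullet> x) \<partial>lborel)"
    unfolding std_gauss_def by (rule integral_density) auto
  also have "\<dots> = (\<integral>x. (\<Prod>b\<in>Basis. ?f (t \<bullet> b) (x \<bullet> b)) \<partial>lborel)"
  proof (intro Bochner_Integration.integral_cong refl)
    fix x :: "real^'d"
    have "(2 * pi) powr (- real CARD('d) / 2) = (1 / sqrt (2 * pi)) ^ CARD('d)"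
      by (simp add: powr_half_sqrt[symmetric] power_divide powr_power powr_minus_divide)
    then have "(\<Prod>b\<in>Basis. std_normal_density (x \<bullet> b)) = (2 * pi) powr (- real CARD('d) / 2) * exp (- (norm x)\<^sup>2 / 2)"
      by (simp add: std_normal_density_def prod.distrib prod_dividef exp_sum[symmetric] norm_sq_Basis sum_negf sum_divide_distrib power_one_over)
    moreover have "(\<Prod>b\<in>Basis. iexp ((t \<bullet> b) * (x \<bullet> b))) = iexp (t \<bullet> x)"
      by (simp add: exp_sum[symmetric] euclidean_inner[of t x] sum_distrib_left)
    ultimately show "((2 * pi) powr (- real CARD('d) / 2) * exp (- (norm x)\<^sup>2 / 2)) *\<^sub>R iexp (t \<bullet> x) = (\<Prod>b\<in>Basis. ?f (t \<bullet> b) (x \<bullet> b))"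
      by (simp add: scaleR_conv_of_real prod.distrib flip: of_real_prod)
  qed
  also have "\<dots> = (\<Prod>b\<in>Basis. complex_of_real (exp (- (t \<bullet> b)\<^sup>2 / 2)))"
    unfolding lborel_integral_prod[OF int] 1 ..
  also have "\<dots> = complex_of_real (exp (- (norm t)\<^sup>2 / 2))"
    by (simp add: norm_sq_Basis exp_sum[symmetric] sum_negf sum_divide_distrib flip: of_real_prod)
  finally show ?thesis .
qed

text \<open>Substituting \<open>y = R *v z\<close> turns the quadratic form of the inverse of
  \<open>S\<close> into the squared norm of \<open>z\<close>, and det R cancels the power of det S.
  Total mass and characteristic function are then inherited from \<open>std_gauss\<close>.\<close>

lemma mvnormal_eq_distr:
  fixes S R :: "real^'d^'d"
  assumes R: "R \<in> spd" and RS: "R ** R = S"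
  shows "mvnormal 0 S = distr std_gauss borel ((*v) R)"
proof (rule measure_eqI)
  have [measurable]: "(*v) M \<in> borel_measurable borel" for M :: "real^'d^'d"
    by (intro borel_measurable_continuous_onI linear_continuous_on) simp
  note invR = matrix_inv_mul_vec[OF spd_invertible[OF R]]
  have detR: "det R > 0" using det_spd_pos[OF R] .
  have detS: "det S = det R * det R" using det_mul[of R R] RS by simp
  then have invS: "invertible S" using detR by (simp add: invertible_det_nz)
  have SR: "matrix_inv S *v (R *v z) = matrix_inv R *v z" for z
  proof -
    have "S *v (matrix_inv R *v z) = R *v z"
      by (simp add: RS[symmetric] matrix_vector_mul_assoc[symmetric] invR)
    then show ?thesis using matrix_inv_mul_vec(2)[OF invS, of "matrix_inv R *v z"] by simp
  qed
  have q: "(R *v z) \<bullet> (matrix_inv S *v (R *v z)) = (norm z)\<^sup>2" for z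
    by (simp add: SR symmetric_inner[OF spd_symmetric[OF R], symmetric] invR power2_norm_eq_inner)
  have d: "det R * det S powr (- 1 / 2) = 1"
  proof -
    have "det S powr (- 1 / 2) = (det R powr 2) powr (- 1 / 2)"
      using detR by (simp add: detS power2_eq_square)
    also have "\<dots> = det R powr (- 1)" by (subst powr_powr) simp
    finally show ?thesis using detR by (simp add: powr_minus_divide)
  qed
  show "sets (mvnormal 0 S) = sets (distr std_gauss borel ((*v) R))" by (simp add: mvnormal_def)
  fix A assume "A \<in> sets (mvnormal 0 S)"
  then have [measurable]: "A \<in> sets borel" by (simp add: mvnormal_def)
  let ?c = "(2 * pi) powr (- real CARD('d) / 2)"
  have "emeasure (mvnormal 0 S) A = (\<integral>\<^sup>+y. ennreal (?c * det S powr (- 1 / 2) * exp (- (y \<bullet> (matrix_inv S *v y)) / 2)) * indicator A y \<partial>lborel)"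
    unfolding mvnormal_def by (subst emeasure_density) auto
  also have "\<dots> = ennreal \<bar>det R\<bar> * (\<integral>\<^sup>+z. ennreal (?c * det S powr (- 1 / 2) * exp (- (norm z)\<^sup>2 / 2)) * indicator A (R *v z) \<partial>lborel)"
    by (subst nn_integral_affine_matrix[OF spd_invertible[OF R], of _ 0]) (simp_all add: q)
  also have "\<dots> = (\<integral>\<^sup>+z. ennreal (det R * (?c * det S powr (- 1 / 2) * exp (- (norm z)\<^sup>2 / 2))) * indicator A (R *v z) \<partial>lborel)"
    using detR by (subst nn_integral_cmult[symmetric]) (auto simp: ennreal_mult mult.assoc)
  also have "\<dots> = (\<integral>\<^sup>+z. ennreal (?c * exp (- (norm z)\<^sup>2 / 2)) * indicator ((*v) R -` A) z \<partial>lborel)"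
  proof (intro nn_integral_cong)
    fix z :: "real^'d"
    have "det R * (?c * det S powr (- 1 / 2) * exp (- (norm z)\<^sup>2 / 2)) = (det R * det S powr (- 1 / 2)) * (?c * exp (- (norm z)\<^sup>2 / 2))"
      by (simp only: mult_ac)
    then have "det R * (?c * det S powr (- 1 / 2) * exp (- (norm z)\<^sup>2 / 2)) = ?c * exp (- (norm z)\<^sup>2 / 2)"
      unfolding d by simp
    then show "ennreal (det R * (?c * det S powr (- 1 / 2) * exp (- (norm z)\<^sup>2 / 2))) * indicator A (R *v z)
      = ennreal (?c * exp (- (norm z)\<^sup>2 / 2)) * indicator ((*v) R -` A) z"
      by (simp only:) (simp add: indicator_def)
  qed
  also have "\<dots> = emeasure std_gauss ((*v) R -` A)"
    unfolding std_gauss_def using measurable_sets[of "(*v) R" borel borel A] by (subst emeasure_density) auto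
  also have "\<dots> = emeasure (distr std_gauss borel ((*v) R)) A"
    by (subst emeasure_distr) auto
  finally show "emeasure (mvnormal 0 S) A = emeasure (distr std_gauss borel ((*v) R)) A" .
qed

lemma mvnormal_facts:
  fixes S :: "real^'d^'d"
  assumes "S \<in> spd"
  shows prob_space_mvnormal: "prob_space (mvnormal 0 S)"
    and char_mvnormal: "(\<integral>y. iexp (t \<bullet> y) \<partial>mvnormal 0 S) = complex_of_real (exp (- (t \<bullet> (S *v t)) / 2))"
proof -
  obtain R where R: "R \<in> spd" "R ** R = S" using spd_sqrt_exists[OF assms] .
  have [measurable]: "(*v) R \<in> borel_measurable borel"
    by (intro borel_measurable_continuous_onI linear_continuous_on) simp
  note eq = mvnormal_eq_distr[OF R]
  show "prob_space (mvnormal 0 S)"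
    unfolding eq by (intro prob_space.prob_space_distr prob_space_std_gauss) simp
  have "(\<integral>y. iexp (t \<bullet> y) \<partial>mvnormal 0 S) = (\<integral>z. iexp ((R *v t) \<bullet> z) \<partial>std_gauss)"
    unfolding eq by (subst integral_distr) (simp_all add: symmetric_inner[OF spd_symmetric[OF R(1)]])
  also have "(norm (R *v t))\<^sup>2 = t \<bullet> (S *v t)"
    by (simp add: power2_norm_eq_inner symmetric_inner[OF spd_symmetric[OF R(1)], symmetric] R(2)[symmetric] matrix_vector_mul_assoc)
  then have "(\<integral>z. iexp ((R *v t) \<bullet> z) \<partial>std_gauss) = complex_of_real (exp (- (t \<bullet> (S *v t)) / 2))"
    by (simp add: char_std_gauss)
  finally show "(\<integral>y. iexp (t \<bullet> y) \<partial>mvnormal 0 S) = complex_of_real (exp (- (t \<bullet> (S *v t)) / 2))" .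
qed

section \<open>Uniformly differentiable families\<close>

text \<open>Only pairs of points of \<open>U\<close> are compared, so \<open>U\<close> need not be open: it will be a
  neighbourhood in the space of symmetric matrices.\<close>

definition c11 :: "'p::real_normed_vector set \<Rightarrow> ('p \<Rightarrow> 'x \<Rightarrow> real) \<Rightarrow> ('p \<Rightarrow> 'x \<Rightarrow> 'p \<Rightarrow> real) \<Rightarrow> bool" where
  "c11 U F D \<longleftrightarrow> (\<forall>\<theta>\<in>U. \<forall>\<theta>'\<in>U. norm (\<theta>' - \<theta>) \<le> 1) \<and> (\<forall>\<theta>\<in>U. \<forall>x. linear (D \<theta> x)) \<and>
     (\<exists>C\<ge>0. (\<forall>\<theta>\<in>U. \<forall>x. \<bar>F \<theta> x\<bar> \<le> C) \<and> (\<forall>\<theta>\<in>U. \<forall>x h. \<bar>D \<theta> x h\<bar> \<le> C * norm h) \<and>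
       (\<forall>\<theta>\<in>U. \<forall>\<theta>'\<in>U. \<forall>x. \<bar>F \<theta>' x - F \<theta> x - D \<theta> x (\<theta>' - \<theta>)\<bar> \<le> C * (norm (\<theta>' - \<theta>))\<^sup>2))"

lemma c11I:
  assumes "\<And>\<theta> \<theta>'. \<theta> \<in> U \<Longrightarrow> \<theta>' \<in> U \<Longrightarrow> norm (\<theta>' - \<theta>) \<le> 1"
    and "\<And>\<theta> x. \<theta> \<in> U \<Longrightarrow> linear (D \<theta> x)"
    and "\<And>\<theta> x. \<theta> \<in> U \<Longrightarrow> \<bar>F \<theta> x\<bar> \<le> Ca"
    and "\<And>\<theta> x h. \<theta> \<in> U \<Longrightarrow> \<bar>D \<theta> x h\<bar> \<le> Cb * norm h"
    and "\<And>\<theta> \<theta>' x. \<theta> \<in> U \<Longrightarrow> \<theta>' \<in> U \<Longrightarrow> \<bar>F \<theta>' x - F \<theta> x - D \<theta> x (\<theta>' - \<theta>)\<bar> \<le> Cc * (norm (\<theta>' - \<theta>))\<^sup>2"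
  shows "c11 U F D"
proof -
  let ?C = "max 0 (max Ca (max Cb Cc))"
  have "\<bar>F \<theta> x\<bar> \<le> ?C" if "\<theta> \<in> U" for \<theta> x
    using assms(3)[OF that, of x] by linarith
  moreover have "\<bar>D \<theta> x h\<bar> \<le> ?C * norm h" if "\<theta> \<in> U" for \<theta> x h
    by (rule order_trans[OF assms(4)[OF that]]) (intro mult_right_mono; simp)
  moreover have "\<bar>F \<theta>' x - F \<theta> x - D \<theta> x (\<theta>' - \<theta>)\<bar> \<le> ?C * (norm (\<theta>' - \<theta>))\<^sup>2" if "\<theta> \<in> U" "\<theta>' \<in> U" for \<theta> \<theta>' x
    by (rule order_trans[OF assms(5)[OF that]]) (intro mult_right_mono; simp)
  ultimately show ?thesis
    unfolding c11_def using assms(1,2) by (intro conjI exI[of _ ?C]) auto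
qed

text \<open>The final Lipschitz bound combines the derivative bound with the remainder bound. This
  is where the diameter condition enters: displacements have norm at most 1, so their squares are no
  larger than they are.\<close>

lemma c11E:
  assumes "c11 U F D"
  obtains C where "C \<ge> 0" "\<And>\<theta> x. \<theta> \<in> U \<Longrightarrow> \<bar>F \<theta> x\<bar> \<le> C" "\<And>\<theta> x h. \<theta> \<in> U \<Longrightarrow> \<bar>D \<theta> x h\<bar> \<le> C * norm h"
    "\<And>\<theta> \<theta>' x. \<theta> \<in> U \<Longrightarrow> \<theta>' \<in> U \<Longrightarrow> \<bar>F \<theta>' x - F \<theta> x - D \<theta> x (\<theta>' - \<theta>)\<bar> \<le> C * (norm (\<theta>' - \<theta>))\<^sup>2"
    "\<And>\<theta> \<theta>' x. \<theta> \<in> U \<Longrightarrow> \<theta>' \<in> U \<Longrightarrow> \<bar>F \<theta>' x - F \<theta> x\<bar> \<le> 2 * C * norm (\<theta>' - \<theta>)"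
proof -
  obtain C where C0: "C \<ge> 0 \<and> (\<forall>\<theta>\<in>U. \<forall>x. \<bar>F \<theta> x\<bar> \<le> C) \<and> (\<forall>\<theta>\<in>U. \<forall>x h. \<bar>D \<theta> x h\<bar> \<le> C * norm h) \<and>
       (\<forall>\<theta>\<in>U. \<forall>\<theta>'\<in>U. \<forall>x. \<bar>F \<theta>' x - F \<theta> x - D \<theta> x (\<theta>' - \<theta>)\<bar> \<le> C * (norm (\<theta>' - \<theta>))\<^sup>2)"
    using assms unfolding c11_def by auto
  then have C: "C \<ge> 0" "\<And>\<theta> x. \<theta> \<in> U \<Longrightarrow> \<bar>F \<theta> x\<bar> \<le> C" "\<And>\<theta> x h. \<theta> \<in> U \<Longrightarrow> \<bar>D \<theta> x h\<bar> \<le> C * norm h"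
    "\<And>\<theta> \<theta>' x. \<theta> \<in> U \<Longrightarrow> \<theta>' \<in> U \<Longrightarrow> \<bar>F \<theta>' x - F \<theta> x - D \<theta> x (\<theta>' - \<theta>)\<bar> \<le> C * (norm (\<theta>' - \<theta>))\<^sup>2"
    by auto
  moreover have "\<bar>F \<theta>' x - F \<theta> x\<bar> \<le> 2 * C * norm (\<theta>' - \<theta>)" if U: "\<theta> \<in> U" "\<theta>' \<in> U" for \<theta> \<theta>' x
  proof -
    have "norm (\<theta>' - \<theta>) \<le> 1" using assms U unfolding c11_def by blast
    then have "C * (norm (\<theta>' - \<theta>))\<^sup>2 \<le> C * norm (\<theta>' - \<theta>)"
      using C(1) by (intro mult_left_mono) (auto simp: power2_eq_square mult_left_le)
    then show ?thesis using C(3)[OF U(1), of x "\<theta>' - \<theta>"] C(4)[OF U, of x] by linarith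
  qed
  ultimately show ?thesis by (rule that)
qed

lemma c11_diam: "c11 U F D \<Longrightarrow> \<theta> \<in> U \<Longrightarrow> \<theta>' \<in> U \<Longrightarrow> norm (\<theta>' - \<theta>) \<le> 1"
  unfolding c11_def by blast

lemma c11_linearD: "c11 U F D \<Longrightarrow> \<theta> \<in> U \<Longrightarrow> linear (D \<theta> x)"
  unfolding c11_def by blast

lemma c11_cong:
  assumes "c11 U F D" "\<And>\<theta> x. \<theta> \<in> U \<Longrightarrow> F \<theta> x = F' \<theta> x" "\<And>\<theta> x h. \<theta> \<in> U \<Longrightarrow> D \<theta> x h = D' \<theta> x h"
  shows "c11 U F' D'"
proof -
  have "D \<theta> x = D' \<theta> x" if "\<theta> \<in> U" for \<theta> x using assms(3)[OF that] by auto
  then show ?thesis using assms(1,2) unfolding c11_def by simp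
qed

lemma c11_const:
  assumes "\<And>\<theta> \<theta>'. \<theta> \<in> U \<Longrightarrow> \<theta>' \<in> U \<Longrightarrow> norm (\<theta>' - \<theta>) \<le> 1" and "\<And>x. \<bar>f x\<bar> \<le> C"
  shows "c11 U (\<lambda>\<theta> x. f x) (\<lambda>\<theta> x h. 0)"
  by (rule c11I[where Ca=C and Cb=0 and Cc=0]) (auto simp: assms module_hom_zero)

text \<open>The remainder is zero, and boundedness on \<open>U\<close> follows from the value at one
  point together with the diameter condition.\<close>

lemma c11_linear:
  assumes diam: "\<And>\<theta> \<theta>'. \<theta> \<in> U \<Longrightarrow> \<theta>' \<in> U \<Longrightarrow> norm (\<theta>' - \<theta>) \<le> 1" and l: "bounded_linear l"
  shows "c11 U (\<lambda>\<theta> x. l \<theta>) (\<lambda>\<theta> x h. l h)"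
proof (cases "U = {}")
  case False
  then obtain \<theta>0 where \<theta>0: "\<theta>0 \<in> U" by blast
  interpret bounded_linear l by fact
  show ?thesis
  proof (rule c11I[OF diam, where Ca="\<bar>l \<theta>0\<bar> + onorm l" and Cb="onorm l" and Cc=0])
    fix \<theta> assume "\<theta> \<in> U"
    have "\<bar>l (\<theta> - \<theta>0)\<bar> \<le> onorm l * norm (\<theta> - \<theta>0)" using onorm[OF l] by simp
    also have "\<dots> \<le> onorm l" using diam[OF \<theta>0 \<open>\<theta> \<in> U\<close>] onorm_pos_le[OF l] by (simp add: mult_left_le)
    finally show "\<bar>l \<theta>\<bar> \<le> \<bar>l \<theta>0\<bar> + onorm l" by (simp add: diff)
  next
    show "\<bar>l h\<bar> \<le> onorm l * norm h" for h using onorm[OF l] by simp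
  qed (auto simp: diff linear_axioms)
qed (auto simp: c11_def intro: exI[of _ 0])

lemma c11_add:
  assumes F: "c11 U F DF" and G: "c11 U G DG"
  shows "c11 U (\<lambda>\<theta> x. F \<theta> x + G \<theta> x) (\<lambda>\<theta> x h. DF \<theta> x h + DG \<theta> x h)"
proof -
  obtain Cf where f: "Cf \<ge> 0" "\<And>\<theta> x. \<theta> \<in> U \<Longrightarrow> \<bar>F \<theta> x\<bar> \<le> Cf" "\<And>\<theta> x h. \<theta> \<in> U \<Longrightarrow> \<bar>DF \<theta> x h\<bar> \<le> Cf * norm h"
    "\<And>\<theta> \<theta>' x. \<theta> \<in> U \<Longrightarrow> \<theta>' \<in> U \<Longrightarrow> \<bar>F \<theta>' x - F \<theta> x - DF \<theta> x (\<theta>' - \<theta>)\<bar> \<le> Cf * (norm (\<theta>' - \<theta>))\<^sup>2"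
    using c11E[OF F] by metis
  obtain Cg where g: "Cg \<ge> 0" "\<And>\<theta> x. \<theta> \<in> U \<Longrightarrow> \<bar>G \<theta> x\<bar> \<le> Cg" "\<And>\<theta> x h. \<theta> \<in> U \<Longrightarrow> \<bar>DG \<theta> x h\<bar> \<le> Cg * norm h"
    "\<And>\<theta> \<theta>' x. \<theta> \<in> U \<Longrightarrow> \<theta>' \<in> U \<Longrightarrow> \<bar>G \<theta>' x - G \<theta> x - DG \<theta> x (\<theta>' - \<theta>)\<bar> \<le> Cg * (norm (\<theta>' - \<theta>))\<^sup>2"
    using c11E[OF G] by metis
  show ?thesis
  proof (rule c11I[OF c11_diam[OF F]])
    show "linear (\<lambda>h. DF \<theta> x h + DG \<theta> x h)" if "\<theta> \<in> U" for \<theta> x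
      by (intro linear_compose_add c11_linearD[OF F that] c11_linearD[OF G that])
    show "\<bar>F \<theta> x + G \<theta> x\<bar> \<le> Cf + Cg" if "\<theta> \<in> U" for \<theta> x
      using f(2)[OF that, of x] g(2)[OF that, of x] by linarith
    show "\<bar>DF \<theta> x h + DG \<theta> x h\<bar> \<le> (Cf + Cg) * norm h" if "\<theta> \<in> U" for \<theta> x h
      unfolding distrib_right using f(3)[OF that, of x h] g(3)[OF that, of x h] by linarith
    show "\<bar>F \<theta>' x + G \<theta>' x - (F \<theta> x + G \<theta> x) - (DF \<theta> x (\<theta>' - \<theta>) + DG \<theta> x (\<theta>' - \<theta>))\<bar> \<le> (Cf + Cg) * (norm (\<theta>' - \<theta>))\<^sup>2"
      if "\<theta> \<in> U" "\<theta>' \<in> U" for \<theta> \<theta>' x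
      unfolding distrib_right using f(4)[OF that, of x] g(4)[OF that, of x] by linarith
  qed
qed

lemma c11_mult:
  assumes F: "c11 U F DF" and G: "c11 U G DG"
  shows "c11 U (\<lambda>\<theta> x. F \<theta> x * G \<theta> x) (\<lambda>\<theta> x h. DF \<theta> x h * G \<theta> x + F \<theta> x * DG \<theta> x h)"
proof -
  obtain Cf where f: "Cf \<ge> 0" "\<And>\<theta> x. \<theta> \<in> U \<Longrightarrow> \<bar>F \<theta> x\<bar> \<le> Cf" "\<And>\<theta> x h. \<theta> \<in> U \<Longrightarrow> \<bar>DF \<theta> x h\<bar> \<le> Cf * norm h"
    "\<And>\<theta> \<theta>' x. \<theta> \<in> U \<Longrightarrow> \<theta>' \<in> U \<Longrightarrow> \<bar>F \<theta>' x - F \<theta> x - DF \<theta> x (\<theta>' - \<theta>)\<bar> \<le> Cf * (norm (\<theta>' - \<theta>))\<^sup>2"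
    "\<And>\<theta> \<theta>' x. \<theta> \<in> U \<Longrightarrow> \<theta>' \<in> U \<Longrightarrow> \<bar>F \<theta>' x - F \<theta> x\<bar> \<le> 2 * Cf * norm (\<theta>' - \<theta>)"
    using c11E[OF F] by metis
  obtain Cg where g: "Cg \<ge> 0" "\<And>\<theta> x. \<theta> \<in> U \<Longrightarrow> \<bar>G \<theta> x\<bar> \<le> Cg" "\<And>\<theta> x h. \<theta> \<in> U \<Longrightarrow> \<bar>DG \<theta> x h\<bar> \<le> Cg * norm h"
    "\<And>\<theta> \<theta>' x. \<theta> \<in> U \<Longrightarrow> \<theta>' \<in> U \<Longrightarrow> \<bar>G \<theta>' x - G \<theta> x - DG \<theta> x (\<theta>' - \<theta>)\<bar> \<le> Cg * (norm (\<theta>' - \<theta>))\<^sup>2"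
    "\<And>\<theta> \<theta>' x. \<theta> \<in> U \<Longrightarrow> \<theta>' \<in> U \<Longrightarrow> \<bar>G \<theta>' x - G \<theta> x\<bar> \<le> 2 * Cg * norm (\<theta>' - \<theta>)"
    using c11E[OF G] by metis
  show ?thesis
  proof (rule c11I[OF c11_diam[OF F]])
    show "linear (\<lambda>h. DF \<theta> x h * G \<theta> x + F \<theta> x * DG \<theta> x h)" if "\<theta> \<in> U" for \<theta> x
    proof -
      interpret f: linear "DF \<theta> x" by (rule c11_linearD[OF F that])
      interpret g: linear "DG \<theta> x" by (rule c11_linearD[OF G that])
      show ?thesis by (rule linearI) (simp_all add: f.add g.add f.scale g.scale algebra_simps)
    qed
    show "\<bar>F \<theta> x * G \<theta> x\<bar> \<le> Cf * Cg" if "\<theta> \<in> U" for \<theta> x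
      unfolding abs_mult by (intro mult_mono f(2) g(2) that f(1)) simp
    show "\<bar>DF \<theta> x h * G \<theta> x + F \<theta> x * DG \<theta> x h\<bar> \<le> (2 * Cf * Cg) * norm h" if "\<theta> \<in> U" for \<theta> x h
    proof -
      have "\<bar>DF \<theta> x h * G \<theta> x\<bar> \<le> (Cf * norm h) * Cg"
        unfolding abs_mult by (intro mult_mono f(3) g(2) that mult_nonneg_nonneg f(1)) simp_all
      moreover have "\<bar>F \<theta> x * DG \<theta> x h\<bar> \<le> Cf * (Cg * norm h)"
        unfolding abs_mult by (intro mult_mono f(2) g(3) that f(1)) simp_all
      ultimately show ?thesis by (simp add: mult_ac)
    qed
    \<comment> \<open>The error splits into the product of the two increments and one remainder of
      each factor; 6 = 4 + 1 + 1, with 4 the product of the Lipschitz factors 2 and 2.\<close>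
    show "\<bar>F \<theta>' x * G \<theta>' x - F \<theta> x * G \<theta> x - (DF \<theta> x (\<theta>' - \<theta>) * G \<theta> x + F \<theta> x * DG \<theta> x (\<theta>' - \<theta>))\<bar>
      \<le> (6 * Cf * Cg) * (norm (\<theta>' - \<theta>))\<^sup>2"
      if U: "\<theta> \<in> U" "\<theta>' \<in> U" for \<theta> \<theta>' x
    proof -
      let ?h = "norm (\<theta>' - \<theta>)"
      have "\<bar>(F \<theta>' x - F \<theta> x) * (G \<theta>' x - G \<theta> x)\<bar> \<le> (2 * Cf * ?h) * (2 * Cg * ?h)"
        unfolding abs_mult by (intro mult_mono f(5) g(5) U mult_nonneg_nonneg f(1)) simp_all
      moreover have "\<bar>F \<theta> x * (G \<theta>' x - G \<theta> x - DG \<theta> x (\<theta>' - \<theta>))\<bar> \<le> Cf * (Cg * ?h\<^sup>2)"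
        unfolding abs_mult by (intro mult_mono f(2) g(4) U f(1)) simp_all
      moreover have "\<bar>(F \<theta>' x - F \<theta> x - DF \<theta> x (\<theta>' - \<theta>)) * G \<theta> x\<bar> \<le> (Cf * ?h\<^sup>2) * Cg"
        unfolding abs_mult by (intro mult_mono f(4) g(2) U mult_nonneg_nonneg f(1)) simp_all
      moreover have "F \<theta>' x * G \<theta>' x - F \<theta> x * G \<theta> x - (DF \<theta> x (\<theta>' - \<theta>) * G \<theta> x + F \<theta> x * DG \<theta> x (\<theta>' - \<theta>))
        = (F \<theta>' x - F \<theta> x) * (G \<theta>' x - G \<theta> x) + F \<theta> x * (G \<theta>' x - G \<theta> x - DG \<theta> x (\<theta>' - \<theta>))
          + (F \<theta>' x - F \<theta> x - DF \<theta> x (\<theta>' - \<theta>)) * G \<theta> x"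
        by (simp add: algebra_simps)
      moreover have "(2 * Cf * ?h) * (2 * Cg * ?h) + Cf * (Cg * ?h\<^sup>2) + (Cf * ?h\<^sup>2) * Cg = (6 * Cf * Cg) * ?h\<^sup>2"
        by (simp add: power2_eq_square algebra_simps)
      ultimately show ?thesis by linarith
    qed
  qed
qed

lemma c11_weight:
  assumes F: "c11 U F DF" and f: "\<And>x. \<bar>f x\<bar> \<le> C"
  shows "c11 U (\<lambda>\<theta> x. F \<theta> x * f x) (\<lambda>\<theta> x h. DF \<theta> x h * f x)"
  by (rule c11_cong[OF c11_mult[OF F c11_const[of U f C, OF c11_diam[OF F] f]]]) auto

section \<open>Chain rule, finite sums and products\<close>

text \<open>The mean value bound is used twice: on \<open>\<phi>'\<close>, making it Lipschitz with
  constant \<open>K\<close>, and then on \<open>\<phi>\<close> minus its tangent at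
  \<open>v\<close>, whose derivative is an increment of \<open>\<phi>'\<close>. Compactness of the
  interval supplies \<open>K\<close>.\<close>

lemma C2_remainder:
  fixes \<phi> \<phi>' \<phi>'' :: "real \<Rightarrow> real"
  assumes 1: "\<And>u. u \<in> {a..b} \<Longrightarrow> (\<phi> has_field_derivative \<phi>' u) (at u)"
    and 2: "\<And>u. u \<in> {a..b} \<Longrightarrow> (\<phi>' has_field_derivative \<phi>'' u) (at u)"
    and cont: "continuous_on {a..b} \<phi>''"
  obtains K where "K \<ge> 0" "\<And>u. u \<in> {a..b} \<Longrightarrow> \<bar>\<phi> u\<bar> \<le> K" "\<And>u. u \<in> {a..b} \<Longrightarrow> \<bar>\<phi>' u\<bar> \<le> K"
    "\<And>u v. u \<in> {a..b} \<Longrightarrow> v \<in> {a..b} \<Longrightarrow> \<bar>\<phi> u - \<phi> v - \<phi>' v * (u - v)\<bar> \<le> K * (u - v)\<^sup>2"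
proof -
  have bd: "\<exists>K. \<forall>u\<in>{a..b}. \<bar>g u\<bar> \<le> K" if "continuous_on {a..b} g" for g :: "real \<Rightarrow> real"
    using compact_imp_bounded[OF compact_continuous_image[OF that]] by (auto simp: bounded_iff)
  have "continuous_on {a..b} \<phi>" "continuous_on {a..b} \<phi>'"
    using DERIV_isCont[OF 1] DERIV_isCont[OF 2] by (auto intro!: continuous_at_imp_continuous_on)
  from this[THEN bd] cont[THEN bd] obtain K0 K1 K2 where K: "\<And>u. u \<in> {a..b} \<Longrightarrow> \<bar>\<phi> u\<bar> \<le> K0"
    "\<And>u. u \<in> {a..b} \<Longrightarrow> \<bar>\<phi>' u\<bar> \<le> K1" "\<And>u. u \<in> {a..b} \<Longrightarrow> \<bar>\<phi>'' u\<bar> \<le> K2" by metis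
  define K where "K = max 0 (max K0 (max K1 K2))"
  have K': "K \<ge> 0" "\<And>u. u \<in> {a..b} \<Longrightarrow> \<bar>\<phi> u\<bar> \<le> K" "\<And>u. u \<in> {a..b} \<Longrightarrow> \<bar>\<phi>' u\<bar> \<le> K" "\<And>u. u \<in> {a..b} \<Longrightarrow> \<bar>\<phi>'' u\<bar> \<le> K"
    using K by (force simp: K_def)+
  have rem: "\<bar>\<phi> u - \<phi> v - \<phi>' v * (u - v)\<bar> \<le> K * (u - v)\<^sup>2" if uv: "u \<in> {a..b}" "v \<in> {a..b}" for u v
  proof -
    have sub: "closed_segment u v \<subseteq> {a..b}" using uv by (auto simp: closed_segment_eq_real_ivl)
    have lip: "norm (\<phi>' w - \<phi>' v) \<le> K * norm (w - v)" if w: "w \<in> closed_segment u v" for w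
      by (rule field_differentiable_bound[of "closed_segment u v" \<phi>' \<phi>''])
        (use w sub K' in \<open>auto intro!: has_field_derivative_at_within[OF 2]\<close>)
    have "norm ((\<phi> u - \<phi>' v * u) - (\<phi> v - \<phi>' v * v)) \<le> (K * \<bar>u - v\<bar>) * norm (u - v)"
    proof (rule field_differentiable_bound[of "closed_segment u v" _ "\<lambda>w. \<phi>' w - \<phi>' v"])
      fix w assume w: "w \<in> closed_segment u v"
      show "((\<lambda>w. \<phi> w - \<phi>' v * w) has_field_derivative \<phi>' w - \<phi>' v) (at w within closed_segment u v)"
      proof -
        have "(\<phi> has_field_derivative \<phi>' w) (at w)" using 1 w sub by blast
        from DERIV_diff[OF this DERIV_cmult_Id[of "\<phi>' v"]] show ?thesis
          by (rule has_field_derivative_at_within)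
      qed
      have "\<bar>w - v\<bar> \<le> \<bar>u - v\<bar>" using w by (auto simp: closed_segment_eq_real_ivl split: if_splits)
      then show "norm (\<phi>' w - \<phi>' v) \<le> K * \<bar>u - v\<bar>"
        using lip[OF w] K'(1) mult_left_mono[of "\<bar>w - v\<bar>" "\<bar>u - v\<bar>" K] by simp
    qed auto
    moreover have "(\<phi> u - \<phi>' v * u) - (\<phi> v - \<phi>' v * v) = \<phi> u - \<phi> v - \<phi>' v * (u - v)"
      by (simp add: algebra_simps)
    moreover have "(K * \<bar>u - v\<bar>) * norm (u - v) = K * (u - v)\<^sup>2"
      by (simp add: power2_eq_square mult.assoc)
    ultimately show ?thesis by (simp only: real_norm_def)
  qed
  show ?thesis by (rule that[OF K'(1-3) rem])
qed

text \<open>All values of \<open>F\<close> lie in one compact interval on which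
  \<open>\<phi>\<close> is twice differentiable. The remainder consists of that of
  \<open>\<phi>\<close>, quadratic in the increment of \<open>F\<close>, and of
  \<open>\<phi>'\<close> times the remainder of \<open>F\<close>.\<close>

lemma c11_compose:
  fixes \<phi> \<phi>' \<phi>'' :: "real \<Rightarrow> real"
  assumes F: "c11 U F DF" and rng: "\<And>\<theta> x. \<theta> \<in> U \<Longrightarrow> F \<theta> x \<in> {a..b}"
    and 1: "\<And>u. u \<in> {a..b} \<Longrightarrow> (\<phi> has_field_derivative \<phi>' u) (at u)"
    and 2: "\<And>u. u \<in> {a..b} \<Longrightarrow> (\<phi>' has_field_derivative \<phi>'' u) (at u)"
    and cont: "continuous_on {a..b} \<phi>''"
  shows "c11 U (\<lambda>\<theta> x. \<phi> (F \<theta> x)) (\<lambda>\<theta> x h. \<phi>' (F \<theta> x) * DF \<theta> x h)"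
proof -
  obtain K where K: "K \<ge> 0" "\<And>u. u \<in> {a..b} \<Longrightarrow> \<bar>\<phi> u\<bar> \<le> K" "\<And>u. u \<in> {a..b} \<Longrightarrow> \<bar>\<phi>' u\<bar> \<le> K"
    "\<And>u v. u \<in> {a..b} \<Longrightarrow> v \<in> {a..b} \<Longrightarrow> \<bar>\<phi> u - \<phi> v - \<phi>' v * (u - v)\<bar> \<le> K * (u - v)\<^sup>2"
    using C2_remainder[OF 1 2 cont] by metis
  obtain Cf where f: "Cf \<ge> 0" "\<And>\<theta> x. \<theta> \<in> U \<Longrightarrow> \<bar>F \<theta> x\<bar> \<le> Cf" "\<And>\<theta> x h. \<theta> \<in> U \<Longrightarrow> \<bar>DF \<theta> x h\<bar> \<le> Cf * norm h"
    "\<And>\<theta> \<theta>' x. \<theta> \<in> U \<Longrightarrow> \<theta>' \<in> U \<Longrightarrow> \<bar>F \<theta>' x - F \<theta> x - DF \<theta> x (\<theta>' - \<theta>)\<bar> \<le> Cf * (norm (\<theta>' - \<theta>))\<^sup>2"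
    "\<And>\<theta> \<theta>' x. \<theta> \<in> U \<Longrightarrow> \<theta>' \<in> U \<Longrightarrow> \<bar>F \<theta>' x - F \<theta> x\<bar> \<le> 2 * Cf * norm (\<theta>' - \<theta>)"
    using c11E[OF F] by metis
  show ?thesis
  proof (rule c11I[OF c11_diam[OF F]])
    show "linear (\<lambda>h. \<phi>' (F \<theta> x) * DF \<theta> x h)" if "\<theta> \<in> U" for \<theta> x
    proof -
      interpret f: linear "DF \<theta> x" by (rule c11_linearD[OF F that])
      show ?thesis by (rule linearI) (simp_all add: f.add f.scale algebra_simps)
    qed
    show "\<bar>\<phi> (F \<theta> x)\<bar> \<le> K" if "\<theta> \<in> U" for \<theta> x using K(2) rng[OF that] by blast
    show "\<bar>\<phi>' (F \<theta> x) * DF \<theta> x h\<bar> \<le> (K * Cf) * norm h" if "\<theta> \<in> U" for \<theta> x h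
      unfolding abs_mult mult.assoc by (intro mult_mono K(3) f(3) rng that K(1)) simp
    show "\<bar>\<phi> (F \<theta>' x) - \<phi> (F \<theta> x) - \<phi>' (F \<theta> x) * DF \<theta> x (\<theta>' - \<theta>)\<bar> \<le> (K * (4 * Cf * Cf + Cf)) * (norm (\<theta>' - \<theta>))\<^sup>2"
      if U: "\<theta> \<in> U" "\<theta>' \<in> U" for \<theta> \<theta>' x
    proof -
      let ?h = "norm (\<theta>' - \<theta>)"
      have "(F \<theta>' x - F \<theta> x)\<^sup>2 \<le> (2 * Cf * ?h)\<^sup>2"
        using f(5)[OF U, of x] by (rule power2_le_iff_abs_le[THEN iffD2, rotated]) (use f(1) in simp)
      then have "K * (F \<theta>' x - F \<theta> x)\<^sup>2 \<le> K * (2 * Cf * ?h)\<^sup>2" using K(1) by (rule mult_left_mono)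
      moreover have "\<bar>\<phi> (F \<theta>' x) - \<phi> (F \<theta> x) - \<phi>' (F \<theta> x) * (F \<theta>' x - F \<theta> x)\<bar> \<le> K * (F \<theta>' x - F \<theta> x)\<^sup>2"
        by (intro K(4) rng U)
      moreover have "\<bar>\<phi>' (F \<theta> x) * (F \<theta>' x - F \<theta> x - DF \<theta> x (\<theta>' - \<theta>))\<bar> \<le> K * (Cf * ?h\<^sup>2)"
        unfolding abs_mult by (intro mult_mono K(3) f(4) U rng K(1)) simp
      moreover have "K * (2 * Cf * ?h)\<^sup>2 + K * (Cf * ?h\<^sup>2) = (K * (4 * Cf * Cf + Cf)) * ?h\<^sup>2"
        by (simp add: power2_eq_square algebra_simps)
      moreover have "\<phi> (F \<theta>' x) - \<phi> (F \<theta> x) - \<phi>' (F \<theta> x) * DF \<theta> x (\<theta>' - \<theta>)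
        = (\<phi> (F \<theta>' x) - \<phi> (F \<theta> x) - \<phi>' (F \<theta> x) * (F \<theta>' x - F \<theta> x))
          + \<phi>' (F \<theta> x) * (F \<theta>' x - F \<theta> x - DF \<theta> x (\<theta>' - \<theta>))"
        by (simp add: algebra_simps)
      ultimately show ?thesis by linarith
    qed
  qed
qed

text \<open>The derivative is left unnamed: for the determinant and the normalizing constant its
  existence is enough, and a formula would only burden the proof.\<close>

lemma c11_sum_ex:
  assumes diam: "\<And>\<theta> \<theta>'. \<theta> \<in> U \<Longrightarrow> \<theta>' \<in> U \<Longrightarrow> norm (\<theta>' - \<theta>) \<le> 1"
    and "finite I" and "\<And>i. i \<in> I \<Longrightarrow> \<exists>D. c11 U (F i) D"
  shows "\<exists>D. c11 U (\<lambda>\<theta> x. \<Sum>i\<in>I. F i \<theta> x) D"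
  using assms(2,3)
proof (induction rule: finite_induct)
  case empty
  show ?case using c11_const[OF diam, of U "\<lambda>_. 0" 0] by (intro exI) auto
next
  case (insert i I)
  then obtain D1 D2 where "c11 U (F i) D1" "c11 U (\<lambda>\<theta> x. \<Sum>i\<in>I. F i \<theta> x) D2" by blast
  from c11_add[OF this] show ?case using insert.hyps by auto
qed

lemma c11_prod_ex:
  assumes diam: "\<And>\<theta> \<theta>'. \<theta> \<in> U \<Longrightarrow> \<theta>' \<in> U \<Longrightarrow> norm (\<theta>' - \<theta>) \<le> 1"
    and "finite I" and "\<And>i. i \<in> I \<Longrightarrow> \<exists>D. c11 U (F i) D"
  shows "\<exists>D. c11 U (\<lambda>\<theta> x. \<Prod>i\<in>I. F i \<theta> x) D"
  using assms(2,3)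
proof (induction rule: finite_induct)
  case empty
  show ?case using c11_const[OF diam, of U "\<lambda>_. 1" 1] by (intro exI) auto
next
  case (insert i I)
  then obtain D1 D2 where "c11 U (F i) D1" "c11 U (\<lambda>\<theta> x. \<Prod>i\<in>I. F i \<theta> x) D2" by blast
  from c11_mult[OF this] show ?case using insert.hyps by auto
qed

section \<open>Local expansion of the Student log density\<close>

abbreviation (input) loc :: "'k::finite param \<Rightarrow> 'k rvec" where "loc \<theta> \<equiv> fst \<theta>"
abbreviation (input) scat :: "'k::finite param \<Rightarrow> 'k rmat" where "scat \<theta> \<equiv> fst (snd \<theta>)"
abbreviation (input) dof :: "'k::finite param \<Rightarrow> real" where "dof \<theta> \<equiv> snd (snd \<theta>)"

lemma param_spaceI: "scat \<theta> \<in> spd \<Longrightarrow> dof \<theta> > 0 \<Longrightarrow> \<theta> \<in> param_space"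
  by (cases \<theta>) (auto simp: param_space_def)

lemma param_space_scat: "\<theta> \<in> param_space \<Longrightarrow> scat \<theta> \<in> spd" and param_space_dof: "\<theta> \<in> param_space \<Longrightarrow> dof \<theta> > 0"
  by (cases \<theta>; auto simp: param_space_def)+

lemma norm_loc_le: "norm (loc h) \<le> norm h" and norm_scat_le: "norm (scat h) \<le> norm h" and abs_dof_le: "\<bar>dof h\<bar> \<le> norm h"
proof -
  show "norm (loc h) \<le> norm h" using norm_fst_le[of "loc h" "snd h"] by simp
  have s: "norm (snd h) \<le> norm h" using norm_snd_le[of "snd h" "fst h"] by simp
  show "norm (scat h) \<le> norm h" using norm_fst_le[of "scat h" "dof h"] s by simp
  show "\<bar>dof h\<bar> \<le> norm h" using norm_snd_le[of "dof h" "scat h"] s by simp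
qed

text \<open>The full inverse rather than its root: for a symmetric scatter matrix this is half the
  gradient of \<open>quad\<close> in \<open>x\<close>, and the parameter derivative of
  \<open>quad\<close> is a polynomial in it.\<close>

definition whiten :: "'k::finite param \<Rightarrow> 'k rvec \<Rightarrow> 'k rvec" where
  "whiten \<theta> x = matrix_inv (scat \<theta>) *v (x - loc \<theta>)"

text \<open>The squared Mahalanobis distance of \<open>x\<close> from the location.\<close>

definition quad :: "'k::finite param \<Rightarrow> 'k rvec \<Rightarrow> real" where
  "quad \<theta> x = (x - loc \<theta>) \<bullet> whiten \<theta> x"

text \<open>The differential of \<open>quad\<close> in the direction \<open>h\<close>, from the rule
  that the inverse of a matrix S has differential minus inv S times dS times inv S.\<close>

definition dquad :: "'k::finite param \<Rightarrow> 'k rvec \<Rightarrow> 'k param \<Rightarrow> real" where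
  "dquad \<theta> x h = - 2 * (loc h \<bullet> whiten \<theta> x) - whiten \<theta> x \<bullet> (scat h *v whiten \<theta> x)"

text \<open>All summands of the log density free of \<open>x\<close>, once ln (1 + quad /
  \<open>\<nu>\<close>) is split as ln (\<open>\<nu>\<close> + quad) - ln \<open>\<nu>\<close>; the
  split accounts for the last summand.\<close>

definition log_const :: "'k::finite param \<Rightarrow> real" where
  "log_const \<theta> = ln_Gamma ((dof \<theta> + real CARD('k)) / 2) - real CARD('k) / 2 * (ln pi + ln (dof \<theta>)) - ln_Gamma (dof \<theta> / 2)
     - 1 / 2 * ln (det (scat \<theta>)) + (dof \<theta> + real CARD('k)) / 2 * ln (dof \<theta>)"

definition sq1 :: "real^'n \<Rightarrow> real" where
  "sq1 x = 1 + (norm x)\<^sup>2"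

text \<open>The summand 1 keeps the weight at least 1, so it dominates constants and is a safe
  divisor. Its exponentials are powers of \<open>sq1\<close> up to a constant factor.\<close>

definition logw :: "real^'n \<Rightarrow> real" where
  "logw x = 1 + ln (sq1 x)"

lemma sq1_ge: "sq1 x \<ge> 1" by (simp add: sq1_def)

lemma logw_ge: "logw x \<ge> 1" using sq1_ge[of x] by (simp add: logw_def)

lemma quad_nonneg:
  assumes "\<theta> \<in> param_space"
  shows "quad \<theta> x \<ge> 0"
proof (cases "x - loc \<theta> = 0")
  case False
  then show ?thesis
    using spd_pos[OF spd_matrix_inv[OF param_space_scat[OF assms]] False] by (simp add: quad_def whiten_def)
qed (simp add: quad_def)

lemma ln_student_density:
  fixes \<theta> :: "'k::finite param"
  assumes \<theta>: "\<theta> \<in> param_space"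
  shows "ln (student_density \<theta> x) = log_const \<theta> - (dof \<theta> + real CARD('k)) / 2 * ln (dof \<theta> + quad \<theta> x)"
proof -
  obtain \<mu> \<Sigma> \<nu> where t: "\<theta> = (\<mu>, \<Sigma>, \<nu>)" by (cases \<theta>)
  let ?k = "real CARD('k)"
  have nu: "\<nu> > 0" and S: "\<Sigma> \<in> spd" using \<theta> by (auto simp: t param_space_def)
  have d: "det \<Sigma> > 0" by (rule det_spd_pos[OF S])
  have q: "quad \<theta> x = (norm (inv_sqrt \<Sigma> *v (x - \<mu>)))\<^sup>2"
    by (simp add: quad_def whiten_def t norm_inv_sqrt[OF S])
  have Q: "quad \<theta> x \<ge> 0" by (rule quad_nonneg[OF \<theta>])
  have g: "Gamma (\<nu> / 2) > 0" "Gamma ((\<nu> + ?k) / 2) > 0" "(pi * \<nu>) powr (?k / 2) > 0" using nu by (auto intro!: Gamma_real_pos)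
  have lc: "ln (student_const \<nu> ?k) = ln_Gamma ((\<nu> + ?k) / 2) - ?k / 2 * (ln pi + ln \<nu>) - ln_Gamma (\<nu> / 2)"
  proof -
    have "ln (a / (b * d)) = ln a - ln b - ln d" if "a > 0" "b > 0" "d > 0" for a b d :: real
      using that by (simp add: ln_div ln_mult)
    from this[OF g(2) g(3) g(1)] show ?thesis
      using nu unfolding student_const_def by (simp add: ln_Gamma_real_pos ln_powr ln_mult)
  qed
  have p: "1 + quad \<theta> x / \<nu> > 0" using Q nu by (simp add: add_pos_nonneg)
  have l1: "ln (1 + quad \<theta> x / \<nu>) = ln (\<nu> + quad \<theta> x) - ln \<nu>"
  proof -
    have "1 + quad \<theta> x / \<nu> = (\<nu> + quad \<theta> x) / \<nu>" using nu by (simp add: field_simps)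
    then show ?thesis using nu Q by (simp add: ln_div)
  qed
  have "ln (student_density \<theta> x) = ln (student_const \<nu> ?k * det \<Sigma> powr (- 1 / 2) * (1 + quad \<theta> x / \<nu>) powr (- (\<nu> + ?k) / 2))"
    by (simp add: t q[unfolded t])
  also have "\<dots> = ln (student_const \<nu> ?k) + ln (det \<Sigma> powr (- 1 / 2)) + ln ((1 + quad \<theta> x / \<nu>) powr (- (\<nu> + ?k) / 2))"
    using student_const_pos[OF nu, of ?k] d p by (subst ln_mult_pos, simp, simp, subst ln_mult_pos) auto
  also have "ln ((1 + quad \<theta> x / \<nu>) powr (- (\<nu> + ?k) / 2)) = - ((\<nu> + ?k) / 2 * (ln (\<nu> + quad \<theta> x) - ln \<nu>))"
  proof -
    have e: "- a / 2 * r = - (a / 2 * r)" for a r :: real by simp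
    have "ln ((1 + quad \<theta> x / \<nu>) powr (- (\<nu> + ?k) / 2)) = - (\<nu> + ?k) / 2 * ln (1 + quad \<theta> x / \<nu>)"
      using p by (intro ln_powr)
    then show ?thesis unfolding e l1 .
  qed
  also have "ln (student_const \<nu> ?k) + ln (det \<Sigma> powr (- 1 / 2)) + - ((\<nu> + ?k) / 2 * (ln (\<nu> + quad \<theta> x) - ln \<nu>))
     = ln (student_const \<nu> ?k) - 1 / 2 * ln (det \<Sigma>) - (\<nu> + ?k) / 2 * (ln (\<nu> + quad \<theta> x) - ln \<nu>)"
    using d by (simp add: ln_powr)
  finally show ?thesis unfolding lc log_const_def t by (simp add: algebra_simps)
qed

definition pball :: "'k::finite param \<Rightarrow> real \<Rightarrow> 'k param set" where
  "pball V \<delta> = {\<theta> \<in> param_space. norm (\<theta> - V) < \<delta>}"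

text \<open>A perturbation of norm at most \<open>d\<close> lowers the coercivity constant by at
  most \<open>d\<close>, so symmetric matrices near a positive definite one stay positive definite
  with a common constant.\<close>

lemma spd_nearby:
  fixes A B :: "real^'n^'n"
  assumes "\<And>x. c * (norm x)\<^sup>2 \<le> x \<bullet> (A *v x)" and "norm (B - A) \<le> d"
  shows "(c - d) * (norm x)\<^sup>2 \<le> x \<bullet> (B *v x)"
proof -
  have "\<bar>x \<bullet> ((B - A) *v x)\<bar> \<le> norm x * norm ((B - A) *v x)" by (rule Cauchy_Schwarz_ineq2)
  also have "\<dots> \<le> norm x * (d * norm x)"
    using norm_matrix_vector_le[of "B - A" x]
      mult_right_mono[OF assms(2) norm_ge_zero[of x]]
    by (intro mult_left_mono) auto
  finally have "- d * (norm x)\<^sup>2 \<le> x \<bullet> ((B - A) *v x)" by (simp add: power2_eq_square algebra_simps)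
  moreover have "x \<bullet> (B *v x) = x \<bullet> (A *v x) + x \<bullet> ((B - A) *v x)"
    by (simp add: matrix_vector_mult_diff_rdistrib inner_diff_right)
  ultimately show ?thesis using assms(1)[of x] by (simp add: left_diff_distrib)
qed

section \<open>A neighbourhood with uniform constants\<close>

text \<open>Each bound on the radius has its purpose: 1/2 gives diameter at most 1,
  \<open>c / 2\<close> keeps half of the coercivity constant, and \<open>dof V / 2\<close> confines
  the degrees of freedom between half and three halves of those of \<open>V\<close>.\<close>

locale student_nbhd =
  fixes V :: "'k::finite param" and c \<delta> :: real
  assumes V: "V \<in> param_space" and c_pos: "c > 0" and coercive: "\<And>x. c * (norm x)\<^sup>2 \<le> x \<bullet> (scat V *v x)"
    and \<delta>: "0 < \<delta>" "\<delta> \<le> 1 / 2" "\<delta> \<le> c / 2" "\<delta> \<le> dof V / 2"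
begin

abbreviation "U \<equiv> pball V \<delta>"

lemma U_param: "\<theta> \<in> U \<Longrightarrow> \<theta> \<in> param_space" by (simp add: pball_def)

lemma U_spd: "\<theta> \<in> U \<Longrightarrow> scat \<theta> \<in> spd" using U_param param_space_scat by blast

lemma U_near: "\<theta> \<in> U \<Longrightarrow> norm (\<theta> - V) < \<delta>" by (simp add: pball_def)

lemma U_diam: "\<theta> \<in> U \<Longrightarrow> \<theta>' \<in> U \<Longrightarrow> norm (\<theta>' - \<theta>) \<le> 1"
  using norm_triangle_ineq4[of "\<theta>' - V" "\<theta> - V"] U_near[of \<theta>] U_near[of \<theta>'] \<delta>(2) by simp

lemma U_dof: "\<theta> \<in> U \<Longrightarrow> dof V / 2 \<le> dof \<theta>" "\<theta> \<in> U \<Longrightarrow> dof \<theta> \<le> 3 / 2 * dof V"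
  using abs_dof_le[of "\<theta> - V"] U_near[of \<theta>] \<delta>(4) by auto

lemma dofV: "dof V > 0" using V param_space_dof by blast

lemma U_coercive: "\<theta> \<in> U \<Longrightarrow> c / 2 * (norm x)\<^sup>2 \<le> x \<bullet> (scat \<theta> *v x)"
  using spd_nearby[OF coercive, of "scat \<theta>" "c / 2" x] norm_scat_le[of "\<theta> - V"] U_near[of \<theta>] \<delta>(3) by simp

lemma U_loc: "\<theta> \<in> U \<Longrightarrow> norm (loc \<theta>) \<le> norm (loc V) + 1"
  using norm_loc_le[of "\<theta> - V"] U_near[of \<theta>] \<delta>(2) norm_triangle_ineq2[of "loc \<theta>" "loc V"] by simp

lemma U_scat: "\<theta> \<in> U \<Longrightarrow> norm (scat \<theta>) \<le> norm (scat V) + 1"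
  using norm_scat_le[of "\<theta> - V"] U_near[of \<theta>] \<delta>(2) norm_triangle_ineq2[of "scat \<theta>" "scat V"] by simp

lemma scat_whiten: "\<theta> \<in> U \<Longrightarrow> scat \<theta> *v whiten \<theta> x = x - loc \<theta>"
  unfolding whiten_def by (rule matrix_inv_mul_vec(1)[OF spd_invertible[OF U_spd]])

text \<open>Coercivity with constant \<open>c / 2\<close> and Cauchy-Schwarz bound the inverses of
  all scatter matrices in \<open>U\<close> by \<open>2 / c\<close>.\<close>

lemma norm_inv_le:
  assumes "\<theta> \<in> U"
  shows "norm z \<le> 2 / c * norm (scat \<theta> *v z)"
proof (cases "z = 0")
  case False
  have "c / 2 * (norm z)\<^sup>2 \<le> norm z * norm (scat \<theta> *v z)"
    using U_coercive[OF assms, of z] Cauchy_Schwarz_ineq2[of z "scat \<theta> *v z"] by linarith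
  then show ?thesis using False c_pos by (simp add: power2_eq_square field_simps)
qed (use c_pos in simp)

text \<open>Locations in \<open>U\<close> are bounded, so centring at any of them changes 1 + |x|^2
  by a bounded factor only. The upper estimate bounds \<open>quad\<close> from above; the lower one
  is needed to bound \<open>dof \<theta> + quad \<theta> x\<close> from below.\<close>

lemma norm_resid_sq:
  obtains K where "K \<ge> 1" "\<And>\<theta> x. \<theta> \<in> U \<Longrightarrow> (norm (x - loc \<theta>))\<^sup>2 \<le> K * sq1 x"
    "\<And>\<theta> x. \<theta> \<in> U \<Longrightarrow> sq1 x \<le> K * (1 + (norm (x - loc \<theta>))\<^sup>2)"
proof -
  define M where "M = norm (loc V) + 1"
  have sq: "(a + b)\<^sup>2 \<le> 2 * a\<^sup>2 + 2 * b\<^sup>2" for a b :: real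
    using zero_le_power2[of "a - b"] by (simp add: power2_eq_square algebra_simps)
  show ?thesis
  proof (rule that[of "2 * M\<^sup>2 + 2"])
    fix \<theta> and x :: "'k rvec" assume "\<theta> \<in> U"
    then have M: "(norm (loc \<theta>))\<^sup>2 \<le> M\<^sup>2" using U_loc by (simp add: M_def power_mono)
    have "(norm (x - loc \<theta>))\<^sup>2 \<le> (norm x + norm (loc \<theta>))\<^sup>2"
      by (intro power_mono norm_triangle_ineq4) simp
    then have "(norm (x - loc \<theta>))\<^sup>2 \<le> 2 * (norm x)\<^sup>2 + 2 * M\<^sup>2" using sq[of "norm x" "norm (loc \<theta>)"] M by linarith
    also have "\<dots> \<le> (2 * M\<^sup>2 + 2) * sq1 x" by (simp add: sq1_def algebra_simps)
    finally show "(norm (x - loc \<theta>))\<^sup>2 \<le> (2 * M\<^sup>2 + 2) * sq1 x" .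
    have "norm x \<le> norm (x - loc \<theta>) + norm (loc \<theta>)" using norm_triangle_ineq[of "x - loc \<theta>" "loc \<theta>"] by simp
    then have "(norm x)\<^sup>2 \<le> (norm (x - loc \<theta>) + norm (loc \<theta>))\<^sup>2" by (intro power_mono) auto
    then have "sq1 x \<le> 1 + 2 * (norm (x - loc \<theta>))\<^sup>2 + 2 * M\<^sup>2"
      using sq[of "norm (x - loc \<theta>)" "norm (loc \<theta>)"] M unfolding sq1_def by linarith
    also have "\<dots> \<le> (2 * M\<^sup>2 + 2) * (1 + (norm (x - loc \<theta>))\<^sup>2)" by (simp add: algebra_simps)
    finally show "sq1 x \<le> (2 * M\<^sup>2 + 2) * (1 + (norm (x - loc \<theta>))\<^sup>2)" .
  qed simp
qed

lemma norm_whiten_sq: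
  obtains K where "K \<ge> 1" "\<And>\<theta> x. \<theta> \<in> U \<Longrightarrow> (norm (whiten \<theta> x))\<^sup>2 \<le> K * sq1 x"
proof -
  obtain K where K: "K \<ge> 1" "\<And>\<theta> x. \<theta> \<in> U \<Longrightarrow> (norm (x - loc \<theta>))\<^sup>2 \<le> K * sq1 x"
    using norm_resid_sq by metis
  show ?thesis
  proof (rule that[of "(4 / c\<^sup>2 + 1) * K"])
    have "1 * 1 \<le> (4 / c\<^sup>2 + 1) * K" using K(1) by (intro mult_mono) auto
    then show "(4 / c\<^sup>2 + 1) * K \<ge> 1" by simp
    fix \<theta> and x :: "'k rvec" assume U: "\<theta> \<in> U"
    have "norm (whiten \<theta> x) \<le> 2 / c * norm (x - loc \<theta>)"
      using norm_inv_le[OF U, of "whiten \<theta> x"] by (simp add: scat_whiten[OF U])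
    then have "(norm (whiten \<theta> x))\<^sup>2 \<le> (2 / c * norm (x - loc \<theta>))\<^sup>2" by (intro power_mono) auto
    also have "\<dots> = 4 / c\<^sup>2 * (norm (x - loc \<theta>))\<^sup>2" by (simp add: power_mult_distrib power_divide)
    also have "\<dots> \<le> (4 / c\<^sup>2 + 1) * (K * sq1 x)" using K(2)[OF U, of x] by (intro mult_mono) auto
    finally show "(norm (whiten \<theta> x))\<^sup>2 \<le> (4 / c\<^sup>2 + 1) * K * sq1 x" by (simp only: mult.assoc)
  qed
qed

text \<open>An exact identity instead of a Taylor expansion, obtained by writing both residuals as a
  scatter matrix applied to its whitened vector. Putting \<open>w\<close> for \<open>w'\<close> on
  its right-hand side gives \<open>dquad\<close>. The error of doing so is controlled by the second
  claim, as the new scatter matrix maps \<open>w' - w\<close> to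
  \<open>- loc h - scat h *v w\<close>.\<close>

lemma quad_diff:
  fixes x :: "'k rvec"
  assumes U: "\<theta> \<in> U" "\<theta>' \<in> U"
  defines "w \<equiv> whiten \<theta> x" and "w' \<equiv> whiten \<theta>' x" and "h \<equiv> \<theta>' - \<theta>"
  shows "quad \<theta>' x - quad \<theta> x = - (loc h \<bullet> w') - loc h \<bullet> w - w \<bullet> (scat h *v w')"
    and "norm (w' - w) \<le> 2 / c * (norm h * (1 + norm w))"
proof -
  let ?A = "scat \<theta>" and ?A' = "scat \<theta>'"
  have u: "x - loc \<theta> = ?A *v w" and u': "x - loc \<theta>' = ?A' *v w'"
    using U by (simp_all add: w_def w'_def scat_whiten)
  have hA: "scat h *v z = ?A' *v z - ?A *v z" for z by (simp add: h_def matrix_vector_mult_diff_rdistrib)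
  have hl: "loc h = ?A *v w - ?A' *v w'" using u u' by (simp add: h_def algebra_simps)
  have s: "a \<bullet> (?A *v b) = (?A *v a) \<bullet> b" "a \<bullet> (?A' *v b) = (?A' *v a) \<bullet> b" for a b
    using symmetric_inner[OF spd_symmetric[OF U_spd]] U by blast+
  have q: "quad \<theta> x = (?A *v w) \<bullet> w" "quad \<theta>' x = (?A' *v w') \<bullet> w'"
    unfolding quad_def u u' by (simp_all only: w_def w'_def)
  have "w \<bullet> (scat h *v w') = (?A' *v w') \<bullet> w - (?A *v w) \<bullet> w'"
    unfolding hA inner_diff_right s(1)[of w w'] inner_commute[of w "?A' *v w'"] ..
  then show "quad \<theta>' x - quad \<theta> x = - (loc h \<bullet> w') - loc h \<bullet> w - w \<bullet> (scat h *v w')"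
    unfolding q hl inner_diff_left by simp
  have "?A' *v (w' - w) = - loc h - scat h *v w"
    by (simp add: hA hl matrix_vector_mult_diff_distrib)
  then have "norm (?A' *v (w' - w)) \<le> norm (loc h) + norm (scat h *v w)"
    using norm_triangle_ineq4[of "- loc h" "scat h *v w"] by simp
  also have "\<dots> \<le> norm h + norm h * norm w"
    using norm_loc_le[of h] norm_matrix_vector_le[of "scat h" w] mult_right_mono[OF norm_scat_le[of h], of "norm w"] by simp
  finally have *: "norm (?A' *v (w' - w)) \<le> norm h * (1 + norm w)" by (simp add: distrib_left)
  show "norm (w' - w) \<le> 2 / c * (norm h * (1 + norm w))"
    by (rule order_trans[OF norm_inv_le[OF U(2)] mult_left_mono[OF *]]) (use c_pos in simp)
qed

lemma linear_dquad: "linear (dquad \<theta> x)"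
  by (rule linearI) (simp_all add: dquad_def inner_add_left inner_add_right matrix_vector_mult_add_rdistrib
    scaleR_matrix_vector_assoc[symmetric] algebra_simps)

text \<open>\<open>quad\<close>, its derivative and its remainder are at most quadratic in the
  residual and the whitened vector, hence bounded after division by \<open>sq1\<close>.\<close>

lemma c11_quad: "c11 U (\<lambda>\<theta> x. quad \<theta> x / sq1 x) (\<lambda>\<theta> x h. dquad \<theta> x h / sq1 x)"
proof -
  obtain K where K: "K \<ge> 1" "\<And>\<theta> x. \<theta> \<in> U \<Longrightarrow> (norm (whiten \<theta> x))\<^sup>2 \<le> K * sq1 x" using norm_whiten_sq by metis
  obtain K' where K': "K' \<ge> 1" "\<And>\<theta> x. \<theta> \<in> U \<Longrightarrow> (norm (x - loc \<theta>))\<^sup>2 \<le> K' * sq1 x" using norm_resid_sq by metis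
  have N: "sq1 x > 0" for x :: "'k rvec" using sq1_ge[of x] by linarith
  have sq: "(1 + a)\<^sup>2 \<le> 2 + 2 * a\<^sup>2" "2 * a \<le> 1 + a\<^sup>2" for a :: real
    using zero_le_power2[of "a - 1"] by (simp_all add: power2_eq_square algebra_simps)
  have wbd: "(1 + norm (whiten \<theta> x))\<^sup>2 \<le> (2 + 2 * K) * sq1 x" if "\<theta> \<in> U" for \<theta> x
    using sq(1)[of "norm (whiten \<theta> x)"] K(2)[OF that, of x] sq1_ge[of x] by (simp add: distrib_right)
  show ?thesis
  proof (rule c11I[OF U_diam])
    show "linear (\<lambda>h. dquad \<theta> x h / sq1 x)" for \<theta> x
    proof -
      interpret linear "dquad \<theta> x" by (rule linear_dquad)
      show ?thesis by (rule linearI) (simp_all add: add scale add_divide_distrib)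
    qed
    show "\<bar>quad \<theta> x / sq1 x\<bar> \<le> K' + K" if U: "\<theta> \<in> U" for \<theta> x
    proof -
      have "\<bar>quad \<theta> x\<bar> \<le> norm (x - loc \<theta>) * norm (whiten \<theta> x)" unfolding quad_def by (rule Cauchy_Schwarz_ineq2)
      also have "\<dots> \<le> (norm (x - loc \<theta>))\<^sup>2 + (norm (whiten \<theta> x))\<^sup>2"
        using sum_squares_bound[of "norm (x - loc \<theta>)" "norm (whiten \<theta> x)"]
          mult_nonneg_nonneg[OF norm_ge_zero[of "x - loc \<theta>"] norm_ge_zero[of "whiten \<theta> x"]] by linarith
      also have "\<dots> \<le> (K' + K) * sq1 x" using K(2)[OF U, of x] K'(2)[OF U, of x] by (simp add: distrib_right)
      finally show ?thesis using N[of x] by (simp add: abs_divide divide_le_eq)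
    qed
    show "\<bar>dquad \<theta> x h / sq1 x\<bar> \<le> (2 + 2 * K) * norm h" if U: "\<theta> \<in> U" for \<theta> x h
    proof -
      let ?w = "norm (whiten \<theta> x)"
      have "\<bar>loc h \<bullet> whiten \<theta> x\<bar> \<le> norm h * ?w"
        by (rule order_trans[OF Cauchy_Schwarz_ineq2 mult_right_mono[OF norm_loc_le]]) simp
      moreover have "norm (scat h *v whiten \<theta> x) \<le> norm h * ?w"
        by (rule order_trans[OF norm_matrix_vector_le mult_right_mono[OF norm_scat_le]]) simp
      then have "\<bar>whiten \<theta> x \<bullet> (scat h *v whiten \<theta> x)\<bar> \<le> ?w * (norm h * ?w)"
        by (rule order_trans[OF Cauchy_Schwarz_ineq2 mult_left_mono]) simp
      ultimately have "\<bar>dquad \<theta> x h\<bar> \<le> 2 * (norm h * ?w) + ?w * (norm h * ?w)" unfolding dquad_def by linarith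
      also have "\<dots> \<le> norm h * (1 + ?w)\<^sup>2" by (simp add: power2_eq_square algebra_simps)
      also have "\<dots> \<le> norm h * ((2 + 2 * K) * sq1 x)" by (intro mult_left_mono wbd U) simp
      finally have "\<bar>dquad \<theta> x h\<bar> \<le> (2 + 2 * K) * norm h * sq1 x" by (simp only: mult_ac)
      then show ?thesis using N[of x] by (simp add: abs_divide divide_le_eq)
    qed
    show "\<bar>quad \<theta>' x / sq1 x - quad \<theta> x / sq1 x - dquad \<theta> x (\<theta>' - \<theta>) / sq1 x\<bar> \<le> (2 / c * (2 + 2 * K)) * (norm (\<theta>' - \<theta>))\<^sup>2"
      if U: "\<theta> \<in> U" "\<theta>' \<in> U" for \<theta> \<theta>' x
    proof -
      define w w' h where "w = whiten \<theta> x" and "w' = whiten \<theta>' x" and "h = \<theta>' - \<theta>"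
      note qd = quad_diff[OF U, of x, folded w_def w'_def h_def]
      \<comment> \<open>After the linear part is subtracted, what is left is linear in
        \<open>w' - w\<close>, itself of order |h|; together with the explicit factor
        \<open>h\<close> this is quadratic.\<close>
      have "quad \<theta>' x - quad \<theta> x - dquad \<theta> x h = - (loc h \<bullet> (w' - w)) - w \<bullet> (scat h *v (w' - w))"
        unfolding qd(1) dquad_def w_def[symmetric]
        by (simp add: inner_diff_right matrix_vector_mult_diff_distrib)
      moreover have "\<bar>loc h \<bullet> (w' - w)\<bar> \<le> norm h * norm (w' - w)"
        by (rule order_trans[OF Cauchy_Schwarz_ineq2 mult_right_mono[OF norm_loc_le]]) simp
      moreover have "norm (scat h *v (w' - w)) \<le> norm h * norm (w' - w)"
        by (rule order_trans[OF norm_matrix_vector_le mult_right_mono[OF norm_scat_le]]) simp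
      then have "\<bar>w \<bullet> (scat h *v (w' - w))\<bar> \<le> norm w * (norm h * norm (w' - w))"
        by (rule order_trans[OF Cauchy_Schwarz_ineq2 mult_left_mono]) simp
      ultimately have "\<bar>quad \<theta>' x - quad \<theta> x - dquad \<theta> x h\<bar> \<le> (norm h * (1 + norm w)) * norm (w' - w)"
        by (simp add: algebra_simps)
      also have "\<dots> \<le> (norm h * (1 + norm w)) * (2 / c * (norm h * (1 + norm w)))"
        by (intro mult_left_mono qd(2)) simp
      also have "\<dots> = 2 / c * (norm h)\<^sup>2 * (1 + norm w)\<^sup>2" by (simp add: power2_eq_square)
      also have "\<dots> \<le> 2 / c * (norm h)\<^sup>2 * ((2 + 2 * K) * sq1 x)"
        using wbd[OF U(1), of x] c_pos by (intro mult_left_mono) (auto simp: w_def)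
      finally have "\<bar>quad \<theta>' x - quad \<theta> x - dquad \<theta> x h\<bar> \<le> (2 / c * (2 + 2 * K)) * (norm h)\<^sup>2 * sq1 x"
        by (simp only: mult_ac)
      moreover have "quad \<theta>' x / sq1 x - quad \<theta> x / sq1 x - dquad \<theta> x h / sq1 x = (quad \<theta>' x - quad \<theta> x - dquad \<theta> x h) / sq1 x"
        by (simp add: diff_divide_distrib)
      ultimately show ?thesis using N[of x] unfolding h_def by (simp only: abs_divide) (simp add: divide_le_eq)
    qed
  qed
qed

lemma c11_dof: "c11 U (\<lambda>\<theta> x. dof \<theta>) (\<lambda>\<theta> x h. dof h)"
  by (rule c11_linear[OF U_diam])
    (auto intro: bounded_linear_compose[of snd snd, unfolded o_def] bounded_linear_snd)

text \<open>The logarithm of this ratio is to be differentiated, so it has to stay away from zero.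
  The degrees of freedom dominate the summand 1 of \<open>sq1\<close>, and \<open>quad\<close>
  dominates the squared residual because the scatter matrices are bounded.\<close>

lemma ratio_bound:
  obtains k where "k > 0" "\<And>\<theta> x. \<theta> \<in> U \<Longrightarrow> k \<le> (dof \<theta> + quad \<theta> x) / sq1 x"
proof -
  obtain K where K: "K \<ge> 1" "\<And>\<theta> x. \<theta> \<in> U \<Longrightarrow> sq1 x \<le> K * (1 + (norm (x - loc \<theta>))\<^sup>2)"
    using norm_resid_sq by metis
  define S where "S = norm (scat V) + 1"
  \<comment> \<open>\<open>2 / dof V\<close> bounds the reciprocal of \<open>dof \<theta>\<close>,
    and \<open>2 * S\<^sup>2 / c\<close> bounds the squared residual divided by
    \<open>quad\<close>.\<close>
  define m where "m = K * (2 / dof V + 2 * S\<^sup>2 / c)"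
  have "m > 0" unfolding m_def using K(1) dofV c_pos by (intro mult_pos_pos add_pos_nonneg) auto
  show ?thesis
  proof (rule that[of "1 / m"])
    fix \<theta> and x :: "'k rvec" assume U: "\<theta> \<in> U"
    let ?w = "whiten \<theta> x"
    have Q: "quad \<theta> x \<ge> 0" by (rule quad_nonneg[OF U_param[OF U]])
    have u: "x - loc \<theta> = scat \<theta> *v ?w" by (simp add: scat_whiten[OF U])
    have "c / 2 * (norm ?w)\<^sup>2 \<le> quad \<theta> x"
      using U_coercive[OF U, of ?w] by (simp add: quad_def u[symmetric] inner_commute[of ?w])
    then have w: "(norm ?w)\<^sup>2 \<le> 2 / c * quad \<theta> x" using c_pos by (simp add: field_simps)
    have "norm (x - loc \<theta>) \<le> S * norm ?w"
      unfolding u using norm_matrix_vector_le[of "scat \<theta>" ?w] mult_right_mono[OF U_scat[OF U], of "norm ?w"]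
      by (simp add: S_def)
    then have "(norm (x - loc \<theta>))\<^sup>2 \<le> (S * norm ?w)\<^sup>2" by (intro power_mono) auto
    also have "\<dots> \<le> S\<^sup>2 * (2 / c * quad \<theta> x)" unfolding power_mult_distrib by (intro mult_left_mono w) simp
    finally have 1: "(norm (x - loc \<theta>))\<^sup>2 \<le> 2 * S\<^sup>2 / c * quad \<theta> x" by (simp add: mult.left_commute)
    have 2: "1 \<le> 2 / dof V * dof \<theta>" using U_dof(1)[OF U] dofV by (simp add: field_simps)
    have n: "0 \<le> 2 / dof V * quad \<theta> x" "0 \<le> 2 * S\<^sup>2 / c * dof \<theta>"
      using dofV c_pos Q param_space_dof[OF U_param[OF U]] by auto
    have "1 + (norm (x - loc \<theta>))\<^sup>2 \<le> (2 / dof V + 2 * S\<^sup>2 / c) * (dof \<theta> + quad \<theta> x)"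
      unfolding distrib_left distrib_right using 1 2 n by linarith
    then have "K * (1 + (norm (x - loc \<theta>))\<^sup>2) \<le> m * (dof \<theta> + quad \<theta> x)"
      unfolding m_def mult.assoc using K(1) by (intro mult_left_mono) auto
    with K(2)[OF U, of x] have "sq1 x \<le> m * (dof \<theta> + quad \<theta> x)" by linarith
    then show "1 / m \<le> (dof \<theta> + quad \<theta> x) / sq1 x"
      using \<open>m > 0\<close> sq1_ge[of x] by (simp add: field_simps)
  qed (use \<open>m > 0\<close> in simp)
qed

lemma c11_ratio: "c11 U (\<lambda>\<theta> x. (dof \<theta> + quad \<theta> x) / sq1 x) (\<lambda>\<theta> x h. (dof h + dquad \<theta> x h) / sq1 x)"
proof -
  have "\<bar>1 / sq1 x\<bar> \<le> 1" for x :: "'k rvec" using sq1_ge[of x] by simp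
  from c11_add[OF c11_weight[OF c11_dof this] c11_quad]
  show ?thesis by (rule c11_cong) (auto simp: add_divide_distrib)
qed

text \<open>Division by \<open>sq1\<close> brings the argument into a compact interval of positive
  numbers, as the chain rule requires; in the logarithmic derivative the factor \<open>sq1\<close>
  cancels.\<close>

lemma c11_ln_ratio: "c11 U (\<lambda>\<theta> x. ln ((dof \<theta> + quad \<theta> x) / sq1 x)) (\<lambda>\<theta> x h. (dof h + dquad \<theta> x h) / (dof \<theta> + quad \<theta> x))"
proof -
  obtain k where k: "k > 0" "\<And>\<theta> x. \<theta> \<in> U \<Longrightarrow> k \<le> (dof \<theta> + quad \<theta> x) / sq1 x" using ratio_bound by metis
  obtain C where C: "\<And>\<theta> x. \<theta> \<in> U \<Longrightarrow> \<bar>(dof \<theta> + quad \<theta> x) / sq1 x\<bar> \<le> C" using c11E[OF c11_ratio] by metis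
  have "c11 U (\<lambda>\<theta> x. ln ((dof \<theta> + quad \<theta> x) / sq1 x))
    (\<lambda>\<theta> x h. inverse ((dof \<theta> + quad \<theta> x) / sq1 x) * ((dof h + dquad \<theta> x h) / sq1 x))"
  proof (rule c11_compose[OF c11_ratio, of k C])
    show "(dof \<theta> + quad \<theta> x) / sq1 x \<in> {k..C}" if "\<theta> \<in> U" for \<theta> x
      using k(2)[OF that, of x] abs_le_D1[OF C[OF that, of x]] by simp
    show "(ln has_real_derivative inverse u) (at u)" if "u \<in> {k..C}" for u :: real
      using that k(1) by (auto intro: DERIV_ln)
    show "(inverse has_real_derivative - (inverse u * inverse u)) (at u)" if "u \<in> {k..C}" for u :: real
      using that k(1) by (auto intro!: derivative_eq_intros)
    show "continuous_on {k..C} (\<lambda>u::real. - (inverse u * inverse u))"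
      using k(1) by (intro continuous_intros) auto
  qed
  then show ?thesis
  proof (rule c11_cong)
    fix \<theta> h and x :: "'k rvec"
    show "inverse ((dof \<theta> + quad \<theta> x) / sq1 x) * ((dof h + dquad \<theta> x h) / sq1 x) = (dof h + dquad \<theta> x h) / (dof \<theta> + quad \<theta> x)"
      using sq1_ge[of x] by (simp add: divide_simps)
  qed auto
qed

section \<open>The normalizing constant as a function of the parameter\<close>

lemma c11_dof_compose:
  assumes "\<And>u. u > 0 \<Longrightarrow> (\<phi> has_real_derivative \<phi>' u) (at u)"
    and "\<And>u. u > 0 \<Longrightarrow> (\<phi>' has_real_derivative \<phi>'' u) (at u)"
    and "continuous_on {0<..} \<phi>''" and "a > 0" "b \<ge> 0"
  shows "\<exists>D. c11 U (\<lambda>\<theta> x. \<phi> (dof \<theta> * a + b)) D"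
proof -
  have 1: "c11 U (\<lambda>\<theta> x. dof \<theta> * a + b) (\<lambda>\<theta> x h. dof h * a + 0)"
    by (rule c11_add[OF c11_weight[OF c11_dof, of "\<lambda>_. a" "\<bar>a\<bar>"] c11_const[OF U_diam, where C="\<bar>b\<bar>"]]) auto
  have pos: "0 < dof V / 2 * a + b" using dofV assms by (simp add: add_pos_nonneg)
  show ?thesis
  proof (rule exI, rule c11_compose[OF 1])
    show "dof \<theta> * a + b \<in> {dof V / 2 * a + b .. 3 / 2 * dof V * a + b}" if "\<theta> \<in> U" for \<theta>
      using mult_right_mono[OF U_dof(1)[OF that], of a] mult_right_mono[OF U_dof(2)[OF that], of a] assms(4) by simp
    fix u assume "u \<in> {dof V / 2 * a + b .. 3 / 2 * dof V * a + b}"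
    then have "u > 0" using pos by simp
    then show "(\<phi> has_real_derivative \<phi>' u) (at u)" "(\<phi>' has_real_derivative \<phi>'' u) (at u)" using assms by auto
  next
    show "continuous_on {dof V / 2 * a + b .. 3 / 2 * dof V * a + b} \<phi>''"
      by (rule continuous_on_subset[OF assms(3)]) (use pos in auto)
  qed
qed

lemma c11_ln_Gamma_dof: "a > 0 \<Longrightarrow> b \<ge> 0 \<Longrightarrow> \<exists>D. c11 U (\<lambda>\<theta> x. ln_Gamma (dof \<theta> * a + b)) D"
proof (rule c11_dof_compose)
  have pos: "u \<notin> \<int>\<^sub>\<le>\<^sub>0" if "u > 0" for u :: real
    using that nonpos_Ints_nonpos[of u] by auto
  show "(ln_Gamma has_real_derivative Digamma u) (at u)" if "u > 0" for u :: real
    using that by (rule has_field_derivative_ln_Gamma_real)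
  show "(Digamma has_real_derivative Polygamma (Suc 0) u) (at u)" if "u > 0" for u :: real
    by (rule has_field_derivative_Polygamma[OF pos[OF that]])
  show "continuous_on {0<..} (Polygamma (Suc 0) :: real \<Rightarrow> real)"
    using pos by (intro continuous_on_Polygamma) auto
qed

lemma c11_ln_dof: "\<exists>D. c11 U (\<lambda>\<theta> x. ln (dof \<theta>)) D"
proof -
  have "\<exists>D. c11 U (\<lambda>\<theta> x. ln (dof \<theta> * 1 + 0)) D"
  proof (rule c11_dof_compose)
    show "(ln has_real_derivative inverse u) (at u)" if "u > 0" for u :: real
      using that by (rule DERIV_ln)
    show "(inverse has_real_derivative - (inverse u * inverse u)) (at u)" if "u > 0" for u :: real
      using that by (auto intro!: derivative_eq_intros)
    show "continuous_on {0<..} (\<lambda>u::real. - (inverse u * inverse u))"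
      by (intro continuous_intros) auto
  qed auto
  then show ?thesis by simp
qed

text \<open>Symmetry, the norm bound and the non-strict coercivity inequalities cut out a compact
  set \<open>T\<close> that contains every scatter matrix of \<open>U\<close> and consists of
  positive definite matrices; the determinant attains a positive minimum on it.\<close>

lemma det_bound:
  obtains k where "k > 0" "\<And>\<theta>. \<theta> \<in> U \<Longrightarrow> k \<le> det (scat \<theta>)"
proof (cases "U = {}")
  case False
  define T where "T = cball 0 (norm (scat V) + 1) \<inter> {A :: 'k rmat. transpose A = A} \<inter> (\<Inter>x. {A. c / 2 * (norm x)\<^sup>2 \<le> x \<bullet> (A *v x)})"
  have lin: "continuous_on UNIV (\<lambda>A :: 'k rmat. A *v x)" for x
    by (rule linear_continuous_on, subst linear_conv_bounded_linear[symmetric])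
      (rule linearI; simp add: matrix_vector_mult_add_rdistrib scaleR_matrix_vector_assoc)
  have tr: "continuous_on UNIV (\<lambda>A :: 'k rmat. transpose A)"
    unfolding transpose_def by (intro continuous_intros)
  have "closed {A :: 'k rmat. transpose A = A}"
    by (intro closed_Collect_eq continuous_intros tr)
  moreover have "closed (\<Inter>x. {A :: 'k rmat. c / 2 * (norm x)\<^sup>2 \<le> x \<bullet> (A *v x)})"
    by (intro closed_INT ballI closed_Collect_le continuous_intros lin)
  ultimately have "compact T"
    unfolding T_def by (intro compact_Int_closed compact_cball)
  have sub: "scat \<theta> \<in> T" if "\<theta> \<in> U" for \<theta>
    unfolding T_def using U_scat[OF that] U_coercive[OF that] spd_symmetric[OF U_spd[OF that]] by simp
  then have "T \<noteq> {}" using False by blast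
  have "continuous_on T det"
    unfolding det_def by (intro continuous_intros)
  from continuous_attains_inf[OF \<open>compact T\<close> \<open>T \<noteq> {}\<close> this]
  obtain A where A: "A \<in> T" "\<And>B. B \<in> T \<Longrightarrow> det A \<le> det B" by blast
  have "A \<in> spd"
  proof -
    have "0 < x \<bullet> (A *v x)" if "x \<noteq> 0" for x
    proof -
      have "0 < c / 2 * (norm x)\<^sup>2" using c_pos that by simp
      also have "\<dots> \<le> x \<bullet> (A *v x)" using A(1) unfolding T_def by blast
      finally show ?thesis .
    qed
    then show ?thesis using A(1) by (simp add: spd_def T_def)
  qed
  then show ?thesis using that[of "det A", OF det_spd_pos A(2)[OF sub]] by blast
qed (use that[of 1] in auto)

text \<open>By the Leibniz formula the determinant is a polynomial in the entries, which are linear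
  in the parameter. Its values lie in a compact interval of positive numbers, so the logarithm may
  be applied.\<close>

lemma c11_ln_det: "\<exists>D. c11 U (\<lambda>\<theta> (x::'x). ln (det (scat \<theta>))) D"
proof -
  have entry: "\<exists>D. c11 U (\<lambda>\<theta> (x::'x). scat \<theta> $ i $ j) D" for i j
    by (rule exI, rule c11_linear[OF U_diam]; assumption?)
      (rule bounded_linear_compose[OF bounded_linear_vec_nth bounded_linear_compose[OF bounded_linear_vec_nth
        bounded_linear_compose[OF bounded_linear_fst bounded_linear_snd]]])
  have "\<exists>D. c11 U (\<lambda>\<theta> (x::'x). (\<Prod>i\<in>UNIV. scat \<theta> $ i $ p i) * of_int (sign p)) D" for p
  proof -
    obtain D where "c11 U (\<lambda>\<theta> (x::'x). \<Prod>i\<in>UNIV. scat \<theta> $ i $ p i) D"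
      using c11_prod_ex[OF U_diam finite_class.finite_UNIV entry, of "\<lambda>i. i" p] by blast
    from c11_weight[OF this, of "\<lambda>_. of_int (sign p)" "\<bar>of_int (sign p)\<bar>"] show ?thesis by blast
  qed
  then have "\<exists>D. c11 U (\<lambda>\<theta> (x::'x). \<Sum>p | p permutes UNIV. (\<Prod>i\<in>UNIV. scat \<theta> $ i $ p i) * of_int (sign p)) D"
    by (intro c11_sum_ex[OF U_diam] finite_permutations) simp_all
  moreover have "det A = (\<Sum>p | p permutes UNIV. (\<Prod>i\<in>UNIV. A $ i $ p i) * of_int (sign p))" for A :: "'k rmat"
    unfolding det_def by (intro sum.cong refl mult.commute)
  ultimately obtain D where D: "c11 U (\<lambda>\<theta> (x::'x). det (scat \<theta>)) D"
    by auto
  obtain k where k: "k > 0" "\<And>\<theta>. \<theta> \<in> U \<Longrightarrow> k \<le> det (scat \<theta>)" using det_bound by metis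
  obtain C where C: "\<And>\<theta>. \<theta> \<in> U \<Longrightarrow> \<bar>det (scat \<theta>)\<bar> \<le> C" using c11E[OF D] by metis
  have "c11 U (\<lambda>\<theta> (x::'x). ln (det (scat \<theta>))) (\<lambda>\<theta> x h. inverse (det (scat \<theta>)) * D \<theta> x h)"
  proof (rule c11_compose[OF D, of k C])
    show "det (scat \<theta>) \<in> {k..C}" if "\<theta> \<in> U" for \<theta>
      using k(2)[OF that] C[OF that] by auto
    show "(ln has_real_derivative inverse u) (at u)" if "u \<in> {k..C}" for u :: real
      using that k(1) by (auto intro: DERIV_ln)
    show "(inverse has_real_derivative - (inverse u * inverse u)) (at u)" if "u \<in> {k..C}" for u :: real
      using that k(1) by (auto intro!: derivative_eq_intros)
    show "continuous_on {k..C} (\<lambda>u::real. - (inverse u * inverse u))"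
      using k(1) by (intro continuous_intros) auto
  qed
  then show ?thesis by blast
qed

text \<open>Built over the one-point observation type \<open>unit\<close>, where a derivative cannot
  depend on the observation, and then carried over to any observation type. This is why
  \<open>\<kappa>\<close> takes the parameter only.\<close>

lemma c11_log_const: "\<exists>\<kappa>. c11 U (\<lambda>\<theta> (x::'x). log_const \<theta>) (\<lambda>\<theta> x. \<kappa> \<theta>)"
proof -
  let ?k = "real CARD('k)"
  obtain D1 where D1: "c11 U (\<lambda>\<theta> (x::unit). ln_Gamma (dof \<theta> * (1/2) + ?k / 2)) D1" using c11_ln_Gamma_dof[of "1/2" "?k / 2"] by auto
  obtain D2 where D2: "c11 U (\<lambda>\<theta> (x::unit). ln_Gamma (dof \<theta> * (1/2) + 0)) D2" using c11_ln_Gamma_dof[of "1/2" "0"] by auto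
  obtain D3 where D3: "c11 U (\<lambda>\<theta> (x::unit). ln (dof \<theta>)) D3" using c11_ln_dof by auto
  obtain D4 where D4: "c11 U (\<lambda>\<theta> (x::unit). ln (det (scat \<theta>))) D4" using c11_ln_det by auto
  have const: "c11 U (\<lambda>\<theta> (x::unit). r) (\<lambda>\<theta> x h. 0)" for r
    by (rule c11_const[OF U_diam, where C="\<bar>r\<bar>"]) auto
  have weight: "c11 U F D \<Longrightarrow> c11 U (\<lambda>\<theta> (x::unit). F \<theta> x * r) (\<lambda>\<theta> x h. D \<theta> x h * r)" for F D r
    by (rule c11_weight[where C="\<bar>r\<bar>"]) auto
  obtain D where D: "c11 U (\<lambda>\<theta> (x::unit). log_const \<theta>) D"
  proof (rule that, rule c11_cong[OF c11_add[OF c11_add[OF c11_add[OF c11_add[OF D1 const[of "- ?k / 2 * ln pi"]] weight[OF D2, of "-1"]]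
        weight[OF D4, of "- 1 / 2"]] c11_mult[OF weight[OF c11_dof, of "1/2"] D3]]])
    fix \<theta> :: "'k param" and x :: unit
    show "ln_Gamma (dof \<theta> * (1 / 2) + ?k / 2) + - ?k / 2 * ln pi + ln_Gamma (dof \<theta> * (1 / 2) + 0) * - 1 +
         ln (det (scat \<theta>)) * (- 1 / 2) + dof \<theta> * (1 / 2) * ln (dof \<theta>) = log_const \<theta>"
      by (simp add: log_const_def add_divide_distrib algebra_simps)
  qed auto
  have "c11 U (\<lambda>\<theta> (x::'x). log_const \<theta>) (\<lambda>\<theta> x. D \<theta> ())"
    using D unfolding c11_def by auto
  then show ?thesis by (intro exI[of _ "\<lambda>\<theta>. D \<theta> ()"])
qed

end

section \<open>The weighted log density and an envelope\<close>

text \<open>\<open>\<kappa>\<close> stands for the differential of \<open>log_const\<close> and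
  stays abstract; the dependence on \<open>x\<close>, which decides the linear independence of the
  score components, is explicit. The other terms are the product rule for the degrees-of-freedom
  factor times the logarithm.\<close>

definition dlog :: "('k::finite param \<Rightarrow> 'k param \<Rightarrow> real) \<Rightarrow> 'k param \<Rightarrow> 'k rvec \<Rightarrow> 'k param \<Rightarrow> real" where
  "dlog \<kappa> \<theta> x h = \<kappa> \<theta> h - dof h / 2 * ln (dof \<theta> + quad \<theta> x)
     - (dof \<theta> + real CARD('k)) / 2 * ((dof h + dquad \<theta> x h) / (dof \<theta> + quad \<theta> x))"

context student_nbhd
begin

lemma dof_quad_pos: "\<theta> \<in> U \<Longrightarrow> dof \<theta> + quad \<theta> x > 0"
  using quad_nonneg[OF U_param, of \<theta> x] param_space_dof[OF U_param, of \<theta>] by linarith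

lemma ln_dof_quad: "\<theta> \<in> U \<Longrightarrow> ln (dof \<theta> + quad \<theta> x) = ln ((dof \<theta> + quad \<theta> x) / sq1 x) + ln (sq1 x)"
  using dof_quad_pos[of \<theta> x] sq1_ge[of x] by (simp add: ln_div)

lemma c11_dof_card: "c11 U (\<lambda>\<theta> x. - (dof \<theta> + real CARD('k)) / 2) (\<lambda>\<theta> x h. - dof h / 2)"
proof -
  have "c11 U (\<lambda>\<theta> x. dof \<theta> * (- 1 / 2) + - real CARD('k) / 2) (\<lambda>\<theta> x h. dof h * (- 1 / 2) + 0)"
    by (rule c11_add[OF c11_weight[OF c11_dof, of "\<lambda>_. - 1 / 2" 1] c11_const[OF U_diam, where C="real CARD('k)"]]) auto
  then show ?thesis by (rule c11_cong) (auto simp: field_simps)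
qed

text \<open>Splitting off ln (\<open>sq1 x\<close>) leaves functions already treated. The split part
  is unbounded, but it is a function of \<open>x\<close> alone and becomes bounded on division by
  \<open>logw x\<close>.\<close>

lemma c11_log_density:
  "\<exists>\<kappa>. c11 U (\<lambda>\<theta> x. ln (student_density \<theta> x) / logw x) (\<lambda>\<theta> x h. dlog \<kappa> \<theta> x h / logw x)"
proof -
  obtain \<kappa> where \<kappa>: "c11 U (\<lambda>\<theta> (x::'k rvec). log_const \<theta>) (\<lambda>\<theta> x. \<kappa> \<theta>)" using c11_log_const by blast
  have w1: "\<bar>1 / logw x\<bar> \<le> 1" and w2: "\<bar>ln (sq1 x) / logw x\<bar> \<le> 1" for x :: "'k rvec"
    using ln_ge_zero[OF sq1_ge[of x]] by (simp_all add: logw_def divide_le_eq)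
  have lw: "logw x > 0" for x :: "'k rvec" using logw_ge[of x] by linarith
  note P = c11_add[OF c11_weight[OF \<kappa> w1] c11_mult[OF c11_dof_card
    c11_add[OF c11_weight[OF c11_ln_ratio w1] c11_const[OF U_diam w2]]]]
  show ?thesis
  proof (rule exI, rule c11_cong[OF P])
    fix \<theta> and x :: "'k rvec" assume U: "\<theta> \<in> U"
    show "log_const \<theta> * (1 / logw x) + - (dof \<theta> + real CARD('k)) / 2 *
        (ln ((dof \<theta> + quad \<theta> x) / sq1 x) * (1 / logw x) + ln (sq1 x) / logw x) = ln (student_density \<theta> x) / logw x"
      unfolding ln_student_density[OF U_param[OF U]] ln_dof_quad[OF U] using lw[of x] by (simp add: field_simps)
    show "\<kappa> \<theta> h * (1 / logw x) + (- dof h / 2 * (ln ((dof \<theta> + quad \<theta> x) / sq1 x) * (1 / logw x) + ln (sq1 x) / logw x)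
       + - (dof \<theta> + real CARD('k)) / 2 * ((dof h + dquad \<theta> x h) / (dof \<theta> + quad \<theta> x) * (1 / logw x) + 0)) = dlog \<kappa> \<theta> x h / logw x" for h
      unfolding dlog_def ln_dof_quad[OF U] using lw[of x]
      by (simp add: diff_divide_distrib add_divide_distrib algebra_simps)
  qed
qed

text \<open>Without its multiple of ln (\<open>sq1 x\<close>) the log density is bounded on
  \<open>U\<close>. That multiple is most harmful at the fewest degrees of freedom in
  \<open>U\<close>, which are at least half of those of \<open>V\<close>.\<close>

lemma density_bound:
  "\<exists>C>0. \<forall>\<theta>\<in>U. \<forall>x. student_density \<theta> x \<le> C * sq1 x powr (- (dof V / 2 + real CARD('k)) / 2)"
proof -
  obtain \<kappa> where \<kappa>: "c11 U (\<lambda>\<theta> (x::'k rvec). log_const \<theta>) (\<lambda>\<theta> x. \<kappa> \<theta>)" using c11_log_const by blast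
  obtain C where C: "\<And>\<theta> x. \<theta> \<in> U \<Longrightarrow> \<bar>log_const \<theta> + - (dof \<theta> + real CARD('k)) / 2 * ln ((dof \<theta> + quad \<theta> x) / sq1 x)\<bar> \<le> C"
    using c11E[OF c11_add[OF \<kappa> c11_mult[OF c11_dof_card c11_ln_ratio]]] by metis
  show ?thesis
  proof (intro exI[of _ "exp C"] conjI ballI allI)
    fix \<theta> and x :: "'k rvec" assume U: "\<theta> \<in> U"
    have s: "sq1 x > 0" "ln (sq1 x) \<ge> 0" using sq1_ge[of x] by auto
    have "ln (student_density \<theta> x) \<le> C - (dof \<theta> + real CARD('k)) / 2 * ln (sq1 x)"
    proof -
      have e: "- a / 2 * r = - (a / 2 * r)" for a r :: real by simp
      show ?thesis
        using abs_le_D1[OF C[OF U, of x]]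
        unfolding ln_student_density[OF U_param[OF U]] ln_dof_quad[OF U] e distrib_left by linarith
    qed
    also have "\<dots> \<le> C - (dof V / 2 + real CARD('k)) / 2 * ln (sq1 x)"
      using mult_right_mono[of "(dof V / 2 + real CARD('k)) / 2" "(dof \<theta> + real CARD('k)) / 2" "ln (sq1 x)"] U_dof(1)[OF U] s(2) by simp
    finally have "student_density \<theta> x \<le> exp (C - (dof V / 2 + real CARD('k)) / 2 * ln (sq1 x))"
      using student_density_pos[OF U_param[OF U], of x] by (metis exp_le_cancel_iff exp_ln)
    also have "\<dots> = exp C * sq1 x powr (- (dof V / 2 + real CARD('k)) / 2)"
    proof -
      have e: "- a / 2 * r = - (a / 2 * r)" for a r :: real by simp
      have "sq1 x powr y = exp (y * ln (sq1 x))" for y using s(1) by (simp add: powr_def)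
      then show ?thesis by (simp only: e exp_diff exp_minus divide_inverse mult_minus_left)
    qed
    finally show "student_density \<theta> x \<le> exp C * sq1 x powr (- (dof V / 2 + real CARD('k)) / 2)" .
  qed simp
qed

end

section \<open>Independent and identically distributed samples\<close>

text \<open>Product measures are determined on boxes, where density and indicator factorize over the
  coordinates.\<close>

lemma density_PiM_prod:
  assumes M: "prob_space M" and N: "prob_space N" and NM: "N = density M g" and [measurable]: "g \<in> borel_measurable M"
    and I: "finite I"
  shows "(\<Pi>\<^sub>M i\<in>I. N) = density (\<Pi>\<^sub>M i\<in>I. M) (\<lambda>\<omega>. \<Prod>i\<in>I. g (\<omega> i))"
proof (rule sym, rule product_sigma_finite.PiM_eqI)
  interpret M: prob_space M by fact
  interpret N: prob_space N by fact
  interpret PM: product_sigma_finite "\<lambda>_. M" ..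
  show "product_sigma_finite (\<lambda>i. N)" ..
  show "finite I" by fact
  have sets: "sets N = sets M" by (simp add: NM)
  show "sets (density (\<Pi>\<^sub>M i\<in>I. M) (\<lambda>\<omega>. \<Prod>i\<in>I. g (\<omega> i))) = sets (\<Pi>\<^sub>M i\<in>I. N)"
    by (simp add: sets cong: sets_PiM_cong)
  fix A assume "\<And>i. i \<in> I \<Longrightarrow> A i \<in> sets N"
  then have A [measurable]: "\<And>i. i \<in> I \<Longrightarrow> A i \<in> sets M" by (simp add: sets)
  have PA: "Pi\<^sub>E I A \<in> sets (\<Pi>\<^sub>M i\<in>I. M)" using I A by (intro sets_PiM_I_finite) auto
  have "emeasure (density (\<Pi>\<^sub>M i\<in>I. M) (\<lambda>\<omega>. \<Prod>i\<in>I. g (\<omega> i))) (Pi\<^sub>E I A)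
    = (\<integral>\<^sup>+\<omega>. (\<Prod>i\<in>I. g (\<omega> i)) * indicator (Pi\<^sub>E I A) \<omega> \<partial>(\<Pi>\<^sub>M i\<in>I. M))"
    using I PA by (subst emeasure_density) auto
  also have "\<dots> = (\<integral>\<^sup>+\<omega>. (\<Prod>i\<in>I. g (\<omega> i) * indicator (A i) (\<omega> i)) \<partial>(\<Pi>\<^sub>M i\<in>I. M))"
  proof (intro nn_integral_cong)
    fix \<omega> assume "\<omega> \<in> space (\<Pi>\<^sub>M i\<in>I. M)"
    then have "indicator (Pi\<^sub>E I A) \<omega> = (\<Prod>i\<in>I. indicator (A i) (\<omega> i) :: ennreal)"
      using I by (auto simp: space_PiM PiE_iff indicator_def prod_zero)
    then show "(\<Prod>i\<in>I. g (\<omega> i)) * indicator (Pi\<^sub>E I A) \<omega> = (\<Prod>i\<in>I. g (\<omega> i) * indicator (A i) (\<omega> i))"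
      by (simp add: prod.distrib)
  qed
  also have "\<dots> = (\<Prod>i\<in>I. \<integral>\<^sup>+x. g x * indicator (A i) x \<partial>M)"
    using I by (intro PM.product_nn_integral_prod) auto
  also have "\<dots> = (\<Prod>i\<in>I. emeasure N (A i))"
    unfolding NM using A by (intro prod.cong refl) (simp add: emeasure_density)
  finally show "emeasure (density (\<Pi>\<^sub>M i\<in>I. M) (\<lambda>\<omega>. \<Prod>i\<in>I. g (\<omega> i))) (Pi\<^sub>E I A) = (\<Prod>i\<in>I. emeasure N (A i))" .
qed

lemma iid_sum_second_moment:
  fixes q :: "'a \<Rightarrow> real" and I :: "'i set"
  assumes M: "prob_space M" and I: "finite I" and q: "integrable M q" and q2: "integrable M (\<lambda>x. q x * q x)"
    and mean: "(\<integral>x. q x \<partial>M) = 0"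
  shows "integrable (\<Pi>\<^sub>M i\<in>I. M) (\<lambda>\<omega>. (\<Sum>i\<in>I. q (\<omega> i))\<^sup>2)"
    and "(\<integral>\<omega>. (\<Sum>i\<in>I. q (\<omega> i))\<^sup>2 \<partial>(\<Pi>\<^sub>M i\<in>I. M)) = real (card I) * (\<integral>x. q x * q x \<partial>M)"
proof -
  interpret M: prob_space M by fact
  interpret PM: product_sigma_finite "\<lambda>_. M" ..
  \<comment> \<open>The product of \<open>f i j k\<close> over all \<open>k\<close> is
    \<open>q\<close> at coordinate \<open>i\<close> times \<open>q\<close> at coordinate
    \<open>j\<close>, also for \<open>i = j\<close>; a single factorization thus serves squares and
    mixed terms.\<close>
  define f where "f i j k x = (if k = i then q x else 1) * (if k = j then q x else 1)" for i j k :: 'i and x :: 'a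
  have f_int: "integrable M (f i j k)" for i j k
    using q q2 by (cases "k = i"; cases "k = j") (simp_all add: f_def[abs_def])
  have prod_f: "(\<Prod>k\<in>I. f i j k (\<omega> k)) = q (\<omega> i) * q (\<omega> j)" if "i \<in> I" "j \<in> I" for i j \<omega>
    unfolding f_def prod.distrib using that I by (simp add: prod.delta)
  have int: "integrable (\<Pi>\<^sub>M i\<in>I. M) (\<lambda>\<omega>. q (\<omega> i) * q (\<omega> j))" if "i \<in> I" "j \<in> I" for i j
    using PM.product_integrable_prod[of I "f i j", OF I f_int] by (simp add: prod_f that)
  have E: "(\<integral>\<omega>. q (\<omega> i) * q (\<omega> j) \<partial>(\<Pi>\<^sub>M i\<in>I. M)) = (if i = j then (\<integral>x. q x * q x \<partial>M) else 0)" if ij: "i \<in> I" "j \<in> I" for i j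
  proof -
    have "(\<integral>\<omega>. q (\<omega> i) * q (\<omega> j) \<partial>(\<Pi>\<^sub>M i\<in>I. M)) = (\<Prod>k\<in>I. \<integral>x. f i j k x \<partial>M)"
      using PM.product_integral_prod[of I "f i j", OF I f_int] by (simp add: prod_f ij)
    also have "\<dots> = (if i = j then (\<integral>x. q x * q x \<partial>M) else 0)"
    proof (cases "i = j")
      case True
      have "(\<integral>x. f i j k x \<partial>M) = (if k = i then (\<integral>x. q x * q x \<partial>M) else 1)" for k
        using True by (simp add: f_def M.prob_space)
      then show ?thesis using True I ij by (simp add: prod.delta)
    next
      case False
      then have "(\<integral>x. f i j i x \<partial>M) = 0" using mean by (simp add: f_def)
      then show ?thesis using False I ij(1) by (auto intro: prod_zero)
    qed
    finally show ?thesis .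
  qed
  have sq: "(\<Sum>i\<in>I. q (\<omega> i))\<^sup>2 = (\<Sum>i\<in>I. \<Sum>j\<in>I. q (\<omega> i) * q (\<omega> j))" for \<omega> :: "'i \<Rightarrow> 'a"
    by (simp add: power2_eq_square sum_product)
  show "integrable (\<Pi>\<^sub>M i\<in>I. M) (\<lambda>\<omega>. (\<Sum>i\<in>I. q (\<omega> i))\<^sup>2)"
    unfolding sq by (intro Bochner_Integration.integrable_sum int)
  have "(\<integral>\<omega>. (\<Sum>i\<in>I. q (\<omega> i))\<^sup>2 \<partial>(\<Pi>\<^sub>M i\<in>I. M)) = (\<Sum>i\<in>I. \<Sum>j\<in>I. \<integral>\<omega>. q (\<omega> i) * q (\<omega> j) \<partial>(\<Pi>\<^sub>M i\<in>I. M))"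
    unfolding sq by (subst Bochner_Integration.integral_sum; (intro Bochner_Integration.integrable_sum int)?;
        (intro sum.cong refl Bochner_Integration.integral_sum int)?)
  also have "\<dots> = real (card I) * (\<integral>x. q x * q x \<partial>M)"
    using I by (simp add: E sum.delta)
  finally show "(\<integral>\<omega>. (\<Sum>i\<in>I. q (\<omega> i))\<^sup>2 \<partial>(\<Pi>\<^sub>M i\<in>I. M)) = real (card I) * (\<integral>x. q x * q x \<partial>M)" .
qed

text \<open>Centring does not increase the second moment, so the raw moment may stand in the bound
  in place of the variance.\<close>

lemma iid_sum_chebyshev:
  fixes q :: "'a \<Rightarrow> real"
  assumes M: "prob_space M" and I: "finite I" and q: "integrable M q" and q2: "integrable M (\<lambda>x. q x * q x)" and a: "a > 0"
  shows "measure (\<Pi>\<^sub>M i\<in>I. M) {\<omega> \<in> space (\<Pi>\<^sub>M i\<in>I. M). a \<le> \<bar>\<Sum>i\<in>I. q (\<omega> i) - (\<integral>x. q x \<partial>M)\<bar>}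
    \<le> real (card I) * (\<integral>x. q x * q x \<partial>M) / a\<^sup>2"
proof -
  interpret M: prob_space M by fact
  interpret P: prob_space "\<Pi>\<^sub>M i\<in>I. M" by (intro prob_space_PiM M)
  define e where "e = (\<integral>x. q x \<partial>M)"
  let ?p = "\<lambda>x. q x - e"
  have sq: "?p x * ?p x = q x * q x + (- 2 * e * q x + e * e)" for x by (simp add: algebra_simps)
  have p: "integrable M ?p" "integrable M (\<lambda>x. ?p x * ?p x)" "(\<integral>x. ?p x \<partial>M) = 0"
    unfolding sq using q q2 by (simp_all add: e_def M.prob_space)
  have "(\<integral>x. ?p x * ?p x \<partial>M) = (\<integral>x. q x * q x \<partial>M) - e * e"
    unfolding sq using q q2 by (simp add: M.prob_space e_def)
  then have le: "(\<integral>x. ?p x * ?p x \<partial>M) \<le> (\<integral>x. q x * q x \<partial>M)" by simp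
  have [measurable]: "q \<in> borel_measurable M" using q by auto
  have "measure (\<Pi>\<^sub>M i\<in>I. M) {\<omega> \<in> space (\<Pi>\<^sub>M i\<in>I. M). a \<le> \<bar>\<Sum>i\<in>I. ?p (\<omega> i)\<bar>}
    \<le> (\<integral>\<omega>. (\<Sum>i\<in>I. ?p (\<omega> i))\<^sup>2 \<partial>(\<Pi>\<^sub>M i\<in>I. M)) / a\<^sup>2"
    by (rule P.second_moment_method[OF _ iid_sum_second_moment(1)[OF M I p] a]) measurable
  also have "\<dots> \<le> real (card I) * (\<integral>x. q x * q x \<partial>M) / a\<^sup>2"
    unfolding iid_sum_second_moment(2)[OF M I p] by (intro divide_right_mono mult_left_mono le) auto
  finally show ?thesis by (simp add: e_def)
qed

section \<open>Expansion of log likelihood ratios\<close>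

lemma abs_square_le:
  fixes a b l :: real
  assumes "\<bar>a\<bar> \<le> b * l"
  shows "\<bar>a\<^sup>2\<bar> \<le> b\<^sup>2 * l ^ 2"
  using power_mono[OF assms, of 2] by (simp add: power_mult_distrib[symmetric])

lemma power_le_fact_exp:
  fixes y :: real
  assumes "y \<ge> 0"
  shows "y ^ p \<le> fact p * exp y"
proof -
  have "y ^ p / fact p \<le> (\<Sum>n. y ^ n / fact n)"
    using summable_exp_generic[of y] assms
    by (intro sum_le_suminf[of _ "{p}", simplified]) (auto simp: divide_inverse mult.commute)
  also have "\<dots> = exp y" by (simp add: exp_def divide_inverse mult.commute)
  finally show ?thesis by (simp add: field_simps)
qed

lemma exp_taylor2:
  fixes r :: real
  shows "\<bar>exp r - 1 - r - r\<^sup>2 / 2\<bar> \<le> \<bar>r\<bar> ^ 3 * exp \<bar>r\<bar>"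
proof -
  obtain t where t: "\<bar>t\<bar> \<le> \<bar>r\<bar>" "exp r = (\<Sum>m<3. r ^ m / fact m) + exp t / fact 3 * r ^ 3"
    using Maclaurin_exp_le[of r 3] by blast
  then have "exp r - 1 - r - r\<^sup>2 / 2 = exp t / 6 * r ^ 3"
    by (simp add: eval_nat_numeral)
  then have "\<bar>exp r - 1 - r - r\<^sup>2 / 2\<bar> = exp t / 6 * \<bar>r\<bar> ^ 3" by (simp only: abs_mult power_abs) simp
  also have "\<dots> \<le> exp \<bar>r\<bar> * \<bar>r\<bar> ^ 3"
  proof (intro mult_right_mono)
    have "exp t \<le> exp \<bar>r\<bar>" using t(1) by simp
    then show "exp t / 6 \<le> exp \<bar>r\<bar>" using exp_gt_zero[of t] by linarith
  qed simp
  finally show ?thesis by (simp only: mult.commute)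
qed

text \<open>The interface between the analysis of the density and the probabilistic estimates:
  bounds on integrals depend on \<open>\<eta>\<close> and \<open>K\<close> alone and are therefore
  uniform over a neighbourhood.\<close>

locale exp_moment = prob_space M for M :: "'a measure" +
  fixes L :: "'a \<Rightarrow> real" and \<eta> K :: real
  assumes L_meas [measurable]: "L \<in> borel_measurable M" and L_ge: "\<And>x. L x \<ge> 1" and \<eta>: "\<eta> > 0"
    and exp_int: "integrable M (\<lambda>x. exp (\<eta> * L x))" and exp_le: "(\<integral>x. exp (\<eta> * L x) \<partial>M) \<le> K"
begin

text \<open>An upper bound for the integral of \<open>L x ^ p * exp (\<eta> / 2 * L x)\<close>, and
  so also for the \<open>p\<close>-th moment of \<open>L\<close>.\<close>

definition mom :: "nat \<Rightarrow> real" where "mom p = fact p * (2 / \<eta>) ^ p * K"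

text \<open>Half of the exponential weight pays for the power of \<open>L\<close>; the other half
  stays free to absorb the factor exp |r| of a Taylor remainder.\<close>

lemma L_power_exp_le: "L x ^ p * exp (\<eta> / 2 * L x) \<le> fact p * (2 / \<eta>) ^ p * exp (\<eta> * L x)"
proof -
  have "(\<eta> / 2 * L x) ^ p \<le> fact p * exp (\<eta> / 2 * L x)"
    using \<eta> L_ge[of x] by (intro power_le_fact_exp) simp
  then have "(2 / \<eta>) ^ p * (\<eta> / 2 * L x) ^ p \<le> (2 / \<eta>) ^ p * (fact p * exp (\<eta> / 2 * L x))"
    using \<eta> by (intro mult_left_mono) auto
  also have "(2 / \<eta>) ^ p * (\<eta> / 2 * L x) ^ p = L x ^ p"
    using \<eta> by (simp add: power_mult_distrib[symmetric])
  finally have "L x ^ p * exp (\<eta> / 2 * L x) \<le> (2 / \<eta>) ^ p * (fact p * exp (\<eta> / 2 * L x)) * exp (\<eta> / 2 * L x)"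
    by (rule mult_right_mono) simp
  also have "exp (\<eta> / 2 * L x) * exp (\<eta> / 2 * L x) = exp (\<eta> * L x)" by (simp add: exp_add[symmetric])
  then have "(2 / \<eta>) ^ p * (fact p * exp (\<eta> / 2 * L x)) * exp (\<eta> / 2 * L x) = fact p * (2 / \<eta>) ^ p * exp (\<eta> * L x)"
    by (simp only: mult.assoc mult.left_commute)
  finally show ?thesis .
qed

lemma dominated:
  assumes [measurable]: "f \<in> borel_measurable M" and le: "\<And>x. \<bar>f x\<bar> \<le> B * (L x ^ p * exp (\<eta> / 2 * L x))" and B: "B \<ge> 0"
  shows "integrable M f" and "\<bar>\<integral>x. f x \<partial>M\<bar> \<le> B * mom p"
proof -
  have le': "\<bar>f x\<bar> \<le> B * (fact p * (2 / \<eta>) ^ p) * exp (\<eta> * L x)" for x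
    using order_trans[OF le mult_left_mono[OF L_power_exp_le B]] by (simp only: mult.assoc)
  have int: "integrable M (\<lambda>x. B * (fact p * (2 / \<eta>) ^ p) * exp (\<eta> * L x))"
    by (intro integrable_mult_right exp_int)
  show f: "integrable M f"
    by (rule Bochner_Integration.integrable_bound[OF int]) (use le' in \<open>auto intro!: AE_I2 intro: order_trans[OF _ abs_ge_self]\<close>)
  have "\<bar>\<integral>x. f x \<partial>M\<bar> \<le> (\<integral>x. \<bar>f x\<bar> \<partial>M)" by (rule integral_abs_bound)
  also have "\<dots> \<le> (\<integral>x. B * (fact p * (2 / \<eta>) ^ p) * exp (\<eta> * L x) \<partial>M)"
    by (intro integral_mono int integrable_abs f le')
  also have "\<dots> = B * (fact p * (2 / \<eta>) ^ p) * (\<integral>x. exp (\<eta> * L x) \<partial>M)" by simp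
  also have "\<dots> \<le> B * (fact p * (2 / \<eta>) ^ p) * K"
    using B \<eta> by (intro mult_left_mono exp_le) auto
  finally show "\<bar>\<integral>x. f x \<partial>M\<bar> \<le> B * mom p" by (simp only: mom_def mult.assoc)
qed

lemma dominated_power:
  assumes [measurable]: "f \<in> borel_measurable M" and le: "\<And>x. \<bar>f x\<bar> \<le> B * L x ^ p" and B: "B \<ge> 0"
  shows "integrable M f" and "\<bar>\<integral>x. f x \<partial>M\<bar> \<le> B * mom p"
proof -
  have "\<bar>f x\<bar> \<le> B * (L x ^ p * exp (\<eta> / 2 * L x))" for x
  proof -
    have "1 \<le> exp (\<eta> / 2 * L x)" using \<eta> L_ge[of x] by simp
    then have "L x ^ p * 1 \<le> L x ^ p * exp (\<eta> / 2 * L x)" using L_ge[of x] by (intro mult_left_mono) auto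
    then show ?thesis using order_trans[OF le mult_left_mono[OF _ B]] by simp
  qed
  from dominated[OF assms(1) this B] show "integrable M f" "\<bar>\<integral>x. f x \<partial>M\<bar> \<le> B * mom p" .
qed

text \<open>Integrating the third-order expansion of exp r, with total 1, leaves only the mean of
  its remainder. The condition on \<open>\<zeta>\<close> keeps exp |r| below the free half of the
  exponential weight.\<close>

lemma log_ratio_mean:
  assumes [measurable]: "r \<in> borel_measurable M" and le: "\<And>x. \<bar>r x\<bar> \<le> \<zeta> * L x" and \<zeta>: "0 \<le> \<zeta>" "\<zeta> \<le> \<eta> / 2"
    and one: "(\<integral>x. exp (r x) \<partial>M) = 1"
  shows "\<bar>(\<integral>x. r x \<partial>M) + (\<integral>x. (r x)\<^sup>2 \<partial>M) / 2\<bar> \<le> \<zeta> ^ 3 * mom 3"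
proof -
  define R where "R x = exp (r x) - 1 - r x - (r x)\<^sup>2 / 2" for x
  have [measurable]: "R \<in> borel_measurable M" unfolding R_def by measurable
  have Lp: "0 \<le> L x" for x using L_ge[of x] by linarith
  have rho: "\<bar>R x\<bar> \<le> \<zeta> ^ 3 * (L x ^ 3 * exp (\<eta> / 2 * L x))" for x
  proof -
    have "\<bar>R x\<bar> \<le> \<bar>r x\<bar> ^ 3 * exp \<bar>r x\<bar>" unfolding R_def by (rule exp_taylor2)
    also have "\<dots> \<le> (\<zeta> * L x) ^ 3 * exp (\<eta> / 2 * L x)"
    proof (intro mult_mono power_mono le)
      have "\<bar>r x\<bar> \<le> \<eta> / 2 * L x" by (rule order_trans[OF le mult_right_mono[OF \<zeta>(2) Lp]])
      then show "exp \<bar>r x\<bar> \<le> exp (\<eta> / 2 * L x)" by simp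
    qed (use \<zeta> Lp in auto)
    finally show ?thesis by (simp only: power_mult_distrib mult.assoc)
  qed
  note d = dominated[OF _ rho]
  have r: "integrable M r" using dominated_power(1)[of r \<zeta> 1] le \<zeta> by simp
  have r2: "integrable M (\<lambda>x. (r x)\<^sup>2)"
  proof (rule dominated_power(1)[of _ "\<zeta>\<^sup>2" 2])
    show "\<bar>(r x)\<^sup>2\<bar> \<le> \<zeta>\<^sup>2 * L x ^ 2" for x
      by (rule abs_square_le[OF le])
  qed auto
  have \<rho>: "integrable M R" by (rule d(1)) (use \<zeta> in auto)
  have "exp (r x) = R x + 1 + r x + (r x)\<^sup>2 / 2" for x by (simp add: R_def)
  then have "(\<integral>x. exp (r x) \<partial>M) = (\<integral>x. R x + 1 + r x + (r x)\<^sup>2 / 2 \<partial>M)" by simp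
  also have "\<dots> = (\<integral>x. R x \<partial>M) + 1 + (\<integral>x. r x \<partial>M) + (\<integral>x. (r x)\<^sup>2 \<partial>M) / 2"
    using r r2 \<rho> by (simp add: prob_space)
  finally have "(\<integral>x. r x \<partial>M) + (\<integral>x. (r x)\<^sup>2 \<partial>M) / 2 = - (\<integral>x. R x \<partial>M)" using one by simp
  moreover have "\<bar>\<integral>x. R x \<partial>M\<bar> \<le> \<zeta> ^ 3 * mom 3" by (rule d(2)) (use \<zeta> in auto)
  ultimately show ?thesis by simp
qed

text \<open>Here \<open>r m\<close> is the log density ratio for the parameter moved by \<open>1 / m\<close> along a ray.\<close>

lemma score_mean_zero:
  assumes [measurable]: "s \<in> borel_measurable M" "\<And>m. r m \<in> borel_measurable M"
    and s: "\<And>x. \<bar>s x\<bar> \<le> C * L x" and C: "C \<ge> 0"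
    and r: "\<And>m x. m \<ge> m0 \<Longrightarrow> \<bar>r m x - s x / real m\<bar> \<le> C * L x / (real m)\<^sup>2"
    and one: "\<And>m. m \<ge> m0 \<Longrightarrow> (\<integral>x. exp (r m x) \<partial>M) = 1"
  shows "(\<integral>x. s x \<partial>M) = 0"
proof -
  \<comment> \<open>Collects (2C)^3 from the Taylor remainder, (2C)^2 / 2 from half the second
    moment of \<open>r m\<close>, and C from the deviation of \<open>r m\<close> from its linear
    part.\<close>
  define B where "B = 8 * C ^ 3 * mom 3 + 2 * C\<^sup>2 * mom 2 + C * mom 1"
  have Lp: "0 \<le> L x" for x using L_ge[of x] by linarith
  have K: "0 \<le> mom p" for p
    using dominated_power(2)[of "\<lambda>_. 0" 1 p] Lp by (simp add: mom_def)
  have si: "integrable M s" using dominated_power(1)[of s C 1] s C by simp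
  \<comment> \<open>The mean of \<open>r m\<close> is of order 1 / m^2 by
    \<open>log_ratio_mean\<close>, and it differs from the mean of \<open>s\<close> divided by
    \<open>m\<close> by the same order; multiplying by \<open>m\<close> leaves 1 / m.\<close>
  have main: "\<bar>\<integral>x. s x \<partial>M\<bar> \<le> B / real m" if m: "m \<ge> m0" "m \<ge> 1" "2 * C / real m \<le> \<eta> / 2" for m
  proof -
    have m1: "real m \<ge> 1" using m(2) by simp
    have rb: "\<bar>r m x\<bar> \<le> 2 * C / real m * L x" for x
    proof -
      have "C * L x / (real m)\<^sup>2 \<le> C * L x / real m"
        using m1 C Lp[of x] by (intro divide_left_mono) (auto simp: power2_eq_square)
      moreover have "\<bar>s x / real m\<bar> \<le> C * L x / real m" using s[of x] m1 by (simp add: divide_right_mono abs_divide)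
      moreover have "2 * C / real m * L x = C * L x / real m + C * L x / real m" by simp
      ultimately show ?thesis using r[OF m(1), of x] by linarith
    qed
    have ri: "integrable M (r m)" using dominated_power(1)[of "r m" "2 * C / real m" 1] rb C by simp
    have r2: "\<bar>\<integral>x. (r m x)\<^sup>2 \<partial>M\<bar> \<le> (2 * C / real m)\<^sup>2 * mom 2"
    proof (rule dominated_power(2))
      show "\<bar>(r m x)\<^sup>2\<bar> \<le> (2 * C / real m)\<^sup>2 * L x ^ 2" for x
        by (rule abs_square_le[OF rb])
    qed auto
    have 1: "\<bar>(\<integral>x. r m x \<partial>M) + (\<integral>x. (r m x)\<^sup>2 \<partial>M) / 2\<bar> \<le> (2 * C / real m) ^ 3 * mom 3"
      by (rule log_ratio_mean[OF _ rb _ m(3) one[OF m(1)]]) (use C in auto)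
    have 2: "\<bar>\<integral>x. r m x - s x / real m \<partial>M\<bar> \<le> C / (real m)\<^sup>2 * mom 1"
      by (rule dominated_power(2)[where p=1]) (use r[OF m(1)] C in auto)
    have "(\<integral>x. r m x - s x / real m \<partial>M) = (\<integral>x. r m x \<partial>M) - (\<integral>x. s x \<partial>M) / real m"
      using ri si by simp
    with 1 2 r2 have "\<bar>(\<integral>x. s x \<partial>M) / real m\<bar> \<le> (2 * C / real m) ^ 3 * mom 3 + (2 * C / real m)\<^sup>2 * mom 2 / 2 + C / (real m)\<^sup>2 * mom 1"
      by linarith
    also have "\<dots> \<le> B / (real m)\<^sup>2"
    proof -
      have "8 * C ^ 3 * mom 3 / real m ^ 3 \<le> 8 * C ^ 3 * mom 3 / (real m)\<^sup>2"
        using m1 C K[of 3] power_increasing[of 2 3 "real m"] by (intro divide_left_mono mult_nonneg_nonneg) auto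
      then show ?thesis by (simp add: B_def power_divide power_mult_distrib add_divide_distrib)
    qed
    finally have "\<bar>\<integral>x. s x \<partial>M\<bar> / real m \<le> B / (real m)\<^sup>2" by (simp add: abs_divide)
    then show ?thesis using m1 by (simp add: power2_eq_square field_simps)
  qed
  have "(\<lambda>m. B / real m) \<longlonglongrightarrow> 0" by (rule lim_const_over_n)
  moreover have "(\<lambda>m. 2 * C / real m) \<longlonglongrightarrow> 0" by (rule lim_const_over_n)
  then have "\<forall>\<^sub>F m in sequentially. 2 * C / real m < \<eta> / 2" using \<eta> by (intro order_tendstoD) auto
  then have "\<forall>\<^sub>F m in sequentially. \<bar>\<integral>x. s x \<partial>M\<bar> \<le> B / real m"
    using eventually_ge_at_top[of m0] eventually_ge_at_top[of 1] by eventually_elim (auto intro: main)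
  ultimately have "\<bar>\<integral>x. s x \<partial>M\<bar> \<le> 0" by (intro tendsto_lowerbound[of "\<lambda>m. B / real m" 0]) auto
  then show ?thesis by simp
qed

text \<open>As \<open>s\<close> is centred, \<open>q\<close> has the mean of \<open>r\<close>, which
  \<open>log_ratio_mean\<close> reduces to half the second moment of \<open>r\<close> with the
  opposite sign. Replacing \<open>n\<close> times the square of \<open>r\<close> by that of
  \<open>s\<close> then costs only order 1 / sqrt n.\<close>

lemma log_ratio_moments:
  assumes [measurable]: "s \<in> borel_measurable M" "r \<in> borel_measurable M"
    and s: "\<And>x. \<bar>s x\<bar> \<le> C * L x" and C: "C \<ge> 0" and n: "n \<ge> 1" "2 * C / sqrt n \<le> \<eta> / 2"
    and r: "\<And>x. \<bar>r x - s x / sqrt n\<bar> \<le> C * L x / n"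
    and one: "(\<integral>x. exp (r x) \<partial>M) = 1" and mean: "(\<integral>x. s x \<partial>M) = 0"
  defines "q \<equiv> \<lambda>x. r x - s x / sqrt n"
  shows "integrable M q" "integrable M (\<lambda>x. q x * q x)" "(\<integral>x. q x * q x \<partial>M) \<le> C\<^sup>2 * mom 2 / n\<^sup>2"
    "\<bar>n * (\<integral>x. q x \<partial>M) + (\<integral>x. (s x)\<^sup>2 \<partial>M) / 2\<bar> \<le> (8 * C ^ 3 * mom 3 + 2 * C\<^sup>2 * mom 2) / sqrt n"
proof -
  have Lp: "0 \<le> L x" for x using L_ge[of x] by linarith
  have n0: "n > 0" "sqrt n > 0" "sqrt n * sqrt n = n" "sqrt n \<le> n" using n(1) by (auto simp: real_sqrt_ge_one real_le_lsqrt power2_eq_square)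
  have qb: "\<bar>q x\<bar> \<le> C / n * L x" for x using r[of x] by (simp add: q_def)
  have [measurable]: "q \<in> borel_measurable M" unfolding q_def by measurable
  show qi: "integrable M q" using dominated_power(1)[of q "C / n" 1] qb C n0 by simp
  have q2: "\<bar>q x * q x\<bar> \<le> C\<^sup>2 / n\<^sup>2 * L x ^ 2" for x
  proof -
    have "\<bar>q x * q x\<bar> = \<bar>q x\<bar>\<^sup>2" by (simp add: power2_eq_square)
    also have "\<dots> \<le> (C / n * L x)\<^sup>2" by (intro power_mono qb) simp
    finally show ?thesis by (simp only: power_mult_distrib power_divide)
  qed
  show "integrable M (\<lambda>x. q x * q x)" by (rule dominated_power(1)[OF _ q2]) auto
  have "\<bar>\<integral>x. q x * q x \<partial>M\<bar> \<le> C\<^sup>2 / n\<^sup>2 * mom 2" by (rule dominated_power(2)[OF _ q2]) auto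
  then show "(\<integral>x. q x * q x \<partial>M) \<le> C\<^sup>2 * mom 2 / n\<^sup>2" by simp
  have rb: "\<bar>r x\<bar> \<le> 2 * C / sqrt n * L x" for x
  proof -
    have "C * L x / n \<le> C * L x / sqrt n"
      using n0 C Lp[of x] by (intro divide_left_mono) auto
    moreover have "\<bar>s x / sqrt n\<bar> \<le> C * L x / sqrt n" using s[of x] n0 by (simp add: divide_right_mono abs_divide)
    moreover have "2 * C / sqrt n * L x = C * L x / sqrt n + C * L x / sqrt n" by simp
    ultimately show ?thesis using r[of x] by linarith
  qed
  have si: "integrable M s" using dominated_power(1)[of s C 1] s C by simp
  have s2: "integrable M (\<lambda>x. (s x)\<^sup>2)"
  proof (rule dominated_power(1)[of _ "C\<^sup>2" 2])
    show "\<bar>(s x)\<^sup>2\<bar> \<le> C\<^sup>2 * L x ^ 2" for x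
      by (rule abs_square_le[OF s])
  qed auto
  have r2: "integrable M (\<lambda>x. (r x)\<^sup>2)"
  proof (rule dominated_power(1)[of _ "(2 * C / sqrt n)\<^sup>2" 2])
    show "\<bar>(r x)\<^sup>2\<bar> \<le> (2 * C / sqrt n)\<^sup>2 * L x ^ 2" for x
      by (rule abs_square_le[OF rb])
  qed auto
  have ri: "integrable M r" using dominated_power(1)[of r "2 * C / sqrt n" 1] rb C n0 by simp
  have 1: "\<bar>(\<integral>x. r x \<partial>M) + (\<integral>x. (r x)\<^sup>2 \<partial>M) / 2\<bar> \<le> (2 * C / sqrt n) ^ 3 * mom 3"
    by (rule log_ratio_mean[OF _ rb _ n(2) one]) (use C n0 in auto)
  have 2: "\<bar>\<integral>x. n * (r x)\<^sup>2 - (s x)\<^sup>2 \<partial>M\<bar> \<le> 3 * C\<^sup>2 / sqrt n * mom 2"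
  proof (rule dominated_power(2))
    fix x
    \<comment> \<open>Difference of two squares: one factor is \<open>q\<close>, of order 1 / n, and
      the other is of order 1 / sqrt n.\<close>
    have "n * (r x)\<^sup>2 - (s x)\<^sup>2 = n * (q x * (r x + s x / sqrt n))"
      using n0 by (simp add: q_def power2_eq_square field_simps)
    also have "\<bar>\<dots>\<bar> = n * (\<bar>q x\<bar> * \<bar>r x + s x / sqrt n\<bar>)" using n0 by (simp add: abs_mult)
    also have "\<dots> \<le> n * ((C / n * L x) * (3 * C / sqrt n * L x))"
    proof (intro mult_left_mono mult_mono qb)
      have "\<bar>s x / sqrt n\<bar> \<le> C / sqrt n * L x" using s[of x] n0 by (simp add: divide_right_mono abs_divide)
      moreover have "3 * C / sqrt n * L x = 2 * C / sqrt n * L x + C / sqrt n * L x" by (simp add: field_simps)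
      ultimately show "\<bar>r x + s x / sqrt n\<bar> \<le> 3 * C / sqrt n * L x" using rb[of x] by linarith
    qed (use n0 C Lp in auto)
    also have "\<dots> = 3 * C\<^sup>2 / sqrt n * L x ^ 2" using n0 by (simp add: power2_eq_square)
    finally show "\<bar>n * (r x)\<^sup>2 - (s x)\<^sup>2\<bar> \<le> 3 * C\<^sup>2 / sqrt n * L x ^ 2" .
  qed (use n0 in auto)
  have 3: "(\<integral>x. n * (r x)\<^sup>2 - (s x)\<^sup>2 \<partial>M) = n * (\<integral>x. (r x)\<^sup>2 \<partial>M) - (\<integral>x. (s x)\<^sup>2 \<partial>M)"
    using r2 s2 by simp
  have 4: "(\<integral>x. q x \<partial>M) = (\<integral>x. r x \<partial>M)"
    unfolding q_def using ri si mean by simp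
  have 5: "n * ((2 * C / sqrt n) ^ 3 * mom 3) = 8 * C ^ 3 * mom 3 / sqrt n"
  proof -
    have "sqrt n ^ 3 = n * sqrt n" using n0(3) by (simp add: power3_eq_cube)
    then show ?thesis using n0 by (simp add: power_divide power_mult_distrib)
  qed
  have "\<bar>n * (\<integral>x. r x \<partial>M) + n * (\<integral>x. (r x)\<^sup>2 \<partial>M) / 2\<bar> \<le> 8 * C ^ 3 * mom 3 / sqrt n"
  proof -
    have "n * \<bar>(\<integral>x. r x \<partial>M) + (\<integral>x. (r x)\<^sup>2 \<partial>M) / 2\<bar> \<le> n * ((2 * C / sqrt n) ^ 3 * mom 3)"
      using n0 by (intro mult_left_mono 1) auto
    moreover have "n * \<bar>(\<integral>x. r x \<partial>M) + (\<integral>x. (r x)\<^sup>2 \<partial>M) / 2\<bar> = \<bar>n * ((\<integral>x. r x \<partial>M) + (\<integral>x. (r x)\<^sup>2 \<partial>M) / 2)\<bar>"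
      using n0 by (simp add: abs_mult)
    ultimately show ?thesis unfolding 5 by (simp add: distrib_left)
  qed
  moreover have K: "0 \<le> mom 2"
    using dominated_power(2)[of "\<lambda>_. 0" 1 2] Lp by (simp add: mom_def)
  \<comment> \<open>Rounded up to 4 so that half of it is the coefficient 2 of the claim.\<close>
  have "3 * C\<^sup>2 / sqrt n * mom 2 \<le> 4 * C\<^sup>2 / sqrt n * mom 2"
    using n0 K by (intro mult_right_mono divide_right_mono) auto
  ultimately show "\<bar>n * (\<integral>x. q x \<partial>M) + (\<integral>x. (s x)\<^sup>2 \<partial>M) / 2\<bar> \<le> (8 * C ^ 3 * mom 3 + 2 * C\<^sup>2 * mom 2) / sqrt n"
    using 2 unfolding 3 4 add_divide_distrib by (simp add: algebra_simps)
qed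

end

section \<open>Triangular arrays\<close>

text \<open>A triangular array: the law of a single observation and the summand both change with
  \<open>n\<close>, while the weight and the constants are common to all rows. \<open>n0\<close> is
  the index from which the parameters have entered the neighbourhood.\<close>

locale score_array =
  fixes M :: "nat \<Rightarrow> 'a measure" and L :: "'a \<Rightarrow> real" and \<eta> K C :: real and n0 :: nat
    and s :: "nat \<Rightarrow> 'a \<Rightarrow> real"
  assumes M: "\<And>n. n \<ge> n0 \<Longrightarrow> exp_moment (M n) L \<eta> K" and C: "C \<ge> 0"
    and s_meas: "\<And>n. n \<ge> n0 \<Longrightarrow> s n \<in> borel_measurable (M n)"
    and s_le: "\<And>n x. n \<ge> n0 \<Longrightarrow> \<bar>s n x\<bar> \<le> C * L x"
    and s_mean: "\<And>n. n \<ge> n0 \<Longrightarrow> (\<integral>x. s n x \<partial>M n) = 0"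
begin

abbreviation "m \<equiv> exp_moment.mom \<eta> K"

lemma \<eta>_pos: "\<eta> > 0" using exp_moment.\<eta>[OF M] by blast

lemma log_likelihood_expansion:
  assumes r_meas: "\<And>n. n \<ge> n0 \<Longrightarrow> r n \<in> borel_measurable (M n)"
    and r: "\<And>n x. n \<ge> n0 \<Longrightarrow> \<bar>r n x - s n x / sqrt (real n)\<bar> \<le> C * L x / real n"
    and one: "\<And>n. n \<ge> n0 \<Longrightarrow> (\<integral>x. exp (r n x) \<partial>M n) = 1"
    and \<epsilon>: "\<epsilon> > 0"
  shows "(\<lambda>n. measure (\<Pi>\<^sub>M j\<in>{1..n}. M n) {\<omega> \<in> space (\<Pi>\<^sub>M j\<in>{1..n}. M n).
     \<epsilon> < \<bar>(\<Sum>j=1..n. r n (\<omega> j)) - ((\<Sum>j=1..n. s n (\<omega> j)) / sqrt (real n) - (\<integral>x. (s n x)\<^sup>2 \<partial>M n) / 2)\<bar>}) \<longlonglongrightarrow> 0"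
proof -
  define B where "B = 8 * C ^ 3 * m 3 + 2 * C\<^sup>2 * m 2"
  define A where "A = 4 * C\<^sup>2 * m 2 / \<epsilon>\<^sup>2"
  let ?E = "\<lambda>n. {\<omega> \<in> space (\<Pi>\<^sub>M j\<in>{1..n}. M n).
     \<epsilon> < \<bar>(\<Sum>j=1..n. r n (\<omega> j)) - ((\<Sum>j=1..n. s n (\<omega> j)) / sqrt (real n) - (\<integral>x. (s n x)\<^sup>2 \<partial>M n) / 2)\<bar>}"
  have bd: "measure (\<Pi>\<^sub>M j\<in>{1..n}. M n) (?E n) \<le> A / real n"
    if n: "n \<ge> n0" "n \<ge> 1" "2 * C / sqrt (real n) < \<eta> / 2" "B / sqrt (real n) < \<epsilon> / 2" for n
  proof -
    interpret E: exp_moment "M n" L \<eta> K by (rule M[OF n(1)])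
    interpret P: prob_space "\<Pi>\<^sub>M j\<in>{1..n}. M n" by (intro prob_space_PiM E.prob_space_axioms)
    define q where "q x = r n x - s n x / sqrt (real n)" for x
    define e where "e = (\<integral>x. q x \<partial>M n)"
    have n1: "real n \<ge> 1" using n(2) by simp
    note lm = E.log_ratio_moments[OF s_meas[OF n(1)] r_meas[OF n(1)] s_le[OF n(1)] C n1 less_imp_le[OF n(3)]
        r[OF n(1)] one[OF n(1)] s_mean[OF n(1)], folded q_def]
    have [measurable]: "q \<in> borel_measurable (M n)" using lm(1) by auto
    have 4: "\<bar>real n * e + (\<integral>x. (s n x)\<^sup>2 \<partial>M n) / 2\<bar> < \<epsilon> / 2"
      using lm(4) n(4) unfolding e_def B_def by linarith
    \<comment> \<open>The displayed quantity exceeds the centred sum of \<open>q\<close> by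
      \<open>n\<close> times \<open>e\<close> plus half the second moment of \<open>s n\<close>,
      which is below \<open>\<epsilon> / 2\<close> by now.\<close>
    have sub: "?E n \<subseteq> {\<omega> \<in> space (\<Pi>\<^sub>M j\<in>{1..n}. M n). \<epsilon> / 2 \<le> \<bar>\<Sum>j\<in>{1..n}. q (\<omega> j) - e\<bar>}"
    proof safe
      fix \<omega> assume gt: "\<epsilon> < \<bar>(\<Sum>j=1..n. r n (\<omega> j)) - ((\<Sum>j=1..n. s n (\<omega> j)) / sqrt (real n) - (\<integral>x. (s n x)\<^sup>2 \<partial>M n) / 2)\<bar>"
      have "(\<Sum>j=1..n. q (\<omega> j) - e) = (\<Sum>j=1..n. r n (\<omega> j)) - (\<Sum>j=1..n. s n (\<omega> j)) / sqrt (real n) - real n * e"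
        by (simp add: q_def sum_subtractf sum_divide_distrib)
      then show "\<epsilon> / 2 \<le> \<bar>\<Sum>j=1..n. q (\<omega> j) - e\<bar>" using gt 4 by linarith
    qed
    have "measure (\<Pi>\<^sub>M j\<in>{1..n}. M n) (?E n) \<le> measure (\<Pi>\<^sub>M j\<in>{1..n}. M n) {\<omega> \<in> space (\<Pi>\<^sub>M j\<in>{1..n}. M n). \<epsilon> / 2 \<le> \<bar>\<Sum>j\<in>{1..n}. q (\<omega> j) - e\<bar>}"
      by (rule P.finite_measure_mono[OF sub]) measurable
    also have "\<dots> \<le> real (card {1..n}) * (\<integral>x. q x * q x \<partial>M n) / (\<epsilon> / 2)\<^sup>2"
      unfolding e_def by (rule iid_sum_chebyshev[OF E.prob_space_axioms _ lm(1,2)]) (use \<epsilon> in auto)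
    also have "\<dots> \<le> real n * (C\<^sup>2 * m 2 / (real n)\<^sup>2) / (\<epsilon> / 2)\<^sup>2"
      using mult_left_mono[OF lm(3), of "real n"] by (intro divide_right_mono) simp_all
    also have "\<dots> = A / real n" using n1 by (simp add: A_def power2_eq_square field_simps)
    finally show ?thesis .
  qed
  have sq: "(\<lambda>n. a / sqrt (real n)) \<longlonglongrightarrow> 0" for a :: real
    by (intro tendsto_divide_0[OF tendsto_const] filterlim_at_top_imp_at_infinity
        filterlim_compose[OF sqrt_at_top] filterlim_real_sequentially)
  have "\<forall>\<^sub>F n in sequentially. 2 * C / sqrt (real n) < \<eta> / 2"
    using order_tendstoD(2)[OF sq] \<eta>_pos by simp
  moreover have "\<forall>\<^sub>F n in sequentially. B / sqrt (real n) < \<epsilon> / 2"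
    using order_tendstoD(2)[OF sq] \<epsilon> by simp
  ultimately have "\<forall>\<^sub>F n in sequentially. norm (measure (\<Pi>\<^sub>M j\<in>{1..n}. M n) (?E n)) \<le> A / real n"
    using eventually_ge_at_top[of n0] eventually_ge_at_top[of 1]
    by eventually_elim (simp only: real_norm_def abs_of_nonneg[OF measure_nonneg] bd)
  then show ?thesis by (rule Lim_null_comparison) (rule lim_const_over_n)
qed

text \<open>Independence gives the \<open>n\<close>-th power of one characteristic function
  \<open>\<psi>\<close>, and a third-order expansion gives \<psi> = 1 - vn n / (2 n) up to order
  n^(-3/2). Powers of numbers in the unit disc differ by at most \<open>n\<close> times the
  difference of the bases. Frequency 1 suffices, since other frequencies can be absorbed into
  \<open>s\<close>.\<close>

lemma char_normalized_sum:
  assumes v: "(\<lambda>n. \<integral>x. (s n x)\<^sup>2 \<partial>M n) \<longlonglongrightarrow> v"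
  shows "(\<lambda>n. \<integral>\<omega>. iexp ((\<Sum>j=1..n. s n (\<omega> j)) / sqrt (real n)) \<partial>(\<Pi>\<^sub>M j\<in>{1..n}. M n)) \<longlonglongrightarrow> complex_of_real (exp (- v / 2))"
proof -
  define vn where "vn n = (\<integral>x. (s n x)\<^sup>2 \<partial>M n)" for n
  define A where "A = C ^ 3 * m 3"
  have "v \<ge> 0" using v by (rule LIMSEQ_le_const) auto
  let ?z = "\<lambda>n. complex_of_real (1 + (- v / 2) / real n)"
  let ?\<phi> = "\<lambda>n. \<integral>\<omega>. iexp ((\<Sum>j=1..n. s n (\<omega> j)) / sqrt (real n)) \<partial>(\<Pi>\<^sub>M j\<in>{1..n}. M n)"
  have bd: "norm (?\<phi> n - ?z n ^ n) \<le> A / sqrt (real n) + \<bar>v - vn n\<bar>" if n: "n \<ge> n0" "n \<ge> 1" "real n \<ge> v" for n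
  proof -
    interpret E: exp_moment "M n" L \<eta> K by (rule M[OF n(1)])
    interpret PM: product_sigma_finite "\<lambda>_::nat. M n" ..
    have n1: "real n > 0" using n(2) by simp
    have [measurable]: "s n \<in> borel_measurable (M n)" by (rule s_meas[OF n(1)])
    define y where "y x = s n x / sqrt (real n)" for x
    have [measurable]: "y \<in> borel_measurable (M n)" unfolding y_def by measurable
    have yb: "\<bar>y x\<bar> \<le> C / sqrt (real n) * L x" for x
      using s_le[OF n(1), of x] n1 by (simp add: y_def abs_divide divide_right_mono)
    have yi: "integrable (M n) y" using E.dominated_power(1)[of y "C / sqrt (real n)" 1] yb C n1 by simp
    have y2: "integrable (M n) (\<lambda>x. (y x)\<^sup>2)"
      by (rule E.dominated_power(1)[OF _ abs_square_le[OF yb]]) auto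
    define \<psi> where "\<psi> = (\<integral>x. iexp (y x) \<partial>M n)"
    have ie: "integrable (M n) (\<lambda>x. iexp (y x))" by (rule E.integrable_iexp) auto
    have \<psi>1: "norm \<psi> \<le> 1"
    proof -
      have "norm \<psi> \<le> (\<integral>x. norm (iexp (y x)) \<partial>M n)" unfolding \<psi>_def by (rule integral_norm_bound)
      then show ?thesis by (simp add: E.prob_space)
    qed
    have prod: "?\<phi> n = \<psi> ^ n"
    proof -
      have "iexp ((\<Sum>j=1..n. s n (\<omega> j)) / sqrt (real n)) = (\<Prod>j\<in>{1..n}. iexp (y (\<omega> j)))" for \<omega> :: "nat \<Rightarrow> 'a"
        by (simp add: y_def sum_divide_distrib exp_sum[symmetric] sum_distrib_left)
      then have "?\<phi> n = (\<integral>\<omega>. (\<Prod>j\<in>{1..n}. iexp (y (\<omega> j))) \<partial>(\<Pi>\<^sub>M j\<in>{1..n}. M n))" by simp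
      also have "\<dots> = (\<Prod>j\<in>{1..n}. \<psi>)"
        unfolding \<psi>_def by (rule PM.product_integral_prod) (auto intro: ie)
      finally show ?thesis by simp
    qed
    have y_mean: "(\<integral>x. y x \<partial>M n) = 0" by (simp add: y_def s_mean[OF n(1)])
    have y_var: "(\<integral>x. (y x)\<^sup>2 \<partial>M n) = vn n / real n" using n1 by (simp add: y_def vn_def power_divide)
    have t: "norm (iexp a - (1 + \<i> * complex_of_real a - complex_of_real (a\<^sup>2) / 2)) \<le> \<bar>a\<bar> ^ 3" for a
    proof -
      have "norm (iexp a - (1 + \<i> * complex_of_real a - complex_of_real (a\<^sup>2) / 2)) \<le> \<bar>a\<bar> ^ 3 / 6"
        using iexp_approx1[of a 2] by (simp add: eval_nat_numeral algebra_simps power_mult_distrib)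
      then show ?thesis by (rule order_trans) simp
    qed
    have "(\<integral>x. 1 + \<i> * complex_of_real (y x) - complex_of_real ((y x)\<^sup>2) / 2 \<partial>M n) = 1 - complex_of_real (vn n / real n) / 2"
      using yi y2 y_mean y_var by (simp add: E.prob_space del: of_real_power of_real_divide)
    then have "\<psi> - (1 - complex_of_real (vn n / real n) / 2)
      = (\<integral>x. iexp (y x) - (1 + \<i> * complex_of_real (y x) - complex_of_real ((y x)\<^sup>2) / 2) \<partial>M n)"
      unfolding \<psi>_def using ie yi y2 by (simp del: of_real_power of_real_divide)
    also have "norm \<dots> \<le> (\<integral>x. norm (iexp (y x) - (1 + \<i> * complex_of_real (y x) - complex_of_real ((y x)\<^sup>2) / 2)) \<partial>M n)"
      by (rule integral_norm_bound)
    also have "\<dots> \<le> (C / sqrt (real n)) ^ 3 * m 3"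
    proof (rule order_trans[OF abs_ge_self E.dominated_power(2)])
      show "\<bar>norm (iexp (y x) - (1 + \<i> * complex_of_real (y x) - complex_of_real ((y x)\<^sup>2) / 2))\<bar> \<le> (C / sqrt (real n)) ^ 3 * L x ^ 3" for x
        using order_trans[OF t[of "y x"] power_mono[OF yb[of x], of 3]] unfolding power_mult_distrib by simp
    qed (use C n1 in auto)
    also have "\<dots> = A / (real n * sqrt (real n))"
      using n1 by (simp add: A_def power_divide power3_eq_cube)
    finally have 1: "norm (\<psi> - (1 - complex_of_real (vn n / real n) / 2)) \<le> A / (real n * sqrt (real n))" .
    have "(1 - complex_of_real (vn n / real n) / 2) - ?z n = complex_of_real ((v - vn n) / (2 * real n))"
      using n1 by (simp add: field_simps)
    then have 2: "norm ((1 - complex_of_real (vn n / real n) / 2) - ?z n) \<le> \<bar>v - vn n\<bar> / real n"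
      using n1 by (simp only: norm_of_real) (simp add: abs_divide field_simps)
    \<comment> \<open>The requirement that \<open>n\<close> be at least \<open>v\<close> keeps this
      base in the unit disc, so that the power estimate applies.\<close>
    have z1: "norm (?z n) \<le> 1"
    proof -
      have "v / 2 / real n \<le> 1" "0 \<le> v / 2 / real n" using n(3) n1 \<open>v \<ge> 0\<close> by (auto simp: divide_le_eq)
      then have "\<bar>1 + (- v / 2) / real n\<bar> \<le> 1" by (simp add: abs_le_iff)
      then show ?thesis by (simp only: norm_of_real)
    qed
    have "norm (\<psi> ^ n - ?z n ^ n) \<le> real n * norm (\<psi> - ?z n)" by (rule norm_power_diff[OF \<psi>1 z1])
    also have "\<dots> \<le> real n * (A / (real n * sqrt (real n)) + \<bar>v - vn n\<bar> / real n)"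
    proof (intro mult_left_mono)
      have "a - b + (b - c) = a - c" for a b c :: complex by simp
      from norm_triangle_le[OF add_mono[OF 1 2], unfolded this]
      show "norm (\<psi> - ?z n) \<le> A / (real n * sqrt (real n)) + \<bar>v - vn n\<bar> / real n" .
    qed simp
    also have "\<dots> = A / sqrt (real n) + \<bar>v - vn n\<bar>" using n1 by (simp add: field_simps)
    finally show ?thesis unfolding prod .
  qed
  have "(\<lambda>n. A / sqrt (real n)) \<longlonglongrightarrow> 0"
    by (intro tendsto_divide_0[OF tendsto_const] filterlim_at_top_imp_at_infinity
        filterlim_compose[OF sqrt_at_top] filterlim_real_sequentially)
  moreover have "(\<lambda>n. \<bar>v - vn n\<bar>) \<longlonglongrightarrow> \<bar>v - v\<bar>" using v unfolding vn_def by (intro tendsto_intros)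
  ultimately have lim0: "(\<lambda>n. A / sqrt (real n) + \<bar>v - vn n\<bar>) \<longlonglongrightarrow> 0" using tendsto_add by fastforce
  have "\<forall>\<^sub>F n in sequentially. norm (?\<phi> n - ?z n ^ n) \<le> A / sqrt (real n) + \<bar>v - vn n\<bar>"
    using eventually_ge_at_top[of n0] eventually_ge_at_top[of 1] eventually_ge_at_top[of "nat \<lceil>v\<rceil>"]
    by eventually_elim (rule bd; linarith)
  then have d: "(\<lambda>n. ?\<phi> n - ?z n ^ n) \<longlonglongrightarrow> 0" by (rule Lim_null_comparison) (rule lim0)
  have "(\<lambda>n. complex_of_real ((1 + (- v / 2) / real n) ^ n)) \<longlonglongrightarrow> complex_of_real (exp (- v / 2))"
    by (intro tendsto_of_real tendsto_exp_limit_sequentially)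
  from tendsto_add[OF d this] show ?thesis by simp
qed

end

section \<open>The continuity theorem in several dimensions\<close>

text \<open>Convolution with a small Gaussian turns an integral against a law into an integral of its
  characteristic function.\<close>

definition gauss_conv :: "(real^'d) measure \<Rightarrow> real \<Rightarrow> real^'d \<Rightarrow> real" where
  "gauss_conv N \<sigma> y = (\<integral>x. exp (- (norm ((1 / \<sigma>) *\<^sub>R (y - x)))\<^sup>2 / 2) \<partial>N)"

text \<open>The Gaussian kernel is the characteristic function of \<open>std_gauss\<close>; Fubini
  then lets the characters be integrated against \<open>N\<close> before the frequencies are
  averaged.\<close>

lemma gauss_conv_char:
  fixes N :: "(real^'d) measure"
  assumes N: "prob_space N" and [simp, measurable_cong]: "sets N = sets borel"
  shows "complex_of_real (gauss_conv N \<sigma> y)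
    = (\<integral>T. iexp (T \<bullet> ((1 / \<sigma>) *\<^sub>R y)) * (\<integral>x. iexp ((- (1 / \<sigma>) *\<^sub>R T) \<bullet> x) \<partial>N) \<partial>std_gauss)"
proof -
  interpret N: prob_space N by fact
  interpret G: prob_space "std_gauss :: (real^'d) measure" by (rule prob_space_std_gauss)
  interpret P: pair_prob_space N "std_gauss :: (real^'d) measure" ..
  let ?f = "\<lambda>x T. iexp (((1 / \<sigma>) *\<^sub>R (y - x)) \<bullet> T)"
  have int: "integrable (N \<Otimes>\<^sub>M std_gauss) (case_prod ?f)"
    by (rule P.integrable_const_bound[where B=1]) (auto simp: split_beta)
  have "complex_of_real (gauss_conv N \<sigma> y) = (\<integral>x. complex_of_real (exp (- (norm ((1 / \<sigma>) *\<^sub>R (y - x)))\<^sup>2 / 2)) \<partial>N)"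
    unfolding gauss_conv_def by (rule integral_complex_of_real[symmetric])
  also have "\<dots> = (\<integral>x. \<integral>T. ?f x T \<partial>std_gauss \<partial>N)" by (simp only: char_std_gauss)
  also have "\<dots> = (\<integral>T. \<integral>x. ?f x T \<partial>N \<partial>std_gauss)" by (rule P.Fubini_integral[OF int, symmetric])
  also have "\<dots> = (\<integral>T. iexp (T \<bullet> ((1 / \<sigma>) *\<^sub>R y)) * (\<integral>x. iexp ((- (1 / \<sigma>) *\<^sub>R T) \<bullet> x) \<partial>N) \<partial>std_gauss)"
  proof (intro Bochner_Integration.integral_cong refl)
    fix T :: "real^'d"
    have "?f x T = iexp (T \<bullet> ((1 / \<sigma>) *\<^sub>R y)) * iexp ((- (1 / \<sigma>) *\<^sub>R T) \<bullet> x)" for x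
      unfolding exp_add[symmetric] distrib_left[symmetric] of_real_add[symmetric]
      by (rule arg_cong[where f="\<lambda>a. iexp a"])
        (simp add: inner_diff_left inner_commute[of T y] inner_commute[of T x] right_diff_distrib)
    then show "(\<integral>x. ?f x T \<partial>N) = iexp (T \<bullet> ((1 / \<sigma>) *\<^sub>R y)) * (\<integral>x. iexp ((- (1 / \<sigma>) *\<^sub>R T) \<bullet> x) \<partial>N)"
      by simp
  qed
  finally show ?thesis .
qed

text \<open>The substitution y = x + \<sigma> z moves the smoothing from \<open>g\<close> to the
  law. The prefactor normalizes the Gaussian density of scale \<open>\<sigma>\<close>, which
  \<open>gauss_conv\<close> omits.\<close>

lemma gauss_conv_integral:
  fixes N :: "(real^'d) measure" and g :: "real^'d \<Rightarrow> real"
  assumes N: "prob_space N" and sets [simp, measurable_cong]: "sets N = sets borel" and \<sigma>: "\<sigma> > 0"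
    and g: "integrable lborel g"
  defines "k \<equiv> (2 * pi) powr (- real CARD('d) / 2)"
  shows "(\<integral>x. (\<integral>z. g (x + \<sigma> *\<^sub>R z) \<partial>std_gauss) \<partial>N) = k / \<sigma> ^ CARD('d) * (\<integral>y. g y * gauss_conv N \<sigma> y \<partial>lborel)"
proof -
  interpret N: prob_space N by fact
  interpret P: pair_sigma_finite N "lborel :: (real^'d) measure" ..
  have [measurable]: "g \<in> borel_measurable borel" using g by auto
  let ?e = "\<lambda>x y. exp (- (norm ((1 / \<sigma>) *\<^sub>R (y - x)))\<^sup>2 / 2)"
  have e1: "0 \<le> ?e x y" "?e x y \<le> 1" for x y :: "real^'d" by auto
  have inner: "(\<integral>z. g (x + \<sigma> *\<^sub>R z) \<partial>std_gauss) = k / \<sigma> ^ CARD('d) * (\<integral>y. g y * ?e x y \<partial>lborel)" for x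
  proof -
    have "(\<integral>y. g y * ?e x y \<partial>lborel) = \<sigma> ^ CARD('d) * (\<integral>z. g (x + \<sigma> *\<^sub>R z) * exp (- (norm z)\<^sup>2 / 2) \<partial>lborel)"
      using \<sigma> by (subst lborel_affine[of \<sigma> x]) (simp_all add: integral_density integral_distr)
    moreover have "(\<integral>z. g (x + \<sigma> *\<^sub>R z) \<partial>std_gauss) = (\<integral>z. (k * exp (- (norm z)\<^sup>2 / 2)) * g (x + \<sigma> *\<^sub>R z) \<partial>lborel)"
      unfolding std_gauss_def k_def by (subst integral_density) auto
    moreover have "(\<integral>z. (k * exp (- (norm z)\<^sup>2 / 2)) * g (x + \<sigma> *\<^sub>R z) \<partial>lborel) = k * (\<integral>z. g (x + \<sigma> *\<^sub>R z) * exp (- (norm z)\<^sup>2 / 2) \<partial>lborel)"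
      by (subst integral_mult_right_zero[symmetric]) (simp add: mult_ac)
    ultimately show ?thesis using \<sigma> by simp
  qed
  have int: "integrable (N \<Otimes>\<^sub>M lborel) (case_prod (\<lambda>x y. g y * ?e x y))"
  proof (rule P.Fubini_integrable)
    show "(\<lambda>(x, y). g y * ?e x y) \<in> borel_measurable (N \<Otimes>\<^sub>M lborel)" by measurable
    have gi: "integrable lborel (\<lambda>y. g y * ?e x y)" for x
      by (rule Bochner_Integration.integrable_bound[OF g])
        (use e1 in \<open>auto intro!: AE_I2 simp: abs_mult intro: mult_left_le\<close>)
    then show "AE x in N. integrable lborel (\<lambda>y. case (x, y) of (x, y) \<Rightarrow> g y * ?e x y)" by simp
    show "integrable N (\<lambda>x. \<integral>y. norm (case (x, y) of (x, y) \<Rightarrow> g y * ?e x y) \<partial>lborel)"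
    proof (rule N.integrable_const_bound[where B="\<integral>y. \<bar>g y\<bar> \<partial>lborel"])
      show "AE x in N. norm (\<integral>y. norm (case (x, y) of (x, y) \<Rightarrow> g y * ?e x y) \<partial>lborel) \<le> (\<integral>y. \<bar>g y\<bar> \<partial>lborel)"
      proof (intro AE_I2)
        fix x
        have "(\<integral>y. \<bar>g y * ?e x y\<bar> \<partial>lborel) \<le> (\<integral>y. \<bar>g y\<bar> \<partial>lborel)"
          by (intro integral_mono integrable_abs gi g) (use e1 in \<open>simp add: abs_mult mult_left_le\<close>)
        then show "norm (\<integral>y. norm (case (x, y) of (x, y) \<Rightarrow> g y * ?e x y) \<partial>lborel) \<le> (\<integral>y. \<bar>g y\<bar> \<partial>lborel)"
          by simp
      qed
    qed measurable
  qed
  have "(\<integral>x. (\<integral>z. g (x + \<sigma> *\<^sub>R z) \<partial>std_gauss) \<partial>N) = k / \<sigma> ^ CARD('d) * (\<integral>x. \<integral>y. g y * ?e x y \<partial>lborel \<partial>N)"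
    unfolding inner by simp
  also have "(\<integral>x. \<integral>y. g y * ?e x y \<partial>lborel \<partial>N) = (\<integral>y. \<integral>x. g y * ?e x y \<partial>N \<partial>lborel)"
    by (rule P.Fubini_integral[OF int, symmetric])
  finally show ?thesis by (simp add: gauss_conv_def)
qed

locale char_convergence =
  fixes N :: "nat \<Rightarrow> (real^'d) measure" and P :: "(real^'d) measure"
  assumes N: "\<And>n. prob_space (N n)" "\<And>n. sets (N n) = sets borel" and P: "prob_space P" "sets P = sets borel"
    and char: "\<And>t. (\<lambda>n. \<integral>x. iexp (t \<bullet> x) \<partial>N n) \<longlonglongrightarrow> (\<integral>x. iexp (t \<bullet> x) \<partial>P)"
begin

lemma char_norm_le: "prob_space Q \<Longrightarrow> sets Q = sets (borel :: (real^'d) measure) \<Longrightarrow> norm (\<integral>x. iexp (t \<bullet> x) \<partial>Q) \<le> 1"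
proof -
  assume Q: "prob_space Q" "sets Q = sets (borel :: (real^'d) measure)"
  interpret Q: prob_space Q by (rule Q)
  have "norm (\<integral>x. iexp (t \<bullet> x) \<partial>Q) \<le> (\<integral>x. norm (iexp (t \<bullet> x)) \<partial>Q)" by (rule integral_norm_bound)
  then show ?thesis by (simp add: Q.prob_space)
qed

lemma char_measurable: 
  assumes Q: "prob_space Q" and [measurable_cong]: "sets Q = sets (borel :: (real^'d) measure)"
  shows "(\<lambda>T. \<integral>x. iexp ((a *\<^sub>R T) \<bullet> x) \<partial>Q) \<in> borel_measurable borel"
proof -
  interpret Q: prob_space Q by (rule Q)
  show ?thesis by (rule Q.borel_measurable_lebesgue_integral) measurable
qed

lemma gauss_conv_tendsto: "(\<lambda>n. gauss_conv (N n) \<sigma> y) \<longlonglongrightarrow> gauss_conv P \<sigma> y"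
proof -
  interpret G: prob_space "std_gauss :: (real^'d) measure" by (rule prob_space_std_gauss)
  note [measurable] = char_measurable[OF N] char_measurable[OF P]
  have "(\<lambda>n. complex_of_real (gauss_conv (N n) \<sigma> y)) \<longlonglongrightarrow> complex_of_real (gauss_conv P \<sigma> y)"
    unfolding gauss_conv_char[OF N] gauss_conv_char[OF P]
  proof (rule integral_dominated_convergence[where w="\<lambda>_. 1"])
    show "AE T in std_gauss. (\<lambda>n. iexp (T \<bullet> ((1 / \<sigma>) *\<^sub>R y)) * (\<integral>x. iexp ((- (1 / \<sigma>) *\<^sub>R T) \<bullet> x) \<partial>N n))
        \<longlonglongrightarrow> iexp (T \<bullet> ((1 / \<sigma>) *\<^sub>R y)) * (\<integral>x. iexp ((- (1 / \<sigma>) *\<^sub>R T) \<bullet> x) \<partial>P)"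
      by (intro AE_I2 tendsto_mult tendsto_const char)
    show "AE T in std_gauss. norm (iexp (T \<bullet> ((1 / \<sigma>) *\<^sub>R y)) * (\<integral>x. iexp ((- (1 / \<sigma>) *\<^sub>R T) \<bullet> x) \<partial>N n)) \<le> 1" for n
    proof -
      have bd: "norm (iexp a * z) \<le> 1" if "norm z \<le> 1" for a z using that by (simp add: norm_mult)
      show ?thesis by (intro AE_I2) (rule bd[OF char_norm_le[OF N]])
    qed
  qed measurable
  then show ?thesis by (simp add: tendsto_of_real_iff)
qed

lemma gauss_conv_bounds:
  assumes Q: "prob_space Q" "sets Q = sets (borel :: (real^'d) measure)"
  shows "\<bar>gauss_conv Q \<sigma> y\<bar> \<le> 1" "gauss_conv Q \<sigma> \<in> borel_measurable borel"
proof -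
  interpret Q: prob_space Q by (rule Q)
  note Q(2)[measurable_cong]
  have "\<bar>gauss_conv Q \<sigma> y\<bar> \<le> (\<integral>x. \<bar>exp (- (norm ((1 / \<sigma>) *\<^sub>R (y - x)))\<^sup>2 / 2)\<bar> \<partial>Q)"
    unfolding gauss_conv_def by (rule integral_abs_bound)
  also have "\<dots> \<le> (\<integral>x. 1 \<partial>Q)"
    by (intro integral_mono Q.integrable_const_bound[where B=1]) auto
  finally show "\<bar>gauss_conv Q \<sigma> y\<bar> \<le> 1" by (simp add: Q.prob_space)
  show "gauss_conv Q \<sigma> \<in> borel_measurable borel"
    unfolding gauss_conv_def[abs_def] by (rule Q.borel_measurable_lebesgue_integral) measurable
qed

text \<open>\<open>gauss_conv\<close> is bounded by 1 and converges pointwise, so Lebesgue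
  integrability of \<open>g\<close> is exactly what dominated convergence requires.\<close>

lemma smoothed_tendsto:
  fixes g :: "real^'d \<Rightarrow> real"
  assumes g: "integrable lborel g" and \<sigma>: "\<sigma> > 0"
  shows "(\<lambda>n. \<integral>x. (\<integral>z. g (x + \<sigma> *\<^sub>R z) \<partial>std_gauss) \<partial>N n) \<longlonglongrightarrow> (\<integral>x. (\<integral>z. g (x + \<sigma> *\<^sub>R z) \<partial>std_gauss) \<partial>P)"
  unfolding gauss_conv_integral[OF N \<sigma> g] gauss_conv_integral[OF P \<sigma> g]
proof (intro tendsto_mult tendsto_const integral_dominated_convergence[where w="\<lambda>y. \<bar>g y\<bar>"])
  have [measurable]: "g \<in> borel_measurable borel" using g by auto
  note [measurable] = gauss_conv_bounds(2)[OF N] gauss_conv_bounds(2)[OF P]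
  show "(\<lambda>y. g y * gauss_conv P \<sigma> y) \<in> borel_measurable lborel" by measurable
  show "(\<lambda>y. g y * gauss_conv (N n) \<sigma> y) \<in> borel_measurable lborel" for n by measurable
  show "integrable lborel (\<lambda>y. \<bar>g y\<bar>)" using g by simp
  show "AE y in lborel. (\<lambda>n. g y * gauss_conv (N n) \<sigma> y) \<longlonglongrightarrow> g y * gauss_conv P \<sigma> y"
    by (intro AE_I2 tendsto_mult tendsto_const gauss_conv_tendsto)
  show "AE y in lborel. norm (g y * gauss_conv (N n) \<sigma> y) \<le> \<bar>g y\<bar>" for n
    using gauss_conv_bounds(1)[OF N] by (intro AE_I2) (simp add: abs_mult mult_left_le)
qed

text \<open>Beyond a large radius \<open>m\<close> the Gaussian mass is negligible; within it the
  displacement is short enough for uniform continuity.\<close>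

lemma smoothing_error:
  fixes g :: "real^'d \<Rightarrow> real"
  assumes uc: "uniformly_continuous_on UNIV g" and B: "\<And>x. \<bar>g x\<bar> \<le> B" and \<epsilon>: "\<epsilon> > 0"
  obtains \<sigma> where "\<sigma> > 0" "\<And>x. \<bar>(\<integral>z. g (x + \<sigma> *\<^sub>R z) \<partial>std_gauss) - g x\<bar> \<le> \<epsilon>"
proof -
  interpret G: prob_space "std_gauss :: (real^'d) measure" by (rule prob_space_std_gauss)
  have [measurable]: "g \<in> borel_measurable borel"
    using uniformly_continuous_imp_continuous[OF uc] by (rule borel_measurable_continuous_onI)
  have G1: "measure (std_gauss :: (real^'d) measure) UNIV = 1" using G.prob_space by simp
  obtain d where d: "d > 0" "\<And>x y. dist y x < d \<Longrightarrow> dist (g y) (g x) < \<epsilon> / 2"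
    using uc \<epsilon> unfolding uniformly_continuous_on_def by (metis UNIV_I half_gt_zero)
  let ?A = "\<lambda>m::nat. {z :: real^'d. real m \<le> norm z}"
  have "(\<lambda>m. measure std_gauss (?A m)) \<longlonglongrightarrow> measure std_gauss (\<Inter>m. ?A m)"
    by (rule G.finite_Lim_measure_decseq) (auto simp: decseq_def)
  moreover have "(\<Inter>m. ?A m) = {}"
  proof -
    have "\<exists>m::nat. \<not> real m \<le> norm z" for z :: "real^'d" using reals_Archimedean2[of "norm z"] by (auto simp: not_le)
    then show ?thesis by auto
  qed
  ultimately have "(\<lambda>m. measure std_gauss (?A m)) \<longlonglongrightarrow> 0" by simp
  then have "(\<lambda>m. 2 * B * measure std_gauss (?A m)) \<longlonglongrightarrow> 2 * B * 0" by (intro tendsto_intros)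
  then have "\<forall>\<^sub>F m in sequentially. 2 * B * measure std_gauss (?A m) < \<epsilon> / 2"
    using \<epsilon> by (intro order_tendstoD(2)) auto
  from eventually_happens'[OF sequentially_bot eventually_conj[OF this eventually_ge_at_top[of 1]]]
  obtain m :: nat where m: "m \<ge> 1" "2 * B * measure std_gauss (?A m) < \<epsilon> / 2" by blast
  \<comment> \<open>For \<open>norm z < m\<close> the displacement
    \<open>\<sigma> *\<^sub>R z\<close> is then shorter than \<open>d\<close>.\<close>
  define \<sigma> where "\<sigma> = d / real m"
  have \<sigma>: "\<sigma> > 0" using d(1) m(1) by (simp add: \<sigma>_def)
  show ?thesis
  proof (rule that[OF \<sigma>])
    fix x
    have gi: "integrable std_gauss (\<lambda>z. g (x + \<sigma> *\<^sub>R z))"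
      by (rule G.integrable_const_bound[where B=B]) (use B in auto)
    have pt: "\<bar>g (x + \<sigma> *\<^sub>R z) - g x\<bar> \<le> \<epsilon> / 2 + 2 * B * indicator (?A m) z" for z
    proof (cases "z \<in> ?A m")
      case True
      then show ?thesis using B[of "x + \<sigma> *\<^sub>R z"] B[of x] \<epsilon> by simp
    next
      case False
      then have "dist (x + \<sigma> *\<^sub>R z) x < d" using d(1) m(1) by (simp add: dist_norm \<sigma>_def field_simps)
      from d(2)[OF this] show ?thesis using False by (simp add: dist_real_def)
    qed
    have "(\<integral>z. g (x + \<sigma> *\<^sub>R z) \<partial>std_gauss) - g x = (\<integral>z. g (x + \<sigma> *\<^sub>R z) - g x \<partial>std_gauss)"
      using gi G1 by simp
    also have "\<bar>\<dots>\<bar> \<le> (\<integral>z. \<bar>g (x + \<sigma> *\<^sub>R z) - g x\<bar> \<partial>std_gauss)" by (rule integral_abs_bound)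
    also have "\<dots> \<le> (\<integral>z. \<epsilon> / 2 + 2 * B * indicator (?A m) z \<partial>std_gauss)"
      using gi by (intro integral_mono pt integrable_abs) (auto simp: G.emeasure_finite less_top[symmetric])
    also have "\<dots> = \<epsilon> / 2 + 2 * B * measure std_gauss (?A m)"
      using G1 by (simp add: G.emeasure_finite less_top[symmetric])
    finally show "\<bar>(\<integral>z. g (x + \<sigma> *\<^sub>R z) \<partial>std_gauss) - g x\<bar> \<le> \<epsilon>" using m(2) by linarith
  qed
qed

lemma tendsto_uniformly_continuous:
  fixes g :: "real^'d \<Rightarrow> real"
  assumes uc: "uniformly_continuous_on UNIV g" and B: "\<And>x. \<bar>g x\<bar> \<le> B" and g: "integrable lborel g"
  shows "(\<lambda>n. \<integral>x. g x \<partial>N n) \<longlonglongrightarrow> (\<integral>x. g x \<partial>P)"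
proof (rule LIMSEQ_I)
  fix \<epsilon> :: real assume \<epsilon>: "\<epsilon> > 0"
  have [measurable]: "g \<in> borel_measurable borel" using g by auto
  obtain \<sigma> where \<sigma>: "\<sigma> > 0" "\<And>x. \<bar>(\<integral>z. g (x + \<sigma> *\<^sub>R z) \<partial>std_gauss) - g x\<bar> \<le> \<epsilon> / 3"
    using smoothing_error[OF uc B, of "\<epsilon> / 3"] \<epsilon> by auto
  define h where "h x = (\<integral>z. g (x + \<sigma> *\<^sub>R z) \<partial>std_gauss)" for x
  interpret G: prob_space "std_gauss :: (real^'d) measure" by (rule prob_space_std_gauss)
  have h_meas [measurable]: "h \<in> borel_measurable borel"
    unfolding h_def[abs_def] by (rule G.borel_measurable_lebesgue_integral) measurable
  have hB: "\<bar>h x\<bar> \<le> B + \<epsilon> / 3" for x using \<sigma>(2)[of x] B[of x] unfolding h_def by linarith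
  have close: "\<bar>(\<integral>x. h x \<partial>Q) - (\<integral>x. g x \<partial>Q)\<bar> \<le> \<epsilon> / 3" if Q: "prob_space Q" "sets Q = sets (borel :: (real^'d) measure)" for Q
  proof -
    interpret Q: prob_space Q by (rule Q)
    note Q(2)[measurable_cong]
    have hi: "integrable Q h" by (rule Q.integrable_const_bound[where B="B + \<epsilon> / 3"]) (use hB in auto)
    have gi: "integrable Q g" by (rule Q.integrable_const_bound[where B=B]) (use B in auto)
    have "(\<integral>x. h x \<partial>Q) - (\<integral>x. g x \<partial>Q) = (\<integral>x. h x - g x \<partial>Q)" using hi gi by simp
    also have "\<bar>\<dots>\<bar> \<le> (\<integral>x. \<bar>h x - g x\<bar> \<partial>Q)" by (rule integral_abs_bound)
    also have "\<dots> \<le> (\<integral>x. \<epsilon> / 3 \<partial>Q)" 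
    proof (intro integral_mono integrable_abs)
      show "\<bar>h x - g x\<bar> \<le> \<epsilon> / 3" for x unfolding h_def by (rule \<sigma>(2))
    qed (use hi gi in simp_all)
    finally show ?thesis by (simp add: Q.prob_space)
  qed
  have "(\<lambda>n. \<integral>x. h x \<partial>N n) \<longlonglongrightarrow> (\<integral>x. h x \<partial>P)"
    unfolding h_def by (rule smoothed_tendsto[OF g \<sigma>(1)])
  then obtain n0 where n0: "\<And>n. n \<ge> n0 \<Longrightarrow> \<bar>(\<integral>x. h x \<partial>N n) - (\<integral>x. h x \<partial>P)\<bar> < \<epsilon> / 3"
    using LIMSEQ_D[of _ _ "\<epsilon> / 3"] \<epsilon> by (metis divide_pos_pos real_norm_def zero_less_numeral)
  show "\<exists>n0. \<forall>n\<ge>n0. norm ((\<integral>x. g x \<partial>N n) - (\<integral>x. g x \<partial>P)) < \<epsilon>"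
  proof (intro exI allI impI)
    fix n assume "n \<ge> n0"
    from n0[OF this] close[OF N, of n] close[OF P]
    show "norm ((\<integral>x. g x \<partial>N n) - (\<integral>x. g x \<partial>P)) < \<epsilon>" unfolding real_norm_def by linarith
  qed
qed

lemma tendsto_compact_support:
  fixes g :: "real^'d \<Rightarrow> real"
  assumes c: "continuous_on UNIV g" and supp: "\<And>x. norm x > R \<Longrightarrow> g x = 0"
  shows "(\<lambda>n. \<integral>x. g x \<partial>N n) \<longlonglongrightarrow> (\<integral>x. g x \<partial>P)"
proof -
  \<comment> \<open>The margin 1 matters for uniform continuity: of two points less than 1 apart,
    either both lie in this ball or both lie outside the radius \<open>R\<close>, where
    \<open>g\<close> vanishes.\<close>
  let ?S = "cball (0 :: real^'d) (R + 1)"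
  have cS: "continuous_on ?S g" using c continuous_on_subset by blast
  have "compact (g ` ?S)" by (rule compact_continuous_image[OF cS]) simp
  then obtain B where "\<forall>y\<in>g ` ?S. norm y \<le> B" using compact_imp_bounded bounded_iff by blast
  then have B: "\<And>x. x \<in> ?S \<Longrightarrow> \<bar>g x\<bar> \<le> B" by simp
  have out: "g x = 0" if "x \<notin> ?S" for x using that supp[of x] by simp
  have bd: "\<bar>g x\<bar> \<le> max B 0" for x using B[of x] out[of x] by (cases "x \<in> ?S") auto
  have "integrable lborel (\<lambda>x. indicator ?S x *\<^sub>R g x)" by (rule borel_integrable_compact) (use cS in auto)
  moreover have "(\<lambda>x. indicator ?S x *\<^sub>R g x) = g"
  proof
    show "indicator ?S x *\<^sub>R g x = g x" for x using out[of x] by (cases "x \<in> ?S") auto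
  qed
  ultimately have int: "integrable lborel g" by simp
  have ucS: "uniformly_continuous_on ?S g" by (rule compact_uniformly_continuous[OF cS]) simp
  have "uniformly_continuous_on UNIV g"
    unfolding uniformly_continuous_on_def
  proof (intro allI impI)
    fix e :: real assume "e > 0"
    then obtain d where d: "d > 0" "\<And>x y. x \<in> ?S \<Longrightarrow> y \<in> ?S \<Longrightarrow> dist y x < d \<Longrightarrow> dist (g y) (g x) < e"
      using ucS unfolding uniformly_continuous_on_def by metis
    have "dist (g y) (g x) < e" if "dist y x < min d 1" for x y
    proof (cases "x \<in> ?S \<and> y \<in> ?S")
      case True then show ?thesis using d(2) that by simp
    next
      case False
      have "norm y \<le> norm x + dist y x" "norm x \<le> norm y + dist y x"
        using norm_triangle_ineq2[of x y] norm_triangle_ineq2[of y x] by (auto simp: dist_norm norm_minus_commute)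
      then have "norm x > R" "norm y > R" using False that by auto
      then show ?thesis using supp \<open>e > 0\<close> by simp
    qed
    then show "\<exists>d>0. \<forall>x\<in>UNIV. \<forall>x'\<in>UNIV. dist x' x < d \<longrightarrow> dist (g x') (g x) < e"
      using d(1) by (intro exI[of _ "min d 1"]) auto
  qed
  from tendsto_uniformly_continuous[OF this bd int] show ?thesis .
qed

text \<open>Tightness is inherited from the limit: a cutoff that keeps most of the mass of
  \<open>P\<close> is itself a compactly supported test function, so it keeps most of the mass of
  \<open>N n\<close> for large \<open>n\<close>.\<close>

theorem tendsto_bounded_continuous:
  fixes g :: "real^'d \<Rightarrow> real"
  assumes c: "continuous_on UNIV g" and bdd: "bounded (range g)"
  shows "(\<lambda>n. \<integral>x. g x \<partial>N n) \<longlonglongrightarrow> (\<integral>x. g x \<partial>P)"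
proof (rule LIMSEQ_I)
  fix \<epsilon> :: real assume \<epsilon>: "\<epsilon> > 0"
  interpret P: prob_space P by (rule P)
  note P(2)[measurable_cong]
  obtain B0 where B0: "\<And>x. \<bar>g x\<bar> \<le> B0" using bdd by (auto simp: bounded_iff)
  \<comment> \<open>The added 1 makes the bound positive, hence a legitimate divisor.\<close>
  define B where "B = B0 + 1"
  have B: "\<bar>g x\<bar> \<le> B" and Bpos: "B > 0" for x using B0[of x] by (auto simp: B_def)
  have [measurable]: "g \<in> borel_measurable borel" using c by (rule borel_measurable_continuous_onI)
  define cut where "cut m x = max 0 (min 1 (real m + 1 - norm (x :: real^'d)))" for m :: nat and x
  have cutc: "continuous_on UNIV (cut m)" for m unfolding cut_def[abs_def] by (intro continuous_intros)
  have [measurable]: "cut m \<in> borel_measurable borel" for m using cutc by (rule borel_measurable_continuous_onI)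
  have cut01: "0 \<le> cut m x" "cut m x \<le> 1" for m x by (auto simp: cut_def)
  have cut0: "cut m x = 0" if "norm x > real m + 1" for m x using that by (auto simp: cut_def)
  have "(\<lambda>m. \<integral>x. cut m x \<partial>P) \<longlonglongrightarrow> (\<integral>x. 1 \<partial>P)"
  proof (rule integral_dominated_convergence[where w="\<lambda>_. 1"])
    show "AE x in P. (\<lambda>m. cut m x) \<longlonglongrightarrow> 1"
    proof (intro AE_I2 tendsto_eventually)
      fix x :: "real^'d"
      show "\<forall>\<^sub>F m in sequentially. cut m x = 1"
        using eventually_ge_at_top[of "nat \<lceil>norm x\<rceil>"] 
      proof eventually_elim
        fix m assume "nat \<lceil>norm x\<rceil> \<le> m"
        then have "norm x \<le> real m" by linarith
        then show "cut m x = 1" by (simp add: cut_def)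
      qed
    qed
  qed (use cut01 in auto)
  \<comment> \<open>The two tails will cost \<open>\<epsilon> / 6\<close> each and the truncated
    integrals \<open>\<epsilon> / 2\<close>, altogether less than \<open>\<epsilon>\<close>.\<close>
  then have "\<forall>\<^sub>F m in sequentially. 1 - \<epsilon> / (6 * B) < (\<integral>x. cut m x \<partial>P)"
    using \<epsilon> Bpos by (intro order_tendstoD(1)) (auto simp: P.prob_space)
  then obtain m where m: "1 - \<epsilon> / (6 * B) < (\<integral>x. cut m x \<partial>P)" by (auto simp: eventually_sequentially)
  have tail: "\<bar>(\<integral>x. g x \<partial>Q) - (\<integral>x. g x * cut m x \<partial>Q)\<bar> \<le> B * (1 - (\<integral>x. cut m x \<partial>Q))"
    if Q: "prob_space Q" "sets Q = sets (borel :: (real^'d) measure)" for Q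
  proof -
    interpret Q: prob_space Q by (rule Q)
    note Q(2)[measurable_cong]
    have i: "integrable Q g" "integrable Q (cut m)" "integrable Q (\<lambda>x. g x * cut m x)"
    proof -
      show "integrable Q g" by (rule Q.integrable_const_bound[where B=B]) (use B in auto)
      show "integrable Q (cut m)" by (rule Q.integrable_const_bound[where B=1]) (use cut01 in auto)
      show "integrable Q (\<lambda>x. g x * cut m x)"
        by (rule Q.integrable_const_bound[where B="B * 1"])
          (use B cut01 Bpos in \<open>auto simp only: real_norm_def abs_mult abs_of_nonneg intro!: AE_I2 mult_mono, auto\<close>)
    qed
    have "(\<integral>x. g x \<partial>Q) - (\<integral>x. g x * cut m x \<partial>Q) = (\<integral>x. g x - g x * cut m x \<partial>Q)" using i by simp
    also have "\<bar>\<dots>\<bar> \<le> (\<integral>x. \<bar>g x - g x * cut m x\<bar> \<partial>Q)" by (rule integral_abs_bound)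
    also have "\<dots> \<le> (\<integral>x. B * (1 - cut m x) \<partial>Q)"
    proof (intro integral_mono integrable_abs)
      fix x
      have "\<bar>g x - g x * cut m x\<bar> = \<bar>g x\<bar> * (1 - cut m x)"
      proof -
        have "g x - g x * cut m x = g x * (1 - cut m x)" by (simp add: algebra_simps)
        then show ?thesis using cut01[of m x] by (simp add: abs_mult)
      qed
      also have "\<dots> \<le> B * (1 - cut m x)" using B[of x] cut01[of m x] by (intro mult_right_mono) auto
      finally show "\<bar>g x - g x * cut m x\<bar> \<le> B * (1 - cut m x)" .
    qed (use i in auto)
    also have "\<dots> = B * (1 - (\<integral>x. cut m x \<partial>Q))" using i by (simp add: Q.prob_space)
    finally show ?thesis .
  qed
  have 1: "(\<lambda>n. \<integral>x. g x * cut m x \<partial>N n) \<longlonglongrightarrow> (\<integral>x. g x * cut m x \<partial>P)"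
    by (rule tendsto_compact_support[where R="real m + 1"]) (auto intro!: continuous_intros c cutc simp: cut0)
  have 2: "(\<lambda>n. \<integral>x. cut m x \<partial>N n) \<longlonglongrightarrow> (\<integral>x. cut m x \<partial>P)"
    by (rule tendsto_compact_support[where R="real m + 1"]) (auto intro!: cutc simp: cut0)
  have "\<forall>\<^sub>F n in sequentially. 1 - \<epsilon> / (6 * B) < (\<integral>x. cut m x \<partial>N n)"
    by (rule order_tendstoD(1)[OF 2 m])
  moreover have "\<forall>\<^sub>F n in sequentially. dist (\<integral>x. g x * cut m x \<partial>N n) (\<integral>x. g x * cut m x \<partial>P) < \<epsilon> / 2"
    using 1 \<epsilon> by (intro tendstoD) auto
  ultimately have "\<forall>\<^sub>F n in sequentially. norm ((\<integral>x. g x \<partial>N n) - (\<integral>x. g x \<partial>P)) < \<epsilon>"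
  proof eventually_elim
    fix n
    assume a: "1 - \<epsilon> / (6 * B) < (\<integral>x. cut m x \<partial>N n)" "dist (\<integral>x. g x * cut m x \<partial>N n) (\<integral>x. g x * cut m x \<partial>P) < \<epsilon> / 2"
    have t: "B * (1 - u) < \<epsilon> / 6" if "1 - \<epsilon> / (6 * B) < u" for u
    proof -
      have "B * (1 - u) < B * (\<epsilon> / (6 * B))" using that Bpos by (intro mult_strict_left_mono) auto
      then show ?thesis using Bpos by simp
    qed
    show "norm ((\<integral>x. g x \<partial>N n) - (\<integral>x. g x \<partial>P)) < \<epsilon>"
      using a(2) t[OF a(1)] t[OF m] tail[OF N, of n] tail[OF P] \<epsilon> unfolding real_norm_def dist_real_def by linarith
  qed
  then show "\<exists>n0. \<forall>n\<ge>n0. norm ((\<integral>x. g x \<partial>N n) - (\<integral>x. g x \<partial>P)) < \<epsilon>"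
    by (simp add: eventually_sequentially)
qed

end

section \<open>Score and Fisher information\<close>

text \<open>Turns coordinates into a displacement with symmetric scatter part, an off-diagonal
  coordinate moving both matching entries as in \<open>score\<close>. On displacements with
  symmetric scatter part it undoes \<open>direction\<close>.\<close>

definition embed :: "'k::{finite,linorder} coord rvec \<Rightarrow> 'k param" where
  "embed s = ((\<chi> i. s $ Inl i), unvech (\<chi> p. s $ Inr (Inl p)), s $ Inr (Inr ()))"

lemma unvech_linear: "unvech (a + b) = unvech a + unvech b" "unvech (r *\<^sub>R a) = r *\<^sub>R unvech a"
  by (simp_all add: unvech_def vec_eq_iff)

lemma linear_embed: "linear embed"
  by (rule linearI) (simp_all add: embed_def vec_eq_iff unvech_def)

lemma embed_sym: "transpose (scat (embed s)) = scat (embed s)"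
  by (simp add: embed_def transpose_unvech)

lemma embed_direction:
  assumes "transpose (scat \<tau>) = scat \<tau>"
  shows "embed (direction \<tau>) = \<tau>"
proof -
  obtain a B c where t: "\<tau> = (a, B, c)" by (cases \<tau>)
  have "(\<chi> p. vech B $ p) = vech B" by (simp add: vec_eq_iff)
  then show ?thesis using unvech_vech[of B] assms by (simp add: t embed_def stack_def vec_eq_iff)
qed

lemma embed_eq_0: "embed s = 0 \<Longrightarrow> s = 0"
proof -
  assume e: "embed s = 0"
  then have u: "unvech (\<chi> p. s $ Inr (Inl p)) = 0" by (simp add: embed_def zero_prod_def)
  have "(\<chi> p. s $ Inr (Inl p)) = vech 0" using vech_unvech[of "\<chi> p. s $ Inr (Inl p)"] unfolding u by simp
  then have "s $ Inr (Inl p) = 0" for p by (simp add: vech_def vec_eq_iff)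
  moreover have "s $ Inl i = 0" "s $ Inr (Inr u) = 0" for i u
    using e by (simp_all add: embed_def zero_prod_def vec_eq_iff)
  ultimately have "s $ d = 0" for d
  proof (cases d)
    case (Inr e)
    then show ?thesis using \<open>\<And>p. s $ Inr (Inl p) = 0\<close> \<open>\<And>u. s $ Inr (Inr u) = 0\<close> by (cases e) auto
  qed simp
  then show "s = 0" by (simp add: vec_eq_iff)
qed

context student_nbhd
begin

text \<open>Near \<open>V\<close> positive definiteness and positive degrees of freedom come for
  free. Hence \<open>U\<close> is relatively open among the parameters with symmetric scatter part,
  and short symmetric displacements do not leave it.\<close>

lemma U_iff: "\<theta> \<in> U \<longleftrightarrow> transpose (scat \<theta>) = scat \<theta> \<and> norm (\<theta> - V) < \<delta>"
proof
  assume "\<theta> \<in> U" then show "transpose (scat \<theta>) = scat \<theta> \<and> norm (\<theta> - V) < \<delta>"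
    using spd_symmetric[OF U_spd] U_near by blast
next
  assume a: "transpose (scat \<theta>) = scat \<theta> \<and> norm (\<theta> - V) < \<delta>"
  have "0 < x \<bullet> (scat \<theta> *v x)" if "x \<noteq> 0" for x
  proof -
    have "0 < c / 2 * (norm x)\<^sup>2" using that c_pos by simp
    also have "\<dots> \<le> x \<bullet> (scat \<theta> *v x)"
      using spd_nearby[OF coercive, of "scat \<theta>" "c / 2" x] norm_scat_le[of "\<theta> - V"] a \<delta>(3) by simp
    finally show ?thesis .
  qed
  moreover have "\<bar>dof \<theta> - dof V\<bar> < \<delta>" using abs_dof_le[of "\<theta> - V"] a by simp
  then have "dof \<theta> > 0" using \<delta>(4) dofV by linarith
  ultimately show "\<theta> \<in> U" using a unfolding pball_def by (auto intro!: param_spaceI simp: spd_def)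
qed

lemma V_in_U: "V \<in> U"
  using V \<delta> by (simp add: pball_def)

lemma eventually_U:
  assumes "\<theta> \<in> U" "transpose (scat h) = scat h"
  shows "\<forall>\<^sub>F t in nhds 0. \<theta> + t *\<^sub>R h \<in> U"
proof -
  have "((\<lambda>t. norm (\<theta> + t *\<^sub>R h - V)) \<longlongrightarrow> norm (\<theta> + 0 *\<^sub>R h - V)) (nhds 0)"
    by (intro tendsto_intros) (simp_all add: filterlim_ident)
  then have "\<forall>\<^sub>F t in nhds 0. norm (\<theta> + t *\<^sub>R h - V) < \<delta>"
    by (rule order_tendstoD(2)) (use assms U_near in simp)
  then show ?thesis
  proof eventually_elim
    case (elim t)
    have "transpose (scat \<theta> + t *\<^sub>R scat h) = scat \<theta> + t *\<^sub>R scat h"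
      using assms U_iff[of \<theta>] by (simp add: transpose_def vec_eq_iff)
    then show ?case using elim U_iff by simp
  qed
qed

section \<open>Uniform exponential moments and continuity in the observation\<close>

text \<open>The tail shape of a Student density with half the degrees of freedom of
  \<open>V\<close>; up to a constant it dominates all densities in \<open>U\<close>.\<close>

definition envelope :: "'k rvec \<Rightarrow> real" where
  "envelope x = sq1 x powr (- (dof V / 2 + real CARD('k)) / 2)"

lemma sq1_measurable [measurable]: "sq1 \<in> borel_measurable borel" "logw \<in> borel_measurable borel"
  unfolding sq1_def[abs_def] logw_def[abs_def] by measurable

lemma exp_logw: "exp (a * logw x) = exp a * sq1 x powr a"
  using sq1_ge[of x] by (simp add: logw_def powr_def exp_add distrib_left)

text \<open>The exponential contributes \<open>sq1\<close> to the power \<open>dof V / 8\<close>,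
  which lifts the exponent of the envelope to -(\<open>dof V / 8\<close> + k/2). This is still an
  integrable Student kernel; any rate below \<open>dof V / 4\<close> would do.\<close>

lemma envelope_exp:
  obtains I where "integrable lborel (\<lambda>x. envelope x * exp (dof V / 8 * logw x))" "I \<ge> 0"
    "(\<integral>x. envelope x * exp (dof V / 8 * logw x) \<partial>lborel) \<le> I"
proof -
  let ?a = "dof V / 8 + real CARD('k) / 2"
  have eq: "envelope x * exp (dof V / 8 * logw x) = exp (dof V / 8) * (1 + (norm x)\<^sup>2 / 1) powr (- ?a)" for x
  proof -
    have "- (dof V / 2 + real CARD('k)) / 2 + dof V / 8 = - ?a" by (simp add: field_simps)
    then have e: "sq1 x powr (- (dof V / 2 + real CARD('k)) / 2) * sq1 x powr (dof V / 8) = sq1 x powr (- ?a)"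
      unfolding powr_add[symmetric] by (simp only:)
    have "envelope x * exp (dof V / 8 * logw x)
      = exp (dof V / 8) * (sq1 x powr (- (dof V / 2 + real CARD('k)) / 2) * sq1 x powr (dof V / 8))"
      unfolding envelope_def exp_logw by (rule mult.left_commute)
    then show ?thesis unfolding e by (simp only: sq1_def div_by_1)
  qed
  have "(\<integral>\<^sup>+x. ennreal ((1 + (norm (x::'k rvec))\<^sup>2 / 1) powr (- ?a)) \<partial>lborel) < \<infinity>"
    using dofV by (subst nn_integral_student_kernel) auto
  then have "integrable lborel (\<lambda>x::'k rvec. (1 + (norm x)\<^sup>2 / 1) powr (- ?a))"
    by (intro integrableI_bounded) auto
  then have int: "integrable lborel (\<lambda>x. envelope x * exp (dof V / 8 * logw x))"
    unfolding eq by (rule integrable_mult_right)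
  show ?thesis
    by (rule that[OF int _ order_refl]) (simp add: envelope_def)
qed

lemma student_integral:
  fixes f :: "'k rvec \<Rightarrow> real"
  assumes "\<theta> \<in> U" and [measurable]: "f \<in> borel_measurable borel"
  shows "integrable (student_t \<theta>) f \<longleftrightarrow> integrable lborel (\<lambda>x. student_density \<theta> x * f x)"
    "(\<integral>x. f x \<partial>student_t \<theta>) = (\<integral>x. student_density \<theta> x * f x \<partial>lborel)"
  unfolding student_t_def using student_density_pos[OF U_param[OF assms(1)]]
  by (simp_all add: integrable_density integral_density less_imp_le)

lemma exp_moment_student:
  obtains K where "\<And>\<theta>. \<theta> \<in> U \<Longrightarrow> exp_moment (student_t \<theta>) logw (dof V / 8) K"
proof -
  obtain C where C: "C > 0" "\<And>\<theta> x. \<theta> \<in> U \<Longrightarrow> student_density \<theta> x \<le> C * envelope x"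
    using density_bound unfolding envelope_def by metis
  obtain I where I: "integrable lborel (\<lambda>x. envelope x * exp (dof V / 8 * logw x))" "I \<ge> 0"
    "(\<integral>x. envelope x * exp (dof V / 8 * logw x) \<partial>lborel) \<le> I" using envelope_exp by metis
  show ?thesis
  proof (rule that[of "C * I"])
    fix \<theta> assume U: "\<theta> \<in> U"
    have le: "student_density \<theta> x * exp (dof V / 8 * logw x) \<le> C * (envelope x * exp (dof V / 8 * logw x))" for x
      using mult_right_mono[OF C(2)[OF U, of x], of "exp (dof V / 8 * logw x)"] by (simp add: mult.assoc)
    have int: "integrable lborel (\<lambda>x. student_density \<theta> x * exp (dof V / 8 * logw x))"
    proof (rule Bochner_Integration.integrable_bound[OF integrable_mult_right[OF I(1), of C]])
      show "AE x in lborel. norm (student_density \<theta> x * exp (dof V / 8 * logw x)) \<le> norm (C * (envelope x * exp (dof V / 8 * logw x)))"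
      proof (intro AE_I2)
        fix x
        have "0 \<le> student_density \<theta> x * exp (dof V / 8 * logw x)"
          using student_density_pos[OF U_param[OF U], of x] by simp
        then show "norm (student_density \<theta> x * exp (dof V / 8 * logw x)) \<le> norm (C * (envelope x * exp (dof V / 8 * logw x)))"
          using le[of x] unfolding real_norm_def by linarith
      qed
    qed measurable
    interpret prob_space "student_t \<theta>" by (rule prob_space_student_t[OF U_param[OF U]])
    have "(\<integral>x. student_density \<theta> x * exp (dof V / 8 * logw x) \<partial>lborel) \<le> (\<integral>x. C * (envelope x * exp (dof V / 8 * logw x)) \<partial>lborel)"
      by (intro integral_mono int integrable_mult_right I le)
    also have "\<dots> \<le> C * I" using I(3) C(1) by simp
    finally show "exp_moment (student_t \<theta>) logw (dof V / 8) (C * I)"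
      using int dofV student_integral[OF U, of "\<lambda>x. exp (dof V / 8 * logw x)"]
      by unfold_locales (auto simp: logw_ge)
  qed
qed

lemma density_ratio_integral:
  assumes U: "\<theta> \<in> U" "\<theta>' \<in> U"
  shows "(\<integral>x. exp (ln (student_density \<theta>' x) - ln (student_density \<theta> x)) \<partial>student_t \<theta>) = 1"
proof -
  note pos = student_density_pos[OF U_param[OF U(1)]] student_density_pos[OF U_param[OF U(2)]]
  have "(\<integral>x. exp (ln (student_density \<theta>' x) - ln (student_density \<theta> x)) \<partial>student_t \<theta>) = (\<integral>x. student_density \<theta>' x \<partial>lborel)"
    using pos by (subst student_integral(2)[OF U(1)]) (simp_all add: exp_diff less_imp_neq[THEN not_sym])
  also have "\<dots> = 1"
    using nn_integral_student_density[OF U_param[OF U(2)]] pos(2)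
    by (subst integral_eq_nn_integral) (auto simp: less_imp_le)
  finally show ?thesis .
qed

lemma whiten_continuous: "continuous_on UNIV (whiten \<theta>)"
  unfolding whiten_def[abs_def]
  by (intro continuous_on_compose2[OF linear_continuous_on[of "(*v) (matrix_inv (scat \<theta>))" UNIV]] continuous_intros) auto

lemma quad_continuous: "continuous_on UNIV (quad \<theta>)"
  unfolding quad_def[abs_def] by (intro continuous_intros whiten_continuous)

lemma dlog_continuous:
  assumes "\<theta> \<in> U"
  shows "continuous_on UNIV (\<lambda>x. dlog \<kappa> \<theta> x h)"
proof -
  have "continuous_on UNIV (\<lambda>x. scat h *v whiten \<theta> x)"
    by (rule continuous_on_compose2[OF linear_continuous_on[of "(*v) (scat h)" UNIV] whiten_continuous]) auto
  then have "continuous_on UNIV (\<lambda>x. dquad \<theta> x h)"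
    unfolding dquad_def by (intro continuous_intros whiten_continuous)
  moreover have "dof \<theta> + quad \<theta> x \<noteq> 0" for x using dof_quad_pos[OF assms, of x] by simp
  ultimately show ?thesis
    unfolding dlog_def by (intro continuous_intros quad_continuous) auto
qed

end

section \<open>The score as a directional derivative\<close>

text \<open>Bundles the weighted derivative, remainder and moment bounds with constants valid on all
  of \<open>U\<close>, undoing the division by \<open>logw\<close>.\<close>

locale student_score = student_nbhd V c \<delta> for V :: "'k::{finite,linorder} param" and c \<delta> +
  fixes \<kappa> :: "'k param \<Rightarrow> 'k param \<Rightarrow> real" and C K :: real
  assumes C: "C \<ge> 0"
    and dlog_linear: "\<And>\<theta> x. \<theta> \<in> U \<Longrightarrow> linear (dlog \<kappa> \<theta> x)"
    and dlog_le: "\<And>\<theta> x h. \<theta> \<in> U \<Longrightarrow> \<bar>dlog \<kappa> \<theta> x h\<bar> \<le> C * norm h * logw x"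
    and remainder: "\<And>\<theta> \<theta>' x. \<theta> \<in> U \<Longrightarrow> \<theta>' \<in> U \<Longrightarrow>
      \<bar>ln (student_density \<theta>' x) - ln (student_density \<theta> x) - dlog \<kappa> \<theta> x (\<theta>' - \<theta>)\<bar> \<le> C * (norm (\<theta>' - \<theta>))\<^sup>2 * logw x"
    and moments: "\<And>\<theta>. \<theta> \<in> U \<Longrightarrow> exp_moment (student_t \<theta>) logw (dof V / 8) K"

lemma student_score_exists:
  fixes V :: "'k::{finite,linorder} param"
  assumes V: "V \<in> param_space"
  obtains c \<delta> \<kappa> C K where "student_score V c \<delta> \<kappa> C K"
proof -
  obtain c where c: "c > 0" "\<And>x. c * (norm x)\<^sup>2 \<le> x \<bullet> (scat V *v x)"
    using spd_coercive[OF param_space_scat[OF V]] by metis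
  define \<delta> where "\<delta> = min (1 / 2) (min (c / 2) (dof V / 2))"
  interpret student_nbhd V c \<delta>
    using V c param_space_dof[OF V] by unfold_locales (auto simp: \<delta>_def)
  obtain \<kappa> where \<kappa>: "c11 U (\<lambda>\<theta> x. ln (student_density \<theta> x) / logw x) (\<lambda>\<theta> x h. dlog \<kappa> \<theta> x h / logw x)"
    using c11_log_density by blast
  obtain C where C: "C \<ge> 0" "\<And>\<theta> x h. \<theta> \<in> U \<Longrightarrow> \<bar>dlog \<kappa> \<theta> x h / logw x\<bar> \<le> C * norm h"
    "\<And>\<theta> \<theta>' x. \<theta> \<in> U \<Longrightarrow> \<theta>' \<in> U \<Longrightarrow> \<bar>ln (student_density \<theta>' x) / logw x - ln (student_density \<theta> x) / logw x - dlog \<kappa> \<theta> x (\<theta>' - \<theta>) / logw x\<bar> \<le> C * (norm (\<theta>' - \<theta>))\<^sup>2"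
    using c11E[OF \<kappa>] by metis
  obtain K where K: "\<And>\<theta>. \<theta> \<in> U \<Longrightarrow> exp_moment (student_t \<theta>) logw (dof V / 8) K" using exp_moment_student by metis
  have lw: "logw x > 0" for x :: "'k rvec" using logw_ge[of x] by linarith
  have 1: "linear (dlog \<kappa> \<theta> x)" if U: "\<theta> \<in> U" for \<theta> and x :: "'k rvec"
  proof -
    interpret l: linear "\<lambda>h. dlog \<kappa> \<theta> x h / logw x" by (rule c11_linearD[OF \<kappa> U])
    show ?thesis
    proof (rule linearI)
      show "dlog \<kappa> \<theta> x (a + b) = dlog \<kappa> \<theta> x a + dlog \<kappa> \<theta> x b" for a b
        using l.add[of a b] lw[of x] by (simp add: divide_simps split: if_splits)
      show "dlog \<kappa> \<theta> x (r *\<^sub>R a) = r *\<^sub>R dlog \<kappa> \<theta> x a" for r a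
        using l.scale[of r a] lw[of x] by (simp add: divide_simps split: if_splits)
    qed
  qed
  have 2: "\<bar>dlog \<kappa> \<theta> x h\<bar> \<le> C * norm h * logw x" if U: "\<theta> \<in> U" for \<theta> x h
    using C(2)[OF U, of x h] lw[of x] by (simp add: abs_divide divide_le_eq)
  have 3: "\<bar>ln (student_density \<theta>' x) - ln (student_density \<theta> x) - dlog \<kappa> \<theta> x (\<theta>' - \<theta>)\<bar> \<le> C * (norm (\<theta>' - \<theta>))\<^sup>2 * logw x"
    if U: "\<theta> \<in> U" "\<theta>' \<in> U" for \<theta> \<theta>' x
    using C(3)[OF U, of x] lw[of x] unfolding diff_divide_distrib[symmetric] abs_divide by (simp add: divide_le_eq)
  have "student_score V c \<delta> \<kappa> C K"
    by (intro student_score.intro student_score_axioms.intro student_nbhd_axioms C(1) 1 2 3 K)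
  then show ?thesis by (rule that)
qed

context student_score
begin

text \<open>Symmetry of the direction keeps the path in \<open>U\<close> for small \<open>t\<close>,
  and there the remainder is quadratic in \<open>t\<close>. Off the symmetric matrices nothing is
  known about \<open>inv_sqrt\<close>, so no such path is considered.\<close>

lemma deriv_log_density:
  assumes U: "\<theta> \<in> U" and h: "transpose (scat h) = scat h"
  shows "((\<lambda>t. ln (student_density (\<theta> + t *\<^sub>R h) x)) has_real_derivative dlog \<kappa> \<theta> x h) (at 0)"
proof -
  let ?f = "\<lambda>t. ln (student_density (\<theta> + t *\<^sub>R h) x)"
  interpret l: linear "dlog \<kappa> \<theta> x" by (rule dlog_linear[OF U])
  have "\<forall>\<^sub>F t in at 0. \<theta> + t *\<^sub>R h \<in> U"
    using eventually_U[OF U h] by (simp add: eventually_nhds_conv_at)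
  then have "\<forall>\<^sub>F t in at 0. norm ((?f (0 + t) - ?f 0) / t - dlog \<kappa> \<theta> x h) \<le> C * (norm h)\<^sup>2 * logw x * \<bar>t\<bar>"
    using eventually_neq_at_within[of 0 0 UNIV]
  proof eventually_elim
    case (elim t)
    then have t: "t \<noteq> 0" by simp
    have "\<bar>?f t - ?f 0 - t * dlog \<kappa> \<theta> x h\<bar> \<le> C * (norm (t *\<^sub>R h))\<^sup>2 * logw x"
      using remainder[OF U elim(1), of x] by (simp add: l.scale)
    then have "\<bar>?f t - ?f 0 - t * dlog \<kappa> \<theta> x h\<bar> / \<bar>t\<bar> \<le> C * (norm (t *\<^sub>R h))\<^sup>2 * logw x / \<bar>t\<bar>"
      by (rule divide_right_mono) simp
    moreover have "(?f t - ?f 0) / t - dlog \<kappa> \<theta> x h = (?f t - ?f 0 - t * dlog \<kappa> \<theta> x h) / t"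
      using t by (simp add: diff_divide_distrib)
    ultimately show ?case using t by (simp add: abs_divide power_mult_distrib power2_eq_square mult_ac)
  qed
  moreover have "((\<lambda>t::real. C * (norm h)\<^sup>2 * logw x * \<bar>t\<bar>) \<longlongrightarrow> 0) (at 0)"
    by (auto intro!: tendsto_eq_intros)
  ultimately have "((\<lambda>t. (?f (0 + t) - ?f 0) / t - dlog \<kappa> \<theta> x h) \<longlongrightarrow> 0) (at 0)"
    by (rule Lim_null_comparison)
  then show ?thesis unfolding DERIV_def by (rule LIM_zero_cancel)
qed

text \<open>Links the coordinatewise \<open>score\<close> with the explicit functional
  \<open>dlog\<close>: each coordinate step is a straight path with symmetric scatter part, so the
  directional derivative applies.\<close>

lemma score_nth:
  assumes U: "\<theta> \<in> U"
  shows "score \<theta> x $ d = dlog \<kappa> \<theta> x (embed (axis d 1))"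
proof -
  obtain \<mu> \<Sigma> \<nu> where t: "\<theta> = (\<mu>, \<Sigma>, \<nu>)" by (cases \<theta>)
  have sym: "transpose \<Sigma> = \<Sigma>" using U_iff[of \<theta>] U by (simp add: t)
  have D: "deriv (\<lambda>t. ln (student_density (\<theta> + t *\<^sub>R embed s) x)) 0 = dlog \<kappa> \<theta> x (embed s)" for s
    by (rule DERIV_imp_deriv[OF deriv_log_density[OF U embed_sym]])
  consider (a) i where "d = Inl i" | (b) p where "d = Inr (Inl p)" | (c) "d = Inr (Inr ())"
    by (metis old.sum.exhaust old.unit.exhaust)
  then show ?thesis
  proof cases
    case a
    have "(\<chi> i'. axis d 1 $ Inl i') = (axis i 1 :: 'k rvec)" "(\<chi> p. axis d 1 $ Inr (Inl p)) = (0 :: 'k vech_index rvec)"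
       "(axis d 1 :: 'k coord rvec) $ Inr (Inr ()) = 0"
      by (simp_all add: a axis_def vec_eq_iff)
    moreover have "unvech 0 = (0 :: 'k rmat)" by (simp add: unvech_def vec_eq_iff)
    ultimately have "embed (axis d 1) = (axis i 1, 0, 0)" by (simp add: embed_def)
    then have "\<theta> + h *\<^sub>R embed (axis d 1) = (\<mu> + h *\<^sub>R axis i 1, \<Sigma>, \<nu>)" for h by (simp add: t)
    then show ?thesis using D[of "axis d 1"] by (simp add: a t stack_def grad_def)
  next
    case b
    have "(\<chi> i. axis d 1 $ Inl i) = (0 :: 'k rvec)" "(\<chi> p. axis d 1 $ Inr (Inl p)) = (axis p 1 :: 'k vech_index rvec)"
       "(axis d 1 :: 'k coord rvec) $ Inr (Inr ()) = 0"
      by (simp_all add: b axis_def vec_eq_iff)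
    then have "embed (axis d 1) = (0, unvech (axis p 1), 0)" by (simp add: embed_def)
    \<comment> \<open>Since \<open>unvech\<close> is linear and inverts \<open>vech\<close> on the
      symmetric \<open>\<Sigma>\<close>, a step in one vech coordinate is a step along a fixed
      symmetric matrix.\<close>
    then have "\<theta> + h *\<^sub>R embed (axis d 1) = (\<mu>, unvech (vech \<Sigma> + h *\<^sub>R axis p 1), \<nu>)" for h
      by (simp add: t unvech_linear unvech_vech[OF sym])
    then show ?thesis using D[of "axis d 1"] by (simp add: b t stack_def grad_def)
  next
    case c
    have "(\<chi> i. axis d 1 $ Inl i) = (0 :: 'k rvec)" "(\<chi> p. axis d 1 $ Inr (Inl p)) = (0 :: 'k vech_index rvec)"
       "(axis d 1 :: 'k coord rvec) $ Inr (Inr ()) = 1"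
      by (simp_all add: c axis_def vec_eq_iff)
    moreover have "unvech 0 = (0 :: 'k rmat)" by (simp add: unvech_def vec_eq_iff)
    ultimately have "embed (axis d 1) = (0, 0, 1)" by (simp add: embed_def)
    then have "\<theta> + h *\<^sub>R embed (axis d 1) = (\<mu>, \<Sigma>, h + \<nu>)" for h by (simp add: t add.commute)
    then have "((\<lambda>h. ln (student_density (\<mu>, \<Sigma>, h + \<nu>) x)) has_real_derivative dlog \<kappa> \<theta> x (embed (axis d 1))) (at 0)"
      using deriv_log_density[OF U embed_sym[of "axis d 1"], of x] by simp
    \<comment> \<open>The score differentiates at \<open>\<nu>\<close> itself rather than at
      displacement 0, hence the shift.\<close>
    then have "((\<lambda>v. ln (student_density (\<mu>, \<Sigma>, v) x)) has_real_derivative dlog \<kappa> \<theta> x (embed (axis d 1))) (at \<nu>)"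
      using DERIV_shift[of "\<lambda>v. ln (student_density (\<mu>, \<Sigma>, v) x)" _ 0 \<nu>] by simp
    from DERIV_imp_deriv[OF this] show ?thesis by (simp add: c t stack_def)
  qed
qed

lemma score_inner:
  assumes U: "\<theta> \<in> U"
  shows "s \<bullet> score \<theta> x = dlog \<kappa> \<theta> x (embed s)"
proof -
  have lin: "linear (\<lambda>s. dlog \<kappa> \<theta> x (embed s))"
    using linear_compose[OF linear_embed dlog_linear[OF U]] by (simp add: o_def)
  have "dlog \<kappa> \<theta> x (embed s) = dlog \<kappa> \<theta> x (embed (\<Sum>d\<in>UNIV. s $ d *s axis d 1))" by (simp only: basis_expansion)
  also have "\<dots> = (\<Sum>d\<in>UNIV. s $ d * dlog \<kappa> \<theta> x (embed (axis d 1)))"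
    unfolding scalar_mult_eq_scaleR linear_sum[OF lin] linear_scale[OF lin] by simp
  finally show ?thesis by (simp add: inner_vec_def score_nth[OF U])
qed

lemma score_measurable:
  assumes U: "\<theta> \<in> U"
  shows "score \<theta> \<in> borel_measurable borel"
proof -
  have "score \<theta> = (\<lambda>x. \<chi> d. dlog \<kappa> \<theta> x (embed (axis d 1)))"
    by (simp add: fun_eq_iff vec_eq_iff score_nth[OF U])
  moreover have "continuous_on UNIV (\<lambda>x. \<chi> d. dlog \<kappa> \<theta> x (embed (axis d 1)))"
    by (intro continuous_on_vec_lambda dlog_continuous U)
  ultimately show ?thesis by (simp add: borel_measurable_continuous_onI)
qed

lemma dlog_measurable: "\<theta> \<in> U \<Longrightarrow> (\<lambda>x. dlog \<kappa> \<theta> x h) \<in> borel_measurable borel"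
  by (intro borel_measurable_continuous_onI dlog_continuous)

lemma dlog_mean:
  assumes U: "\<theta> \<in> U" and h: "transpose (scat h) = scat h"
  shows "(\<integral>x. dlog \<kappa> \<theta> x h \<partial>student_t \<theta>) = 0"
proof -
  interpret E: exp_moment "student_t \<theta>" logw "dof V / 8" K by (rule moments[OF U])
  have "((\<lambda>m. 1 / real m) \<longlongrightarrow> 0) sequentially" by (rule lim_const_over_n)
  from filterlim_iff[THEN iffD1, OF this, rule_format, OF eventually_U[OF U h]]
  obtain m0 where m0: "\<And>m. m \<ge> m0 \<Longrightarrow> \<theta> + (1 / real m) *\<^sub>R h \<in> U" by (auto simp: eventually_sequentially)
  let ?r = "\<lambda>m x. ln (student_density (\<theta> + (1 / real m) *\<^sub>R h) x) - ln (student_density \<theta> x)"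
  \<comment> \<open>One constant for both the score bound and the remainder bound, as
    \<open>score_mean_zero\<close> expects.\<close>
  define B where "B = C * norm h + C * (norm h)\<^sup>2"
  have lw: "0 \<le> logw x" for x :: "'k rvec" using logw_ge[of x] by linarith
  have 1: "(\<lambda>x. dlog \<kappa> \<theta> x h) \<in> borel_measurable (student_t \<theta>)" using dlog_measurable[OF U] by simp
  have 2: "?r m \<in> borel_measurable (student_t \<theta>)" for m by measurable
  have 3: "\<bar>dlog \<kappa> \<theta> x h\<bar> \<le> B * logw x" for x
    using dlog_le[OF U, of x h] C lw[of x] by (simp add: B_def distrib_right add_increasing2)
  have 4: "0 \<le> B" using C by (simp add: B_def)
  have 5: "\<bar>?r m x - dlog \<kappa> \<theta> x h / real m\<bar> \<le> B * logw x / (real m)\<^sup>2" if "m \<ge> m0" for m x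
  proof -
    have "\<bar>?r m x - dlog \<kappa> \<theta> x h / real m\<bar> \<le> C * (norm h)\<^sup>2 * logw x / (real m)\<^sup>2"
      using remainder[OF U m0[OF that], of x] by (simp add: linear_scale[OF dlog_linear[OF U]] power_divide)
    also have "\<dots> \<le> B * logw x / (real m)\<^sup>2"
      using C lw[of x] by (intro divide_right_mono mult_right_mono) (auto simp: B_def)
    finally show ?thesis .
  qed
  have 6: "(\<integral>x. exp (?r m x) \<partial>student_t \<theta>) = 1" if "m \<ge> m0" for m
    by (rule density_ratio_integral[OF U m0[OF that]])
  show ?thesis by (rule E.score_mean_zero[OF 1 2 3 4 5 6])
qed

lemma dlog_product_integrable:
  assumes U: "\<theta> \<in> U"
  shows "integrable (student_t \<theta>) (\<lambda>x. dlog \<kappa> \<theta> x h * dlog \<kappa> \<theta> x h')"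
proof -
  interpret E: exp_moment "student_t \<theta>" logw "dof V / 8" K by (rule moments[OF U])
  note [measurable] = dlog_measurable[OF U]
  show ?thesis
  proof (rule E.dominated_power(1)[where B="(C * norm h) * (C * norm h')" and p=2])
    show "\<bar>dlog \<kappa> \<theta> x h * dlog \<kappa> \<theta> x h'\<bar> \<le> (C * norm h) * (C * norm h') * logw x ^ 2" for x
    proof -
      have "\<bar>dlog \<kappa> \<theta> x h * dlog \<kappa> \<theta> x h'\<bar> \<le> (C * norm h * logw x) * (C * norm h' * logw x)"
        unfolding abs_mult using C logw_ge[of x] by (intro mult_mono dlog_le U) auto
      then show ?thesis by (simp add: power2_eq_square mult_ac)
    qed
  qed (use C in auto)
qed

lemma fisher_nth:
  assumes U: "\<theta> \<in> U"
  shows "fisher_info \<theta> $ a $ b = (\<integral>x. dlog \<kappa> \<theta> x (embed (axis a 1)) * dlog \<kappa> \<theta> x (embed (axis b 1)) \<partial>student_t \<theta>)"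
  unfolding fisher_info_def covariance_matrix_def score_nth[OF U] vec_lambda_beta dlog_mean[OF U embed_sym] diff_zero ..

lemma fisher_inner:
  assumes U: "\<theta> \<in> U"
  shows "s \<bullet> (fisher_info \<theta> *v s) = (\<integral>x. (dlog \<kappa> \<theta> x (embed s))\<^sup>2 \<partial>student_t \<theta>)"
proof -
  let ?e = "\<lambda>d x. dlog \<kappa> \<theta> x (embed (axis d 1))"
  have int: "integrable (student_t \<theta>) (\<lambda>x. s $ a * s $ b * (?e a x * ?e b x))" for a b
    by (intro integrable_mult_right dlog_product_integrable U)
  have "dlog \<kappa> \<theta> x (embed s) = (\<Sum>d\<in>UNIV. s $ d * ?e d x)" for x
    using score_inner[OF U, of s x] by (simp add: inner_vec_def score_nth[OF U])
  then have sq: "(dlog \<kappa> \<theta> x (embed s))\<^sup>2 = (\<Sum>a\<in>UNIV. \<Sum>b\<in>UNIV. s $ a * s $ b * (?e a x * ?e b x))" for x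
    by (simp add: power2_eq_square sum_product mult_ac)
  have "(\<integral>x. (dlog \<kappa> \<theta> x (embed s))\<^sup>2 \<partial>student_t \<theta>)
    = (\<integral>x. (\<Sum>a\<in>UNIV. \<Sum>b\<in>UNIV. s $ a * s $ b * (?e a x * ?e b x)) \<partial>student_t \<theta>)"
    unfolding sq ..
  also have "\<dots> = (\<Sum>a\<in>UNIV. \<integral>x. (\<Sum>b\<in>UNIV. s $ a * s $ b * (?e a x * ?e b x)) \<partial>student_t \<theta>)"
    by (rule Bochner_Integration.integral_sum) (rule Bochner_Integration.integrable_sum, rule int)
  also have "\<dots> = (\<Sum>a\<in>UNIV. \<Sum>b\<in>UNIV. \<integral>x. s $ a * s $ b * (?e a x * ?e b x) \<partial>student_t \<theta>)"
    by (rule sum.cong[OF refl], rule Bochner_Integration.integral_sum, rule int)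
  also have "\<dots> = (\<Sum>a\<in>UNIV. \<Sum>b\<in>UNIV. s $ a * (fisher_info \<theta> $ a $ b * s $ b))"
    unfolding fisher_nth[OF U] integral_mult_right_zero by (simp only: mult.assoc mult.left_commute mult.commute)
  also have "\<dots> = s \<bullet> (fisher_info \<theta> *v s)"
    unfolding inner_vec_def matrix_vector_mult_def inner_real_def by (simp add: sum_distrib_left)
  finally show ?thesis ..
qed

end

section \<open>Linear independence of the score components\<close>

text \<open>The set where \<open>g\<close> is nonzero is open and negligible, hence empty.\<close>

lemma continuous_AE_zero:
  fixes g :: "'a::euclidean_space \<Rightarrow> real"
  assumes g: "continuous_on UNIV g" and ae: "AE x in lborel. g x = 0"
  shows "g x = 0"
proof (rule ccontr)
  assume nz: "g x \<noteq> 0"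
  have op: "open {x. g x \<noteq> 0}" by (intro open_Collect_neq g continuous_intros)
  have "{x. g x \<noteq> 0} \<in> null_sets lborel"
    using ae op by (subst AE_iff_null_sets) auto
  then have "negligible {x. g x \<noteq> 0}"
    unfolding negligible_iff_null_sets by (rule null_sets_completionI)
  then show False using open_not_negligible[OF op] nz by blast
qed

text \<open>Terms are separated by their behaviour in \<open>x\<close>: only the degrees-of-freedom
  direction produces logarithmic growth, the rest being bounded along a ray. Once it is gone, the
  location part is odd and the scatter part even in the whitened variable. \<open>\<kappa>\<close>
  may be arbitrary, since it is constant in \<open>x\<close>.\<close>

lemma dlog_eq_0:
  fixes V :: "'k::finite param"
  assumes V: "V \<in> param_space" and sym: "transpose (scat h) = scat h" and zero: "\<And>x. dlog \<kappa> V x h = 0"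
  shows "h = 0"
proof -
  let ?k = "real CARD('k)"
  define a B c where "a = loc h" and "B = scat h" and "c = dof h"
  define \<nu> where "\<nu> = dof V"
  define q where "q w = w \<bullet> (scat V *v w)" for w
  define d where "d w = - 2 * (a \<bullet> w) - w \<bullet> (B *v w)" for w
  have S: "scat V \<in> spd" and \<nu>: "\<nu> > 0" using param_space_scat[OF V] param_space_dof[OF V] by (auto simp: \<nu>_def)
  have q0: "q w \<ge> 0" for w using spd_pos[OF S, of w] by (cases "w = 0") (auto simp: q_def)
  \<comment> \<open>Taking \<open>x\<close> as location plus scatter matrix times \<open>w\<close>
    makes \<open>w\<close> the whitened vector, so both quadratic forms become polynomials in a free
    variable.\<close>
  have eq: "\<kappa> V h = c / 2 * ln (\<nu> + q w) + (\<nu> + ?k) / 2 * ((c + d w) / (\<nu> + q w))" for w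
  proof -
    have w: "whiten V (loc V + scat V *v w) = w"
      by (simp add: whiten_def matrix_inv_mul_vec(2)[OF spd_invertible[OF S]])
    then have "quad V (loc V + scat V *v w) = q w"
      by (simp add: quad_def q_def symmetric_inner[OF spd_symmetric[OF S]])
    moreover have "dquad V (loc V + scat V *v w) h = d w" by (simp add: dquad_def w d_def a_def B_def)
    ultimately show ?thesis using zero[of "loc V + scat V *v w"] by (simp add: dlog_def c_def \<nu>_def)
  qed
  have "c = 0"
  proof (rule ccontr)
    assume "c \<noteq> 0"
    define e :: "'k rvec" where "e = axis undefined 1"
    have "e \<noteq> 0" by (simp add: e_def axis_eq_0_iff)
    then have q1: "q e > 0" using spd_pos[OF S] by (simp add: q_def)
    \<comment> \<open>Bounds the rational term along the ray: for \<open>t\<close> at least 1 its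
      numerator is at most \<open>t\<^sup>2\<close> times the sum in parentheses, and its
      denominator is at least \<open>t\<^sup>2 * q e\<close>.\<close>
    define m where "m = (\<bar>c\<bar> + 2 * \<bar>a \<bullet> e\<bar> + \<bar>e \<bullet> (B *v e)\<bar>) / q e"
    define M where "M = \<bar>\<kappa> V h\<bar> + (\<nu> + ?k) / 2 * m"
    have bd: "\<bar>c\<bar> / 2 * ln (t\<^sup>2 * q e) \<le> M" if t: "t \<ge> 1" for t
    proof -
      have qt: "q (t *\<^sub>R e) = t\<^sup>2 * q e" by (simp add: q_def matrix_vector_mult_scaleR power2_eq_square)
      have tt: "1 \<le> t\<^sup>2" "t \<le> t\<^sup>2" using one_le_power[OF t, of 2] self_le_power[OF t, of 2] by simp_all
      have "\<bar>c + d (t *\<^sub>R e)\<bar> \<le> \<bar>c\<bar> + 2 * (t * \<bar>a \<bullet> e\<bar>) + t\<^sup>2 * \<bar>e \<bullet> (B *v e)\<bar>"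
      proof -
        have "d (t *\<^sub>R e) = - 2 * (t * (a \<bullet> e)) - t\<^sup>2 * (e \<bullet> (B *v e))"
          by (simp add: d_def matrix_vector_mult_scaleR power2_eq_square)
        moreover have "\<bar>t * (a \<bullet> e)\<bar> = t * \<bar>a \<bullet> e\<bar>" "\<bar>t\<^sup>2 * (e \<bullet> (B *v e))\<bar> = t\<^sup>2 * \<bar>e \<bullet> (B *v e)\<bar>"
          using t by (simp_all add: abs_mult)
        ultimately show ?thesis by linarith
      qed
      also have "\<dots> \<le> t\<^sup>2 * \<bar>c\<bar> + 2 * (t\<^sup>2 * \<bar>a \<bullet> e\<bar>) + t\<^sup>2 * \<bar>e \<bullet> (B *v e)\<bar>"
        using mult_right_mono[OF tt(1), of "\<bar>c\<bar>"] mult_right_mono[OF tt(2), of "\<bar>a \<bullet> e\<bar>"] by simp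
      also have "\<dots> = m * (t\<^sup>2 * q e)" using q1 by (simp add: m_def field_simps)
      also have "\<dots> \<le> m * (\<nu> + q (t *\<^sub>R e))"
        using q1 \<nu> unfolding qt by (intro mult_left_mono) (auto simp: m_def)
      finally have "\<bar>(c + d (t *\<^sub>R e)) / (\<nu> + q (t *\<^sub>R e))\<bar> \<le> m"
        using \<nu> q0[of "t *\<^sub>R e"] by (simp add: abs_divide divide_le_eq)
      then have "(\<nu> + ?k) / 2 * \<bar>(c + d (t *\<^sub>R e)) / (\<nu> + q (t *\<^sub>R e))\<bar> \<le> (\<nu> + ?k) / 2 * m"
        using \<nu> by (intro mult_left_mono) auto
      moreover have "\<bar>(\<nu> + ?k) / 2 * ((c + d (t *\<^sub>R e)) / (\<nu> + q (t *\<^sub>R e)))\<bar> = (\<nu> + ?k) / 2 * \<bar>(c + d (t *\<^sub>R e)) / (\<nu> + q (t *\<^sub>R e))\<bar>"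
        using \<nu> by (simp only: abs_mult) simp
      ultimately have "\<bar>c / 2 * ln (\<nu> + q (t *\<^sub>R e))\<bar> \<le> M" using eq[of "t *\<^sub>R e"] unfolding M_def by linarith
      then have "\<bar>c\<bar> / 2 * ln (\<nu> + q (t *\<^sub>R e)) \<le> M"
        using abs_ge_self[of "ln (\<nu> + q (t *\<^sub>R e))"] mult_left_mono[of "ln (\<nu> + q (t *\<^sub>R e))" "\<bar>ln (\<nu> + q (t *\<^sub>R e))\<bar>" "\<bar>c\<bar> / 2"]
        by (simp add: abs_mult)
      moreover have "ln (t\<^sup>2 * q e) \<le> ln (\<nu> + q (t *\<^sub>R e))"
        using q1 \<nu> t unfolding qt by (subst ln_le_cancel_iff) (auto intro!: add_pos_nonneg mult_pos_pos)
      then have "\<bar>c\<bar> / 2 * ln (t\<^sup>2 * q e) \<le> \<bar>c\<bar> / 2 * ln (\<nu> + q (t *\<^sub>R e))" by (intro mult_left_mono) auto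
      ultimately show ?thesis by linarith
    qed
    \<comment> \<open>Chosen so that |c| / 2 times \<open>L\<close> is \<open>M + 1\<close>, which
      exceeds the bound \<open>M\<close>.\<close>
    define L where "L = 2 * (M + 1) / \<bar>c\<bar>"
    define t where "t = max 1 (exp L / q e)"
    have "exp L / q e \<le> t" by (simp add: t_def)
    then have "exp L \<le> t * q e" using q1 by (simp add: divide_le_eq)
    also have "\<dots> \<le> t\<^sup>2 * q e" using q1 by (intro mult_right_mono self_le_power) (auto simp: t_def)
    finally have "L \<le> ln (t\<^sup>2 * q e)" using q1 by (subst ln_ge_iff) (auto simp: t_def)
    then have "\<bar>c\<bar> / 2 * L \<le> \<bar>c\<bar> / 2 * ln (t\<^sup>2 * q e)" by (intro mult_left_mono) auto
    then have "\<bar>c\<bar> / 2 * L \<le> M" using bd[of t] by (simp add: t_def)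
    then show False using \<open>c \<noteq> 0\<close> by (simp add: L_def)
  qed
  \<comment> \<open>At \<open>w = 0\<close> the polynomial \<open>d\<close> vanishes and isolates
    the constant.\<close>
  have k0: "\<kappa> V h = 0" using eq[of 0] \<open>c = 0\<close> by (simp add: d_def)
  have d0: "d w = 0" for w
  proof -
    have "\<nu> + q w > 0" "\<nu> + ?k > 0" using \<nu> q0[of w] by auto
    then show ?thesis using eq[of w] \<open>c = 0\<close> k0 by auto
  qed
  \<comment> \<open>Comparing \<open>w\<close> with \<open>- w\<close> separates the odd linear part
    of \<open>d\<close> from its even quadratic part.\<close>
  have aw: "a \<bullet> w = 0" and Bw: "w \<bullet> (B *v w) = 0" for w
    using d0[of w] d0[of "- w"] by (simp_all add: d_def linear_neg[OF matrix_vector_mul_linear])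
  have "a = 0" using aw[of a] by simp
  moreover have "B = 0"
  proof -
    \<comment> \<open>Polarization: a symmetric form that vanishes on the diagonal vanishes
      identically.\<close>
    have "w \<bullet> (B *v z) = 0" for w z
      using Bw[of "w + z"] Bw[of w] Bw[of z] symmetric_inner[OF sym, of w z]
      by (simp add: B_def[symmetric] matrix_vector_right_distrib inner_add_left inner_add_right inner_commute[of "B *v w"])
    then have "B *v z = 0" for z using inner_eq_zero_iff by blast
    then show ?thesis by (simp add: matrix_eq)
  qed
  ultimately show ?thesis using \<open>c = 0\<close> by (simp add: a_def B_def c_def prod_eq_iff)
qed

context student_score
begin

text \<open>In a null direction the score would vanish almost surely, by positivity of the density
  almost everywhere for Lebesgue measure, and by continuity everywhere; linear independence excludes
  this.\<close>

lemma fisher_spd: "fisher_info V \<in> spd"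
proof -
  note VU = V_in_U
  have "transpose (fisher_info V) = fisher_info V"
    by (simp add: transpose_def vec_eq_iff fisher_nth[OF VU] mult.commute)
  moreover have "0 < s \<bullet> (fisher_info V *v s)" if s: "s \<noteq> 0" for s
  proof -
    have nn: "0 \<le> s \<bullet> (fisher_info V *v s)" unfolding fisher_inner[OF VU] by simp
    have "s \<bullet> (fisher_info V *v s) \<noteq> 0"
    proof
      assume "s \<bullet> (fisher_info V *v s) = 0"
      then have 0: "(\<integral>x. (dlog \<kappa> V x (embed s))\<^sup>2 \<partial>student_t V) = 0" unfolding fisher_inner[OF VU] .
      have int: "integrable (student_t V) (\<lambda>x. (dlog \<kappa> V x (embed s))\<^sup>2)"
        using dlog_product_integrable[OF VU] by (simp add: power2_eq_square)
      have "AE x in student_t V. (dlog \<kappa> V x (embed s))\<^sup>2 = 0"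
        using integral_nonneg_eq_0_iff_AE[OF int] 0 by simp
      then have "AE x in lborel. dlog \<kappa> V x (embed s) = 0"
        unfolding student_t_def by (subst (asm) AE_density) (auto simp: student_density_pos[OF U_param[OF VU]])
      then have "dlog \<kappa> V x (embed s) = 0" for x
        by (rule continuous_AE_zero[OF dlog_continuous[OF VU]])
      then have "embed s = 0" by (rule dlog_eq_0[OF U_param[OF VU] embed_sym])
      then show False using embed_eq_0 s by blast
    qed
    then show ?thesis using nn by simp
  qed
  ultimately show ?thesis by (simp add: spd_def)
qed

section \<open>Continuity of the Fisher information at \<open>V\<close>\<close>

text \<open>Remainder bounds alone make the derivative Lipschitz at \<open>V\<close>. With t =
  |\<theta> - V|, the value at \<open>\<theta> + t *\<^sub>R h\<close> is expanded from
  \<open>\<theta>\<close> and from \<open>V\<close>, and the value at \<open>\<theta>\<close> from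
  \<open>V\<close>. The three errors are of order t^2, while the derivatives enter with a factor
  \<open>t\<close>.\<close>

lemma dlog_near:
  assumes U: "\<theta> \<in> U" and U': "\<theta> + norm (\<theta> - V) *\<^sub>R h \<in> U"
  shows "\<bar>dlog \<kappa> \<theta> x h - dlog \<kappa> V x h\<bar> \<le> C * ((norm h)\<^sup>2 + (1 + norm h)\<^sup>2 + 1) * logw x * norm (\<theta> - V)"
proof (cases "\<theta> = V")
  case True then show ?thesis by simp
next
  case False
  define t where "t = norm (\<theta> - V)"
  have t: "t > 0" using False by (simp add: t_def)
  have lw: "logw x \<ge> 0" using logw_ge[of x] by linarith
  let ?l = "\<lambda>\<theta>. ln (student_density \<theta> x)"
  interpret l: linear "dlog \<kappa> \<theta> x" by (rule dlog_linear[OF U])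
  interpret v: linear "dlog \<kappa> V x" by (rule dlog_linear[OF V_in_U])
  have 1: "\<bar>?l (\<theta> + t *\<^sub>R h) - ?l \<theta> - t * dlog \<kappa> \<theta> x h\<bar> \<le> C * (t\<^sup>2 * (norm h)\<^sup>2) * logw x"
    using remainder[OF U U', of x] t by (simp add: l.scale t_def[symmetric] power_mult_distrib)
  have 2: "\<bar>?l (\<theta> + t *\<^sub>R h) - ?l V - (dlog \<kappa> V x (\<theta> - V) + t * dlog \<kappa> V x h)\<bar> \<le> C * (t\<^sup>2 * (1 + norm h)\<^sup>2) * logw x"
  proof -
    have e: "\<theta> + t *\<^sub>R h - V = (\<theta> - V) + t *\<^sub>R h" by simp
    have "norm (\<theta> + t *\<^sub>R h - V) \<le> t * (1 + norm h)"
      unfolding e using norm_triangle_ineq[of "\<theta> - V" "t *\<^sub>R h"] t by (simp add: t_def[symmetric] distrib_left)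
    then have "(norm (\<theta> + t *\<^sub>R h - V))\<^sup>2 \<le> t\<^sup>2 * (1 + norm h)\<^sup>2"
      unfolding power_mult_distrib[symmetric] by (rule power_mono) simp
    then have "C * (norm (\<theta> + t *\<^sub>R h - V))\<^sup>2 * logw x \<le> C * (t\<^sup>2 * (1 + norm h)\<^sup>2) * logw x"
      using C lw by (intro mult_right_mono mult_left_mono) auto
    moreover have "dlog \<kappa> V x (\<theta> + t *\<^sub>R h - V) = dlog \<kappa> V x (\<theta> - V) + t * dlog \<kappa> V x h"
      unfolding e v.add v.scale by simp
    ultimately show ?thesis using remainder[OF V_in_U U', of x] unfolding t_def[symmetric] by simp
  qed
  have 3: "\<bar>?l \<theta> - ?l V - dlog \<kappa> V x (\<theta> - V)\<bar> \<le> C * t\<^sup>2 * logw x"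
    using remainder[OF V_in_U U, of x] by (simp add: t_def)
  have "t * \<bar>dlog \<kappa> \<theta> x h - dlog \<kappa> V x h\<bar> = \<bar>t * dlog \<kappa> \<theta> x h - t * dlog \<kappa> V x h\<bar>"
    using t by (simp add: abs_mult flip: right_diff_distrib)
  also have "\<dots> \<le> C * (t\<^sup>2 * (norm h)\<^sup>2) * logw x + C * (t\<^sup>2 * (1 + norm h)\<^sup>2) * logw x + C * t\<^sup>2 * logw x"
    using 1 2 3 by linarith
  also have "\<dots> = t * (C * ((norm h)\<^sup>2 + (1 + norm h)\<^sup>2 + 1) * logw x * t)"
    by (simp add: power2_eq_square algebra_simps)
  finally show ?thesis using t by (simp add: t_def[symmetric])
qed

lemma dlog_tendsto:
  assumes U: "\<And>n. \<theta> n \<in> U" and lim: "\<theta> \<longlonglongrightarrow> V" and h: "transpose (scat h) = scat h"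
  shows "(\<lambda>n. dlog \<kappa> (\<theta> n) x h) \<longlonglongrightarrow> dlog \<kappa> V x h"
proof -
  have n0: "(\<lambda>n. norm (\<theta> n - V)) \<longlonglongrightarrow> 0" using lim by (simp add: LIM_zero_iff tendsto_norm_zero_iff)
  have "(\<lambda>n. norm (\<theta> n + norm (\<theta> n - V) *\<^sub>R h - V)) \<longlonglongrightarrow> norm (V + 0 *\<^sub>R h - V)"
    by (intro tendsto_intros lim n0)
  then have "\<forall>\<^sub>F n in sequentially. norm (\<theta> n + norm (\<theta> n - V) *\<^sub>R h - V) < \<delta>"
    using \<delta>(1) by (intro order_tendstoD(2)) auto
  then have "\<forall>\<^sub>F n in sequentially. norm (dlog \<kappa> (\<theta> n) x h - dlog \<kappa> V x h)
    \<le> C * ((norm h)\<^sup>2 + (1 + norm h)\<^sup>2 + 1) * logw x * norm (\<theta> n - V)"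
  proof eventually_elim
    case (elim n)
    have "transpose (scat (\<theta> n) + norm (\<theta> n - V) *\<^sub>R scat h) = scat (\<theta> n) + norm (\<theta> n - V) *\<^sub>R scat h"
      using h U_iff[of "\<theta> n"] U[of n] by (simp add: transpose_def vec_eq_iff)
    then have "\<theta> n + norm (\<theta> n - V) *\<^sub>R h \<in> U" using elim U_iff by simp
    from dlog_near[OF U this] show ?case by simp
  qed
  moreover have "(\<lambda>n. C * ((norm h)\<^sup>2 + (1 + norm h)\<^sup>2 + 1) * logw x * norm (\<theta> n - V)) \<longlonglongrightarrow> 0"
    using tendsto_mult[OF tendsto_const n0] by simp
  ultimately have "(\<lambda>n. dlog \<kappa> (\<theta> n) x h - dlog \<kappa> V x h) \<longlonglongrightarrow> 0" by (rule Lim_null_comparison)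
  then show ?thesis by (rule LIM_zero_cancel)
qed

lemma density_tendsto:
  assumes U: "\<And>n. \<theta> n \<in> U" and lim: "\<theta> \<longlonglongrightarrow> V"
  shows "(\<lambda>n. student_density (\<theta> n) x) \<longlonglongrightarrow> student_density V x"
proof -
  let ?l = "\<lambda>\<theta>. ln (student_density \<theta> x)"
  have n0: "(\<lambda>n. norm (\<theta> n - V)) \<longlonglongrightarrow> 0" using lim by (simp add: LIM_zero_iff tendsto_norm_zero_iff)
  have bd: "norm (?l (\<theta> n) - ?l V) \<le> C * (norm (\<theta> n - V))\<^sup>2 * logw x + C * norm (\<theta> n - V) * logw x" for n
    using remainder[OF V_in_U U, of n x] dlog_le[OF V_in_U, of x "\<theta> n - V"] unfolding real_norm_def by linarith
  have "(\<lambda>n. C * (norm (\<theta> n - V))\<^sup>2 * logw x + C * norm (\<theta> n - V) * logw x) \<longlonglongrightarrow> C * 0\<^sup>2 * logw x + C * 0 * logw x"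
    by (intro tendsto_intros n0)
  then have "(\<lambda>n. C * (norm (\<theta> n - V))\<^sup>2 * logw x + C * norm (\<theta> n - V) * logw x) \<longlonglongrightarrow> 0" by simp
  from Lim_null_comparison[OF always_eventually[OF allI[OF bd]] this]
  have "(\<lambda>n. ?l (\<theta> n) - ?l V) \<longlonglongrightarrow> 0" .
  then have "(\<lambda>n. ?l (\<theta> n)) \<longlonglongrightarrow> ?l V" by (rule LIM_zero_cancel)
  then have "(\<lambda>n. exp (?l (\<theta> n))) \<longlonglongrightarrow> exp (?l V)" by (rule tendsto_exp)
  then show ?thesis using student_density_pos[OF U_param[OF U]] student_density_pos[OF U_param[OF V_in_U]] by simp
qed

text \<open>Dominated convergence entrywise: densities and score components converge pointwise, and
  the envelope with its exponential factor dominates their products on all of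
  \<open>U\<close>.\<close>

lemma fisher_tendsto:
  assumes U: "\<And>n. \<theta> n \<in> U" and lim: "\<theta> \<longlonglongrightarrow> V"
  shows "(\<lambda>n. fisher_info (\<theta> n)) \<longlonglongrightarrow> fisher_info V"
proof (intro vec_tendstoI)
  fix a b :: "'k coord"
  define ha hb where "ha = embed (axis a 1)" and "hb = embed (axis b 1)"
  have sym: "transpose (scat ha) = scat ha" "transpose (scat hb) = scat hb" by (simp_all add: ha_def hb_def embed_sym)
  obtain Cd where Cd: "Cd > 0" "\<And>\<theta> x. \<theta> \<in> U \<Longrightarrow> student_density \<theta> x \<le> Cd * envelope x"
    using density_bound unfolding envelope_def by metis
  let ?\<eta> = "dof V / 8"
  \<comment> \<open>The two score bounds contribute the square of \<open>logw x\<close>, absorbed by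
    \<open>exp (?\<eta> * logw x)\<close> at the price of the factor 2! /
    \<open>?\<eta>\<^sup>2\<close>.\<close>
  define W where "W x = Cd * (C * norm ha * (C * norm hb)) * (2 / ?\<eta>\<^sup>2) * (envelope x * exp (?\<eta> * logw x))" for x
  have W: "integrable lborel W" 
  proof -
    obtain I where "integrable lborel (\<lambda>x. envelope x * exp (?\<eta> * logw x))" using envelope_exp by blast
    then show ?thesis unfolding W_def[abs_def] by (rule integrable_mult_right)
  qed
  let ?f = "\<lambda>\<theta> x. student_density \<theta> x * (dlog \<kappa> \<theta> x ha * dlog \<kappa> \<theta> x hb)"
  have meas: "?f \<theta> \<in> borel_measurable lborel" if "\<theta> \<in> U" for \<theta>
    using dlog_measurable[OF that, of ha] dlog_measurable[OF that, of hb] by measurable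
  have le: "norm (?f \<theta> x) \<le> W x" if \<theta>: "\<theta> \<in> U" for \<theta> x
  proof -
    have lw: "0 \<le> logw x" using logw_ge[of x] by linarith
    have "(?\<eta> * logw x) ^ 2 \<le> fact 2 * exp (?\<eta> * logw x)" using lw dofV by (intro power_le_fact_exp) simp
    then have "logw x * logw x \<le> 2 / ?\<eta>\<^sup>2 * exp (?\<eta> * logw x)"
      using dofV by (simp add: power_mult_distrib power2_eq_square field_simps)
    then have l2: "(C * norm ha * (C * norm hb)) * (logw x * logw x) \<le> (C * norm ha * (C * norm hb)) * (2 / ?\<eta>\<^sup>2 * exp (?\<eta> * logw x))"
      using C by (intro mult_left_mono) auto
    have "\<bar>dlog \<kappa> \<theta> x ha * dlog \<kappa> \<theta> x hb\<bar> \<le> (C * norm ha * logw x) * (C * norm hb * logw x)"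
      unfolding abs_mult using C lw by (intro mult_mono dlog_le \<theta>) auto
    also have "\<dots> = (C * norm ha * (C * norm hb)) * (logw x * logw x)" by simp
    finally have d: "\<bar>dlog \<kappa> \<theta> x ha * dlog \<kappa> \<theta> x hb\<bar> \<le> (C * norm ha * (C * norm hb)) * (2 / ?\<eta>\<^sup>2 * exp (?\<eta> * logw x))"
      using l2 by linarith
    have "norm (?f \<theta> x) = student_density \<theta> x * \<bar>dlog \<kappa> \<theta> x ha * dlog \<kappa> \<theta> x hb\<bar>"
      using student_density_pos[OF U_param[OF \<theta>], of x] by (simp add: abs_mult)
    also have "\<dots> \<le> (Cd * envelope x) * ((C * norm ha * (C * norm hb)) * (2 / ?\<eta>\<^sup>2 * exp (?\<eta> * logw x)))"
    proof (intro mult_mono d)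
      show "student_density \<theta> x \<le> Cd * envelope x" by (rule Cd(2)[OF \<theta>])
      show "0 \<le> Cd * envelope x" using Cd(1) by (simp add: envelope_def)
    qed simp
    also have "\<dots> = W x" unfolding W_def by (simp only: mult.assoc mult.left_commute)
    finally show ?thesis .
  qed
  have "(\<lambda>n. \<integral>x. ?f (\<theta> n) x \<partial>lborel) \<longlonglongrightarrow> (\<integral>x. ?f V x \<partial>lborel)"
    by (rule integral_dominated_convergence[OF meas[OF V_in_U] meas[OF U] W])
      (auto intro!: AE_I2 tendsto_mult density_tendsto dlog_tendsto U lim sym le[OF U, unfolded real_norm_def])
  moreover have "fisher_info \<theta> $ a $ b = (\<integral>x. ?f \<theta> x \<partial>lborel)" if "\<theta> \<in> U" for \<theta>
    unfolding fisher_nth[OF that] ha_def[symmetric] hb_def[symmetric]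
    using dlog_measurable[OF that] by (intro student_integral(2) that) measurable
  ultimately show "(\<lambda>n. fisher_info (\<theta> n) $ a $ b) \<longlonglongrightarrow> fisher_info V $ a $ b"
    using U V_in_U by simp
qed

text \<open>The array has a single constant: the summand with \<open>T\<close> bounds the score, and
  the one with \<open>T\<^sup>2\<close> reserves room for the remainder of the log ratio.\<close>

lemma student_score_array:
  assumes U: "\<And>n. n \<ge> n0 \<Longrightarrow> \<theta> n \<in> U" and sym: "\<And>n. n \<ge> n0 \<Longrightarrow> transpose (scat (h n)) = scat (h n)"
    and T: "\<And>n. norm (h n) \<le> T"
  shows "score_array (\<lambda>n. student_t (\<theta> n)) logw (dof V / 8) K (C * T + C * T\<^sup>2) n0 (\<lambda>n x. dlog \<kappa> (\<theta> n) x (h n))"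
proof (rule score_array.intro)
  have T0: "T \<ge> 0" using T[of 0] norm_ge_zero order_trans by blast
  then show "0 \<le> C * T + C * T\<^sup>2" using C by simp
  fix n assume n: "n \<ge> n0"
  show "exp_moment (student_t (\<theta> n)) logw (dof V / 8) K" by (rule moments[OF U[OF n]])
  show "(\<lambda>x. dlog \<kappa> (\<theta> n) x (h n)) \<in> borel_measurable (student_t (\<theta> n))" using dlog_measurable[OF U[OF n]] by simp
  show "(\<integral>x. dlog \<kappa> (\<theta> n) x (h n) \<partial>student_t (\<theta> n)) = 0" by (rule dlog_mean[OF U[OF n] sym[OF n]])
  fix x :: "'k rvec"
  have lw: "0 \<le> logw x" using logw_ge[of x] by linarith
  have "C * norm (h n) * logw x \<le> (C * T + C * T\<^sup>2) * logw x"
    using mult_left_mono[OF T[of n] C] C lw by (intro mult_right_mono) (auto intro: order_trans)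
  then show "\<bar>dlog \<kappa> (\<theta> n) x (h n)\<bar> \<le> (C * T + C * T\<^sup>2) * logw x"
    using dlog_le[OF U[OF n], of x "h n"] by linarith
qed

end

lemma linear_direction: "linear direction"
proof (rule linearI)
  fix a b :: "'k::{finite,linorder} param" and r :: real
  obtain a1 a2 a3 b1 b2 b3 where ab: "a = (a1, a2, a3)" "b = (b1, b2, b3)" by (cases a, cases b)
  show "direction (a + b) = direction a + direction b"
    by (simp add: ab stack_def vech_def vec_eq_iff split: sum.split)
  show "direction (r *\<^sub>R a) = r *\<^sub>R direction a"
    by (simp add: ab stack_def vech_def vec_eq_iff split: sum.split)
qed

section \<open>Likelihood ratios of Student samples\<close>

lemma prob_space_student_sample: "\<theta> \<in> param_space \<Longrightarrow> prob_space (student_sample n \<theta>)"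
  unfolding student_sample_def by (intro prob_space_PiM prob_space_student_t)

text \<open>Positivity of the densities makes the product of their ratios a density of one sample
  law with respect to the other. Radon-Nikodym derivatives are unique only up to null sets, hence
  the almost sure form.\<close>

lemma log_lr_student:
  assumes \<theta>: "\<theta> \<in> param_space" and \<theta>': "\<theta>' \<in> param_space"
  shows "AE \<omega> in student_sample n \<theta>. log_lr (student_sample n \<theta>') (student_sample n \<theta>) \<omega>
    = (\<Sum>j=1..n. ln (student_density \<theta>' (\<omega> j)) - ln (student_density \<theta> (\<omega> j)))"
proof -
  note pos = student_density_pos[OF \<theta>] student_density_pos[OF \<theta>']
  have ne: "student_density \<theta> x \<noteq> 0" "student_density \<theta>' x \<noteq> 0" for x
    using pos(1)[of x] pos(2)[of x] by auto
  let ?g = "\<lambda>x. ennreal (student_density \<theta>' x / student_density \<theta> x)"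
  interpret P: prob_space "student_sample n \<theta>" by (rule prob_space_student_sample[OF \<theta>])
  have "ennreal (student_density \<theta> x) * ?g x = ennreal (student_density \<theta>' x)" for x
    using pos[of x] by (simp add: ennreal_mult[symmetric] less_imp_le less_imp_neq[THEN not_sym])
  then have "student_t \<theta>' = density (student_t \<theta>) ?g"
    unfolding student_t_def by (subst density_density_eq) auto
  then have eq: "student_sample n \<theta>' = density (student_sample n \<theta>) (\<lambda>\<omega>. \<Prod>j\<in>{1..n}. ?g (\<omega> j))"
    unfolding student_sample_def
    by (intro density_PiM_prod prob_space_student_t \<theta> \<theta>') auto
  have "AE \<omega> in student_sample n \<theta>. (\<Prod>j\<in>{1..n}. ?g (\<omega> j)) = RN_deriv (student_sample n \<theta>) (student_sample n \<theta>') \<omega>"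
    by (rule P.RN_deriv_unique[OF _ eq[symmetric]]) (simp add: student_sample_def)
  then show ?thesis
  proof eventually_elim
    case (elim \<omega>)
    have "(\<Prod>j\<in>{1..n}. ?g (\<omega> j)) = ennreal (\<Prod>j\<in>{1..n}. student_density \<theta>' (\<omega> j) / student_density \<theta> (\<omega> j))"
      using pos by (intro prod_ennreal) (simp add: less_imp_le)
    then have "log_lr (student_sample n \<theta>') (student_sample n \<theta>) \<omega> = ln (\<Prod>j\<in>{1..n}. student_density \<theta>' (\<omega> j) / student_density \<theta> (\<omega> j))"
      unfolding log_lr_def elim[symmetric] using pos by (simp add: prod_nonneg less_imp_le)
    also have "\<dots> = (\<Sum>j=1..n. ln (student_density \<theta>' (\<omega> j) / student_density \<theta> (\<omega> j)))"
      using ne by (intro ln_prod) auto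
    finally show ?case by (simp add: ln_div ne)
  qed
qed

section \<open>Uniform local asymptotic normality\<close>

text \<open>The vectors need not converge: they stay in a ball, on which convergence of matrices is
  uniform.\<close>

lemma inner_matrix_tendsto:
  fixes G :: "nat \<Rightarrow> real^'n^'n"
  assumes G: "G \<longlonglongrightarrow> A" and s: "\<And>n. norm (s n) \<le> T"
  shows "(\<lambda>n. s n \<bullet> (A *v s n) - s n \<bullet> (G n *v s n)) \<longlonglongrightarrow> 0"
proof (rule Lim_null_comparison)
  have T: "T \<ge> 0" using s[of 0] norm_ge_zero order_trans by blast
  show "\<forall>\<^sub>F n in sequentially. norm (s n \<bullet> (A *v s n) - s n \<bullet> (G n *v s n)) \<le> T * (norm (G n - A) * T)"
  proof (intro always_eventually allI)
    fix n
    have "s n \<bullet> (A *v s n) - s n \<bullet> (G n *v s n) = s n \<bullet> ((A - G n) *v s n)"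
      by (simp add: matrix_vector_mult_diff_rdistrib inner_diff_right)
    also have "\<bar>\<dots>\<bar> \<le> norm (s n) * norm ((A - G n) *v s n)" by (rule Cauchy_Schwarz_ineq2)
    also have "\<dots> \<le> T * (norm (A - G n) * T)"
    proof (intro mult_mono s T)
      show "norm ((A - G n) *v s n) \<le> norm (A - G n) * T"
        by (rule order_trans[OF norm_matrix_vector_le mult_left_mono[OF s]]) simp
    qed simp
    finally show "norm (s n \<bullet> (A *v s n) - s n \<bullet> (G n *v s n)) \<le> T * (norm (G n - A) * T)"
      by (simp add: norm_minus_commute)
  qed
  have "(\<lambda>n. norm (G n - A)) \<longlonglongrightarrow> 0" using G by (simp add: LIM_zero_iff tendsto_norm_zero_iff)
  then have "(\<lambda>n. T * (norm (G n - A) * T)) \<longlonglongrightarrow> T * (0 * T)" by (intro tendsto_intros)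
  then show "(\<lambda>n. T * (norm (G n - A) * T)) \<longlonglongrightarrow> 0" by simp
qed

lemma central_seq_measurable:
  fixes \<theta> :: "'k::{finite,linorder} param"
  assumes "score \<theta> \<in> borel_measurable borel"
  shows "central_seq n \<theta> \<in> borel_measurable (student_sample n \<theta>)"
proof -
  have [measurable]: "(\<lambda>\<omega>. score \<theta> (\<omega> j)) \<in> borel_measurable (student_sample n \<theta>)" if "j \<in> {1..n}" for j
  proof -
    have "(\<lambda>\<omega>. \<omega> j) \<in> measurable (student_sample n \<theta>) (student_t \<theta>)"
      unfolding student_sample_def by (rule measurable_component_singleton[OF that])
    then have "(\<lambda>\<omega>. \<omega> j) \<in> measurable (student_sample n \<theta>) borel"
      using measurable_cong_sets[OF refl sets_student_t] by blast
    from measurable_compose[OF this assms] show ?thesis .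
  qed
  show ?thesis unfolding central_seq_def[abs_def] by measurable
qed

context student_score
begin

text \<open>The array expansion has the score variance at \<open>\<theta> n\<close> in its quadratic
  term, and continuity of the information moves it to \<open>V\<close>. Symmetry of
  \<open>\<tau> n\<close> lets \<open>embed\<close> recover it from
  \<open>direction\<close>.\<close>

lemma log_lr_expansion:
  assumes U: "\<And>n. n \<ge> n0 \<Longrightarrow> \<theta> n \<in> U" and U': "\<And>n. n \<ge> n0 \<Longrightarrow> \<theta> n + (1 / sqrt (real n)) *\<^sub>R \<tau> n \<in> U"
    and lim: "\<theta> \<longlonglongrightarrow> V" and T: "\<And>n. norm (\<tau> n) \<le> T" and sym: "\<And>n. n \<ge> n0 \<Longrightarrow> transpose (scat (\<tau> n)) = scat (\<tau> n)"
    and n0: "n0 \<ge> 1"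
  shows "small_oP (\<lambda>n. student_sample n (\<theta> n))
           (\<lambda>n \<omega>. log_lr (student_sample n (\<theta> n + (1 / sqrt (real n)) *\<^sub>R \<tau> n)) (student_sample n (\<theta> n)) \<omega>
                  - (direction (\<tau> n) \<bullet> central_seq n (\<theta> n) \<omega>
                     - 1 / 2 * (direction (\<tau> n) \<bullet> (fisher_info V *v direction (\<tau> n)))))"
    (is "small_oP ?M ?R")
  unfolding small_oP_def
proof (intro conjI allI impI)
  have [measurable]: "central_seq n (\<theta> n) \<in> borel_measurable (?M n)" if "n \<ge> n0" for n
    by (rule central_seq_measurable[OF score_measurable[OF U[OF that]]])
  have R_meas: "?R n \<in> borel_measurable (?M n)" if "n \<ge> n0" for n
    using that unfolding log_lr_def by measurable
  then show "\<forall>\<^sub>F n in sequentially. ?R n \<in> borel_measurable (?M n)"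
    using eventually_ge_at_top[of n0] by (rule eventually_mono[rotated])
  define s where "s n x = dlog \<kappa> (\<theta> n) x (\<tau> n)" for n x
  define r where "r n x = ln (student_density (\<theta> n + (1 / sqrt (real n)) *\<^sub>R \<tau> n) x) - ln (student_density (\<theta> n) x)" for n x
  define v where "v n = (\<integral>x. (s n x)\<^sup>2 \<partial>student_t (\<theta> n))" for n
  define \<Gamma>\<tau> where "\<Gamma>\<tau> n = direction (\<tau> n) \<bullet> (fisher_info V *v direction (\<tau> n))" for n
  have T0: "T \<ge> 0" using T[of 0] norm_ge_zero order_trans by blast
  interpret A: score_array "\<lambda>n. student_t (\<theta> n)" logw "dof V / 8" K "C * T + C * T\<^sup>2" n0 s
    unfolding s_def[abs_def] by (rule student_score_array[OF U sym T])
  have s_dir: "direction (\<tau> n) \<bullet> score (\<theta> n) x = s n x" if "n \<ge> n0" for n x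
    unfolding s_def score_inner[OF U[OF that]] embed_direction[OF sym[OF that]] ..
  have r_meas: "r n \<in> borel_measurable (student_t (\<theta> n))" for n unfolding r_def by measurable
  have r_bd: "\<bar>r n x - s n x / sqrt (real n)\<bar> \<le> (C * T + C * T\<^sup>2) * logw x / real n" if n: "n \<ge> n0" for n x
  proof -
    have n1: "real n > 0" using n n0 by simp
    have lw: "0 \<le> logw x" using logw_ge[of x] by linarith
    have "\<bar>r n x - s n x / sqrt (real n)\<bar> \<le> C * (norm (\<tau> n))\<^sup>2 / real n * logw x"
      using remainder[OF U[OF n] U'[OF n], of x] n1
      by (simp add: r_def s_def linear_scale[OF dlog_linear[OF U[OF n]]] power_mult_distrib power_divide)
    also have "\<dots> \<le> (C * T + C * T\<^sup>2) / real n * logw x"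
    proof (intro mult_right_mono divide_right_mono)
      have "C * (norm (\<tau> n))\<^sup>2 \<le> C * T\<^sup>2" using C T[of n] by (intro mult_left_mono power_mono) auto
      then show "C * (norm (\<tau> n))\<^sup>2 \<le> C * T + C * T\<^sup>2" using C T0 by (simp add: add_increasing)
    qed (use n1 lw in auto)
    finally show ?thesis by simp
  qed
  have one: "(\<integral>x. exp (r n x) \<partial>student_t (\<theta> n)) = 1" if "n \<ge> n0" for n
    unfolding r_def by (rule density_ratio_integral[OF U[OF that] U'[OF that]])
  have v_lim: "(\<lambda>n. \<Gamma>\<tau> n - v n) \<longlonglongrightarrow> 0"
  proof -
    \<comment> \<open>Early members, which may lie outside \<open>U\<close>, are replaced by
      \<open>V\<close>, so that the continuity of the information applies to the whole
      sequence.\<close>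
    define \<theta>' where "\<theta>' n = (if n \<ge> n0 then \<theta> n else V)" for n
    have ev: "\<forall>\<^sub>F n in sequentially. \<theta> n = \<theta>' n"
      using eventually_ge_at_top[of n0] by eventually_elim (simp add: \<theta>'_def)
    have "\<theta>' \<longlonglongrightarrow> V" using Lim_transform_eventually[OF lim ev] .
    moreover have "\<theta>' n \<in> U" for n using U V_in_U by (simp add: \<theta>'_def)
    ultimately have F: "(\<lambda>n. fisher_info (\<theta>' n)) \<longlonglongrightarrow> fisher_info V" by (intro fisher_tendsto)
    obtain B where B: "\<And>x. norm (direction x :: 'k coord rvec) \<le> B * norm x" "B > 0"
      using linear_bounded_pos[OF linear_direction] by blast
    have "norm (direction (\<tau> n)) \<le> B * T" for n
      using order_trans[OF B(1) mult_left_mono[OF T]] B(2) by (simp add: less_imp_le)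
    from inner_matrix_tendsto[OF F this]
    have "(\<lambda>n. \<Gamma>\<tau> n - direction (\<tau> n) \<bullet> (fisher_info (\<theta>' n) *v direction (\<tau> n))) \<longlonglongrightarrow> 0" by (simp only: \<Gamma>\<tau>_def)
    moreover have "\<forall>\<^sub>F n in sequentially. \<Gamma>\<tau> n - direction (\<tau> n) \<bullet> (fisher_info (\<theta>' n) *v direction (\<tau> n)) = \<Gamma>\<tau> n - v n"
      using eventually_ge_at_top[of n0]
    proof eventually_elim
      case (elim n)
      show ?case using elim fisher_inner[OF U[OF elim], of "direction (\<tau> n)"]
        by (simp add: \<theta>'_def v_def s_def embed_direction[OF sym[OF elim]])
    qed
    ultimately show ?thesis by (rule Lim_transform_eventually)
  qed
  fix \<epsilon> :: real assume \<epsilon>: "\<epsilon> > 0"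
  \<comment> \<open>One half of \<open>\<epsilon>\<close> is for the random error, the other for the
    deterministic change of information.\<close>
  let ?E = "\<lambda>n. {\<omega> \<in> space (?M n). \<epsilon> / 2 < \<bar>(\<Sum>j=1..n. r n (\<omega> j)) - ((\<Sum>j=1..n. s n (\<omega> j)) / sqrt (real n) - v n / 2)\<bar>}"
  have E0: "(\<lambda>n. measure (?M n) (?E n)) \<longlonglongrightarrow> 0"
    unfolding student_sample_def v_def
    by (rule A.log_likelihood_expansion[OF r_meas r_bd one half_gt_zero[OF \<epsilon>]])
  have "\<forall>\<^sub>F n in sequentially. dist (\<Gamma>\<tau> n - v n) 0 < \<epsilon>"
    using v_lim \<epsilon> by (rule tendstoD)
  then have "\<forall>\<^sub>F n in sequentially. norm (measure (?M n) {\<omega> \<in> space (?M n). \<epsilon> < \<bar>?R n \<omega>\<bar>}) \<le> measure (?M n) (?E n)"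
    using eventually_ge_at_top[of n0]
  proof eventually_elim
    case (elim n)
    interpret P: prob_space "?M n" by (rule prob_space_student_sample[OF U_param[OF U[OF elim(2)]]])
    have [measurable]: "s n \<in> borel_measurable (student_t (\<theta> n))" by (rule A.s_meas[OF elim(2)])
    note [measurable] = r_meas[of n]
    have E_meas: "?E n \<in> sets (?M n)" unfolding student_sample_def by measurable
    \<comment> \<open>The inclusion holds only almost surely, because the likelihood ratio is
      identified only up to a null set; this suffices for comparing probabilities.\<close>
    have "AE \<omega> in ?M n. \<omega> \<in> {\<omega> \<in> space (?M n). \<epsilon> < \<bar>?R n \<omega>\<bar>} \<longrightarrow> \<omega> \<in> ?E n"
      using log_lr_student[OF U_param[OF U[OF elim(2)]] U_param[OF U'[OF elim(2)]], of n]
    proof eventually_elim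
      case (elim \<omega>)
      have c: "direction (\<tau> n) \<bullet> central_seq n (\<theta> n) \<omega> = (\<Sum>j=1..n. s n (\<omega> j)) / sqrt (real n)"
        using s_dir[OF \<open>n \<ge> n0\<close>] by (simp add: central_seq_def inner_sum_right)
      have eq: "?R n \<omega> = (\<Sum>j=1..n. r n (\<omega> j)) - ((\<Sum>j=1..n. s n (\<omega> j)) / sqrt (real n) - v n / 2) + (\<Gamma>\<tau> n - v n) / 2"
        unfolding elim c r_def \<Gamma>\<tau>_def by (simp add: field_simps)
      have small: "\<bar>(\<Gamma>\<tau> n - v n) / 2\<bar> < \<epsilon> / 2" using \<open>dist (\<Gamma>\<tau> n - v n) 0 < \<epsilon>\<close> by (simp add: dist_real_def)
      have tri: "\<epsilon> / 2 < \<bar>X\<bar>" if "\<epsilon> < \<bar>X + Y\<bar>" "\<bar>Y\<bar> < \<epsilon> / 2" for X Y :: real using that by linarith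
      show ?case
      proof (intro impI)
        assume "\<omega> \<in> {\<omega> \<in> space (?M n). \<epsilon> < \<bar>?R n \<omega>\<bar>}"
        then have "\<omega> \<in> space (?M n)" "\<epsilon> < \<bar>?R n \<omega>\<bar>" by blast+
        then show "\<omega> \<in> ?E n" using tri[OF _ small] unfolding eq by blast
      qed
    qed
    then have "measure (?M n) {\<omega> \<in> space (?M n). \<epsilon> < \<bar>?R n \<omega>\<bar>} \<le> measure (?M n) (?E n)"
      by (rule P.finite_measure_mono_AE[OF _ E_meas])
    then show ?case by simp
  qed
  then show "(\<lambda>n. measure (?M n) {\<omega> \<in> space (?M n). \<epsilon> < \<bar>?R n \<omega>\<bar>}) \<longlonglongrightarrow> 0"
    by (rule Lim_null_comparison) (rule E0)
qed

text \<open>The inner product of \<open>t\<close> with the central sequence is the normalized sum of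
  the scores along \<open>embed t\<close>, so the array limit gives the characteristic function at
  every frequency \<open>t\<close>.\<close>

lemma central_seq_law:
  assumes U: "\<And>n. n \<ge> n0 \<Longrightarrow> \<theta> n \<in> U" and lim: "\<theta> \<longlonglongrightarrow> V"
  shows "conv_in_law (\<lambda>n. student_sample n (\<theta> n)) (\<lambda>n. central_seq n (\<theta> n)) (mvnormal 0 (fisher_info V))"
  unfolding conv_in_law_def
proof (intro conjI allI impI)
  let ?P = "mvnormal 0 (fisher_info V)"
  have meas: "central_seq n (\<theta> n) \<in> borel_measurable (student_sample n (\<theta> n))" if "n \<ge> n0" for n
    by (rule central_seq_measurable[OF score_measurable[OF U[OF that]]])
  then show "\<forall>\<^sub>F n in sequentially. central_seq n (\<theta> n) \<in> borel_measurable (student_sample n (\<theta> n))"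
    using eventually_ge_at_top[of n0] by (rule eventually_mono[rotated])
  \<comment> \<open>The default \<open>?P\<close> for early indices makes every \<open>N n\<close> a
    probability law on the Borel sets without affecting the limit.\<close>
  define N where "N n = (if n \<ge> n0 then distr (student_sample n (\<theta> n)) borel (central_seq n (\<theta> n)) else ?P)" for n
  have sP: "sets ?P = sets borel" by (simp add: mvnormal_def)
  define \<theta>' where "\<theta>' n = (if n \<ge> n0 then \<theta> n else V)" for n
  have ev: "\<forall>\<^sub>F n in sequentially. \<theta> n = \<theta>' n"
    using eventually_ge_at_top[of n0] by eventually_elim (simp add: \<theta>'_def)
  have "\<theta>' \<longlonglongrightarrow> V" using Lim_transform_eventually[OF lim ev] .
  moreover have "\<theta>' n \<in> U" for n using U V_in_U by (simp add: \<theta>'_def)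
  ultimately have F: "(\<lambda>n. fisher_info (\<theta>' n)) \<longlonglongrightarrow> fisher_info V" by (intro fisher_tendsto)
  interpret char_convergence N ?P
  proof (rule char_convergence.intro)
    show "prob_space (N n)" for n
      unfolding N_def using prob_space_mvnormal[OF fisher_spd]
      by (auto intro!: prob_space.prob_space_distr prob_space_student_sample U_param U meas)
    show "sets (N n) = sets borel" for n by (simp add: N_def sP)
    show "prob_space ?P" by (rule prob_space_mvnormal[OF fisher_spd])
    show "sets ?P = sets borel" by (rule sP)
    fix t :: "'k coord rvec"
    define s where "s n x = dlog \<kappa> (\<theta> n) x (embed t)" for n x
    interpret A: score_array "\<lambda>n. student_t (\<theta> n)" logw "dof V / 8" K "C * norm (embed t) + C * (norm (embed t))\<^sup>2" n0 s
      unfolding s_def[abs_def] by (rule student_score_array[OF U embed_sym order_refl])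
    have "(\<lambda>n. t \<bullet> (fisher_info V *v t) - t \<bullet> (fisher_info (\<theta>' n) *v t)) \<longlonglongrightarrow> 0"
      by (rule inner_matrix_tendsto[OF F order_refl])
    then have "(\<lambda>n. t \<bullet> (fisher_info V *v t) - (t \<bullet> (fisher_info V *v t) - t \<bullet> (fisher_info (\<theta>' n) *v t))) \<longlonglongrightarrow> t \<bullet> (fisher_info V *v t) - 0"
      by (intro tendsto_diff tendsto_const)
    then have "(\<lambda>n. t \<bullet> (fisher_info (\<theta>' n) *v t)) \<longlonglongrightarrow> t \<bullet> (fisher_info V *v t)" by simp
    moreover have "\<forall>\<^sub>F n in sequentially. t \<bullet> (fisher_info (\<theta>' n) *v t) = (\<integral>x. (s n x)\<^sup>2 \<partial>student_t (\<theta> n))"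
      using eventually_ge_at_top[of n0] by eventually_elim (simp add: \<theta>'_def s_def fisher_inner[OF U])
    ultimately have "(\<lambda>n. \<integral>x. (s n x)\<^sup>2 \<partial>student_t (\<theta> n)) \<longlonglongrightarrow> t \<bullet> (fisher_info V *v t)"
      by (rule Lim_transform_eventually)
    from A.char_normalized_sum[OF this]
    have "(\<lambda>n. \<integral>\<omega>. iexp ((\<Sum>j=1..n. s n (\<omega> j)) / sqrt (real n)) \<partial>student_sample n (\<theta> n))
      \<longlonglongrightarrow> (\<integral>x. iexp (t \<bullet> x) \<partial>?P)"
      unfolding student_sample_def char_mvnormal[OF fisher_spd] .
    moreover have "\<forall>\<^sub>F n in sequentially. (\<integral>\<omega>. iexp ((\<Sum>j=1..n. s n (\<omega> j)) / sqrt (real n)) \<partial>student_sample n (\<theta> n)) = (\<integral>x. iexp (t \<bullet> x) \<partial>N n)"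
      using eventually_ge_at_top[of n0]
    proof eventually_elim
      case (elim n)
      have "t \<bullet> central_seq n (\<theta> n) \<omega> = (\<Sum>j=1..n. s n (\<omega> j)) / sqrt (real n)" for \<omega>
        by (simp add: central_seq_def inner_sum_right score_inner[OF U[OF elim]] s_def)
      then show ?case using elim by (simp add: N_def integral_distr[OF meas[OF elim]])
    qed
    ultimately show "(\<lambda>n. \<integral>x. iexp (t \<bullet> x) \<partial>N n) \<longlonglongrightarrow> (\<integral>x. iexp (t \<bullet> x) \<partial>?P)"
      by (rule Lim_transform_eventually)
  qed
  fix g :: "'k coord rvec \<Rightarrow> real" assume g: "continuous_on UNIV g" "bounded (range g)"
  have [measurable]: "g \<in> borel_measurable borel" using g(1) by (rule borel_measurable_continuous_onI)
  have "\<forall>\<^sub>F n in sequentially. (\<integral>y. g y \<partial>N n) = (\<integral>\<omega>. g (central_seq n (\<theta> n) \<omega>) \<partial>student_sample n (\<theta> n))"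
    using eventually_ge_at_top[of n0] by eventually_elim (simp add: N_def integral_distr[OF meas])
  then show "(\<lambda>n. \<integral>\<omega>. g (central_seq n (\<theta> n) \<omega>) \<partial>student_sample n (\<theta> n)) \<longlonglongrightarrow> (\<integral>y. g y \<partial>?P)"
    by (rule Lim_transform_eventually[OF tendsto_bounded_continuous[OF g]])
qed

end

theorem theorem1:
  fixes V :: "'k::{finite,linorder} param"
    and Vn \<tau> :: "nat \<Rightarrow> 'k param"
  assumes "V \<in> param_space"
    and "\<And>n. n \<ge> 1 \<Longrightarrow> Vn n \<in> param_space"
    and "(\<lambda>n. norm (Vn n - V)) \<in> O(\<lambda>n. 1 / sqrt (real n))"
    and "bounded (range \<tau>)"
    and "\<And>n. n \<ge> 1 \<Longrightarrow> Vn n + (1 / sqrt (real n)) *\<^sub>R \<tau> n \<in> param_space"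
  shows "small_oP (\<lambda>n. student_sample n (Vn n))
           (\<lambda>n \<omega>. log_lr (student_sample n (Vn n + (1 / sqrt (real n)) *\<^sub>R \<tau> n))
                         (student_sample n (Vn n)) \<omega>
                  - (direction (\<tau> n) \<bullet> central_seq n (Vn n) \<omega>
                     - 1 / 2 * (direction (\<tau> n) \<bullet> (fisher_info V *v direction (\<tau> n)))))
       \<and> conv_in_law (\<lambda>n. student_sample n (Vn n))
           (\<lambda>n. central_seq n (Vn n)) (mvnormal 0 (fisher_info V))"
proof -
  obtain c \<delta> \<kappa> C K where "student_score V c \<delta> \<kappa> C K" using student_score_exists[OF assms(1)] by blast
  then interpret student_score V c \<delta> \<kappa> C K .
  have sq0: "(\<lambda>n. 1 / sqrt (real n)) \<longlonglongrightarrow> 0"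
    by (intro tendsto_divide_0[OF tendsto_const] filterlim_at_top_imp_at_infinity
        filterlim_compose[OF sqrt_at_top] filterlim_real_sequentially)
  obtain B where "\<forall>\<^sub>F n in sequentially. norm (norm (Vn n - V)) \<le> B * norm (1 / sqrt (real n))"
    using assms(3) by (elim landau_o.bigE)
  moreover have "(\<lambda>n. B * norm (1 / sqrt (real n))) \<longlonglongrightarrow> 0"
    using tendsto_mult[OF tendsto_const tendsto_norm[OF sq0], of B] by simp
  ultimately have "(\<lambda>n. norm (Vn n - V)) \<longlonglongrightarrow> 0" by (rule Lim_null_comparison)
  then have lim: "Vn \<longlonglongrightarrow> V" by (simp add: LIM_zero_iff tendsto_norm_zero_iff)
  obtain T where T: "\<And>n. norm (\<tau> n) \<le> T" using assms(4) by (auto simp: bounded_iff)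
  have T0: "T \<ge> 0" using T[of 0] norm_ge_zero order_trans by blast
  have "(\<lambda>n. (1 / sqrt (real n)) *\<^sub>R \<tau> n) \<longlonglongrightarrow> 0"
  proof (rule Lim_null_comparison)
    show "\<forall>\<^sub>F n in sequentially. norm ((1 / sqrt (real n)) *\<^sub>R \<tau> n) \<le> norm (1 / sqrt (real n)) * T"
      by (intro always_eventually allI) (simp only: norm_scaleR real_norm_def, intro mult_left_mono T, simp)
    show "(\<lambda>n. norm (1 / sqrt (real n)) * T) \<longlonglongrightarrow> 0"
      using tendsto_mult[OF tendsto_norm[OF sq0] tendsto_const, of T] by simp
  qed
  from tendsto_add[OF lim this] have lim': "(\<lambda>n. Vn n + (1 / sqrt (real n)) *\<^sub>R \<tau> n) \<longlonglongrightarrow> V" by simp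
  have "\<forall>\<^sub>F n in sequentially. dist (Vn n) V < \<delta>" "\<forall>\<^sub>F n in sequentially. dist (Vn n + (1 / sqrt (real n)) *\<^sub>R \<tau> n) V < \<delta>"
    using tendstoD[OF lim \<delta>(1)] tendstoD[OF lim' \<delta>(1)] by auto
  from eventually_conj[OF this]
  obtain m where m: "\<And>n. n \<ge> m \<Longrightarrow> dist (Vn n) V < \<delta> \<and> dist (Vn n + (1 / sqrt (real n)) *\<^sub>R \<tau> n) V < \<delta>"
    unfolding eventually_sequentially by blast
  \<comment> \<open>At least 1, where the hypotheses begin; at 0 the scaling factor has the default
    value 0 and would say nothing about \<open>\<tau>\<close>.\<close>
  define n0 where "n0 = max 1 m"
  have U: "Vn n \<in> U" if "n \<ge> n0" for n
    using m[of n] assms(2)[of n] that by (simp add: n0_def pball_def dist_norm)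
  have U': "Vn n + (1 / sqrt (real n)) *\<^sub>R \<tau> n \<in> U" if "n \<ge> n0" for n
    using m[of n] assms(5)[of n] that by (simp add: n0_def pball_def dist_norm)
  \<comment> \<open>Both the base point and the shifted point have symmetric scatter matrices, so
    their difference, a nonzero multiple of the scatter part of \<open>\<tau> n\<close>, is
    symmetric as well.\<close>
  have sym: "transpose (scat (\<tau> n)) = scat (\<tau> n)" if n: "n \<ge> n0" for n
  proof -
    have "transpose (scat (Vn n)) = scat (Vn n)" using U[OF n] U_iff by blast
    moreover have "transpose (scat (Vn n) + (1 / sqrt (real n)) *\<^sub>R scat (\<tau> n)) = scat (Vn n) + (1 / sqrt (real n)) *\<^sub>R scat (\<tau> n)"
      using U'[OF n] U_iff by simp
    moreover have "real n > 0" using n by (simp add: n0_def)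
    ultimately show ?thesis by (simp add: transpose_def vec_eq_iff)
  qed
  have "n0 \<ge> 1" by (simp add: n0_def)
  from log_lr_expansion[OF U U' lim T sym this] central_seq_law[OF U lim] show ?thesis by blast
qed

end
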